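(* Let $X$ be an object in a cartesian Rosický tangent category with scalar $R$-multiplication. Then the tangent bundle $TX\to X$ with the anchor $\mathrm{id}:TX\to TX$ and the Lie bracket of vector fields is an abstract Lie algebroid.
   Context: **Rosický tangent structure.** A Rosický tangent structure on a category $\mathcal{C}$ consists of a functor $T:\mathcal{C}\to\mathcal{C}$ and natural transformations $\pi:T\to 1$, $0:1\to T$, $+:T_2\to T$, $\lambda:T\to T^2$, $\tau:T^2\to T^2$ such that for all objects $X$: (i) for all $k\ge1$ the fiber product $T_kX=TX\times_X\cdots\times_XTX$ of $k$ copies of $\pi_X:TX\to X$ exists and is preserved by $T$, i.e. the natural morphism $\nu_{k,X}:T(T_kX)\to T^2X\times_{TX}^{T\pi_X,T\pi_X}\cdots\times_{TX}^{T\pi_X,T\pi_X}T^2X$ is an isomorphism; (ii) $\pi_X:TX\to X$ with addition $+_X$ and zero $0_X$ is an abelian group object in the slice category $\mathcal{C}_{/X}$; let $-_X:T_2X\to TX$ denote the fiberwise difference; (iii) $\tau_X\circ\tau_X=\mathrm{id}$, $\tau_{TX}\circ T\tau_X\circ\tau_{TX}=T\tau_X\circ\tau_{TX}\circ T\tau_X$, $\pi_{TX}\circ\tau_X=T\pi_X$, and $+_{TX}\circ(\tau_X\times_{TX}\tau_X)=\tau_X\circ T(+_X)\circ\nu_{2,X}^{-1}$ on $T^2X\times_{TX}^{T\pi_X,T\pi_X}T^2X$; (iv) $\pi_{TX}\circ\lambda_X=0_X\circ\pi_X$, $\lambda_{TX}\circ\lambda_X=T\lambda_X\circ\lambda_X$,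 and $+_{TX}\circ(\lambda_X\times_{0_X}\lambda_X)=\lambda_X\circ+_X$; (v) $\tau_X\circ\lambda_X=\lambda_X$ and $T\tau_X\circ\tau_{TX}\circ T\lambda_X=\lambda_{TX}\circ\tau_X$; (vi) the commutative square $(\pi_{TX},T\pi_X)\circ\lambda_X=(0_X,0_X)\circ\pi_X:TX\to T_2X$ is a pullback square. The extended vertical lift is $(\lambda_2)_X:=\tau_X\circ+_{TX}\circ(T0_X\times_{0_X}\lambda_X):T_2X\to T^2X$. It is known that the square with $(\lambda_2)_X$, $T\pi_X:T^2X\to TX$, $\pi_X\circ\mathrm{pr}_1:T_2X\to X$ and $0_X:X\to TX$ is a pullback. **Cartesian.** The tangent structure is cartesian if $\mathcal{C}$ has finite products and $\chi_{X,Y}:=(T\mathrm{pr}_1,T\mathrm{pr}_2):T(X\times Y)\to TX\times TY$ is invertible for all $X,Y$. For $f:X\times Y\to Z$ the partial tangent morphisms are $T_{(1)}f:=Tf\circ\chi_{X,Y}^{-1}\circ(\mathrm{id}_{TX}\times0_Y):TX\times Y\to TZ$ and $T_{(2)}f:=Tf\circ\chi_{X,Y}^{-1}\circ(0_X\times\mathrm{id}_{TY}):X\times TY\to TZ$. **Vector fields.** A vector field on $X$ is a section $v:X\to TX$ of $\pi_X$; $\Gamma(X,TX)$ denotes the set of them, with sum $v+w:=+_X\circ(v,w)$. The bracket $[v,w]$ is the unique vector field with $\delta(v,w)=(\lambda_2)_X\circ(w,[v,w])$, where $\delta(v,w):=-_{TX}\circ(Tw\circ v,\ \tau_X\circ Tv\circ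 w):X\to T^2X$. It is known (Rosický, Cockett–Cruttwell) that this is a Lie bracket, i.e. biadditive, antisymmetric, and satisfying the Jacobi identity. **Scalar multiplication.** Let $R$ be a commutative unital ring object in $\mathcal{C}$ with addition $\hat{+}$, zero $\hat{0}$, multiplication $\hat{m}$, unit $\hat{1}$. An $R$-module structure on the tangent bundle is a natural morphism $\kappa_X:R\times TX\to TX$ with $\pi_X\circ\kappa_X=\pi_X\circ\mathrm{pr}_2$, $\kappa_X\circ(\mathrm{id}_R\times\kappa_X)=\kappa_X\circ(\hat{m}\times\mathrm{id}_{TX})$, $\kappa_X\circ(\hat{1}\times\mathrm{id}_{TX})$ equal to the canonical isomorphism $*\times TX\cong TX$, $\kappa_X\circ(\hat{+}\times\mathrm{id}_{TX})=+_X\circ(\kappa_X\circ(\mathrm{pr}_1,\mathrm{pr}_3),\kappa_X\circ(\mathrm{pr}_2,\mathrm{pr}_3))$, and $\kappa_X\circ(\mathrm{id}_R\times+_X)=+_X\circ(\kappa_X\circ(\mathrm{pr}_1,\mathrm{pr}_2),\kappa_X\circ(\mathrm{pr}_1,\mathrm{pr}_3))$ on $R\times T_2X$. The tangent fiber $T_{\hat{0}}R:=*\times_R^{\hat{0},\pi_R}TR$ (if it exists) inherits an $R$-module structure from $+_R,0_R,\kappa_R$. $R$ is tangent-stable if $T_{\hat{0}}R$ exists and there is an isomorphism of $R$-modules $T_{\hat{0}}R\cong R$, which is then fixed. In that case $\eta_R:TR\to R$ is the projection onto the fiber: the morphism $T_{(2)}\hat{+}\circ(\hat{\iota}\circ\pi_R,\mathrm{id}_{TR}):TR\to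 TR$ (with $\hat{\iota}$ the additive inverse of $R$) factors uniquely through $T_{\hat{0}}R\to TR$, and $\eta_R$ is the resulting $TR\to T_{\hat{0}}R$ followed by $T_{\hat{0}}R\cong R$. The $R$-module structure $\kappa$ is a scalar $R$-multiplication if $R$ is tangent-stable and for all $X$: (S1) $\lambda_X\circ\kappa_X=\kappa_{TX}\circ(\mathrm{id}_R\times\lambda_X)$; (S2) $T_{(1)}\kappa_X=(\lambda_2)_X\circ(\kappa_X\circ(\mathrm{pr}_1,\mathrm{pr}_3),\kappa_X\circ(\mathrm{pr}_2,\mathrm{pr}_3))\circ((\pi_R,\eta_R)\times\mathrm{id}_{TX})$ on $TR\times TX$; (S3) $T_{(2)}\kappa_X=\tau_X\circ\kappa_{TX}\circ(\mathrm{id}_R\times\tau_X)$ on $R\times T^2X$. **Functions.** $\mathrm{Hom}(X,R)$ is a commutative ring with $f+g:=\hat{+}\circ(f,g)$ and $fg:=\hat{m}\circ(f,g)$. Vector fields act on functions by $v\cdot f:=\eta_R\circ Tf\circ v$. **Abstract Lie algebroid.** A bundle of $R$-modules over $X$ is an abelian group object $p:A\to X$ in $\mathcal{C}_{/X}$ with a morphism $\kappa_A:R\times A\to A$ over $X$ satisfying the usual axioms of a linear $R$-action (for $A=TX$ it is $\kappa_X$). Its set of sections $\Gamma(X,A)$ is an abelian group and a module over $\mathrm{Hom}(X,R)$ via $fa:=\kappa_A\circ(f,a)$. An abstract Lie algebroid consists of a bundle of $R$-modules $A\to X$, a morphism $\rho:A\to TX$ of bundles of $R$-modules over $X$ (the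 anchor), and a Lie bracket on the abelian group $\Gamma(X,A)$ such that $[a,fb]=f[a,b]+((\rho\circ a)\cdot f)\,b$ and $\rho\circ[a,b]=[\rho\circ a,\rho\circ b]$ for all $a,b\in\Gamma(X,A)$ and $f:X\to R$. *)

theory Defs
  imports "HOL-Algebra.Group"
begin

section \<open>Categories, functors, limits\<close>

text \<open>
  A category has a set of objects and a set of arrows; \<open>g \<cdot> f\<close> is the composite ``g after f'' and is
  only meaningful if \<open>Dom g = Cod f\<close>.  Nothing is assumed about values outside the carriers.
\<close>

record ('o, 'm) cat =
  Ob :: "'o set"
  Ar :: "'m set"
  Dom :: "'m \<Rightarrow> 'o"
  Cod :: "'m \<Rightarrow> 'o"
  Comp :: "'m \<Rightarrow> 'm \<Rightarrow> 'm"  (infixr "\<cdot>\<index>" 75)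
  Ident :: "'o \<Rightarrow> 'm"

definition Hom :: "('o, 'm) cat \<Rightarrow> 'o \<Rightarrow> 'o \<Rightarrow> 'm set" where
  "Hom C A B = {f \<in> Ar C. Dom C f = A \<and> Cod C f = B}"

locale category =
  fixes C :: "('o, 'm) cat" (structure)
  assumes dom_in_Ob: "f \<in> Ar C \<Longrightarrow> Dom C f \<in> Ob C"
    and cod_in_Ob: "f \<in> Ar C \<Longrightarrow> Cod C f \<in> Ob C"
    and ident_in_Hom: "A \<in> Ob C \<Longrightarrow> Ident C A \<in> Hom C A A"
    and comp_in_Hom: "f \<in> Hom C A B \<Longrightarrow> g \<in> Hom C B D \<Longrightarrow> g \<cdot> f \<in> Hom C A D"
    and ident_left: "f \<in> Hom C A B \<Longrightarrow> Ident C B \<cdot> f = f"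
    and ident_right: "f \<in> Hom C A B \<Longrightarrow> f \<cdot> Ident C A = f"
    and comp_assoc:
      "f \<in> Hom C A B \<Longrightarrow> g \<in> Hom C B D \<Longrightarrow> h \<in> Hom C D E \<Longrightarrow> (h \<cdot> g) \<cdot> f = h \<cdot> (g \<cdot> f)"

definition is_functor ::
  "('o, 'm) cat \<Rightarrow> ('p, 'n) cat \<Rightarrow> ('o \<Rightarrow> 'p) \<Rightarrow> ('m \<Rightarrow> 'n) \<Rightarrow> bool" where
  "is_functor C D Fo Fa \<longleftrightarrow>
     (\<forall>A \<in> Ob C. Fo A \<in> Ob D) \<and>
     (\<forall>f \<in> Ar C. Fa f \<in> Hom D (Fo (Dom C f)) (Fo (Cod C f))) \<and>
     (\<forall>A \<in> Ob C. Fa (Ident C A) = Ident D (Fo A)) \<and>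
     (\<forall>f \<in> Ar C. \<forall>g \<in> Ar C. Dom C g = Cod C f \<longrightarrow> Fa (g \<cdot>\<^bsub>C\<^esub> f) = Fa g \<cdot>\<^bsub>D\<^esub> Fa f)"

definition nat_trans ::
  "('o, 'm) cat \<Rightarrow> ('p, 'n) cat \<Rightarrow> ('o \<Rightarrow> 'p) \<Rightarrow> ('m \<Rightarrow> 'n) \<Rightarrow> ('o \<Rightarrow> 'p) \<Rightarrow> ('m \<Rightarrow> 'n)
    \<Rightarrow> ('o \<Rightarrow> 'n) \<Rightarrow> bool" where
  "nat_trans C D Fo Fa Go Ga \<alpha> \<longleftrightarrow>
     (\<forall>A \<in> Ob C. \<alpha> A \<in> Hom D (Fo A) (Go A)) \<and>
     (\<forall>f \<in> Ar C. Ga f \<cdot>\<^bsub>D\<^esub> \<alpha> (Dom C f) = \<alpha> (Cod C f) \<cdot>\<^bsub>D\<^esub> Fa f)"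

definition inverse_arrows :: "('o, 'm) cat \<Rightarrow> 'm \<Rightarrow> 'm \<Rightarrow> bool" where
  "inverse_arrows C f g \<longleftrightarrow>
     f \<in> Ar C \<and> g \<in> Hom C (Cod C f) (Dom C f) \<and>
     g \<cdot>\<^bsub>C\<^esub> f = Ident C (Dom C f) \<and> f \<cdot>\<^bsub>C\<^esub> g = Ident C (Cod C f)"

definition is_iso :: "('o, 'm) cat \<Rightarrow> 'm \<Rightarrow> bool" where
  "is_iso C f \<longleftrightarrow> (\<exists>g. inverse_arrows C f g)"

definition inverse_of :: "('o, 'm) cat \<Rightarrow> 'm \<Rightarrow> 'm" where
  "inverse_of C f = (THE g. inverse_arrows C f g)"

text \<open>The product of the empty list is a terminal object.\<close>

definition product_cone :: "('o, 'm) cat \<Rightarrow> 'o list \<Rightarrow> 'o \<Rightarrow> 'm list \<Rightarrow> bool" where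
  "product_cone C As Z gs \<longleftrightarrow>
     length gs = length As \<and> (\<forall>i < length As. gs ! i \<in> Hom C Z (As ! i))"

definition is_product :: "('o, 'm) cat \<Rightarrow> 'o list \<Rightarrow> 'o \<Rightarrow> 'm list \<Rightarrow> bool" where
  "is_product C As P ps \<longleftrightarrow>
     set As \<subseteq> Ob C \<and> P \<in> Ob C \<and> product_cone C As P ps \<and>
     (\<forall>Z \<in> Ob C. \<forall>gs. product_cone C As Z gs \<longrightarrow>
        (\<exists>!u. u \<in> Hom C Z P \<and> map (\<lambda>p. p \<cdot>\<^bsub>C\<^esub> u) ps = gs))"

definition fiber_cone :: "('o, 'm) cat \<Rightarrow> 'm list \<Rightarrow> 'o \<Rightarrow> 'm list \<Rightarrow> bool" where
  "fiber_cone C fs Z gs \<longleftrightarrow>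
     product_cone C (map (Dom C) fs) Z gs \<and>
     (\<forall>i < length fs. \<forall>j < length fs. fs ! i \<cdot>\<^bsub>C\<^esub> gs ! i = fs ! j \<cdot>\<^bsub>C\<^esub> gs ! j)"

definition is_fiber_product :: "('o, 'm) cat \<Rightarrow> 'm list \<Rightarrow> 'o \<Rightarrow> 'm list \<Rightarrow> bool" where
  "is_fiber_product C fs P ps \<longleftrightarrow>
     fs \<noteq> [] \<and> set fs \<subseteq> Ar C \<and> (\<exists>B. \<forall>f \<in> set fs. Cod C f = B) \<and>
     P \<in> Ob C \<and> fiber_cone C fs P ps \<and>
     (\<forall>Z \<in> Ob C. \<forall>gs. fiber_cone C fs Z gs \<longrightarrow>
        (\<exists>!u. u \<in> Hom C Z P \<and> map (\<lambda>p. p \<cdot>\<^bsub>C\<^esub> u) ps = gs))"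

text \<open>The morphism \<open>(g\<^sub>1, \<dots>, g\<^sub>k)\<close> into a (fiber) product \<open>P\<close> with projections \<open>ps\<close>, \<open>k \<ge> 1\<close>.\<close>

definition tuple :: "('o, 'm) cat \<Rightarrow> 'o \<Rightarrow> 'm list \<Rightarrow> 'm list \<Rightarrow> 'm" where
  "tuple C P ps gs = (THE u. u \<in> Hom C (Dom C (hd gs)) P \<and> map (\<lambda>p. p \<cdot>\<^bsub>C\<^esub> u) ps = gs)"

definition to_terminal :: "('o, 'm) cat \<Rightarrow> 'o \<Rightarrow> 'o \<Rightarrow> 'm" where
  "to_terminal C I Z = (THE u. u \<in> Hom C Z I)"

text \<open>Objects of the slice category are the arrows into \<open>X\<close>; an arrow from \<open>p\<close> to \<open>q\<close> is a triple \<open>(p, f, q)\<close>.\<close>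

definition slice :: "('o, 'm) cat \<Rightarrow> 'o \<Rightarrow> ('m, 'm \<times> 'm \<times> 'm) cat" where
  "slice C X =
     \<lparr> Ob = {p \<in> Ar C. Cod C p = X},
       Ar = {(p, f, q). p \<in> Ar C \<and> q \<in> Ar C \<and> Cod C p = X \<and> Cod C q = X \<and>
                        f \<in> Hom C (Dom C p) (Dom C q) \<and> q \<cdot>\<^bsub>C\<^esub> f = p},
       Dom = (\<lambda>(p, f, q). p),
       Cod = (\<lambda>(p, f, q). q),
       Comp = (\<lambda>(q, g, r) (p, f, q'). (p, g \<cdot>\<^bsub>C\<^esub> f, r)),
       Ident = (\<lambda>p. (p, Ident C (Dom C p), p)) \<rparr>"

definition underlying :: "'m \<times> 'm \<times> 'm \<Rightarrow> 'm" where
  "underlying = (\<lambda>(p, f, q). f)"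


section \<open>Abelian group objects\<close>

text \<open>\<open>gone\<close> is a terminal object and \<open>gsq\<close> with projections \<open>gprs\<close> is a product of \<open>gob\<close> with itself.\<close>

record ('o, 'm) group_data =
  gob :: 'o
  gone :: 'o
  gsq :: 'o
  gprs :: "'m list"
  gadd :: 'm
  gzero :: 'm

definition gpair :: "('o, 'm) cat \<Rightarrow> ('o, 'm) group_data \<Rightarrow> 'm \<Rightarrow> 'm \<Rightarrow> 'm" where
  "gpair C G f g = tuple C (gsq G) (gprs G) [f, g]"

definition is_neg :: "('o, 'm) cat \<Rightarrow> ('o, 'm) group_data \<Rightarrow> 'm \<Rightarrow> bool" where
  "is_neg C G n \<longleftrightarrow> n \<in> Hom C (gob G) (gob G) \<and>
     gadd G \<cdot>\<^bsub>C\<^esub> gpair C G (Ident C (gob G)) n = gzero G \<cdot>\<^bsub>C\<^esub> to_terminal C (gone G) (gob G)"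

definition neg :: "('o, 'm) cat \<Rightarrow> ('o, 'm) group_data \<Rightarrow> 'm" where
  "neg C G = (THE n. is_neg C G n)"

definition abelian_group_object :: "('o, 'm) cat \<Rightarrow> ('o, 'm) group_data \<Rightarrow> bool" where
  "abelian_group_object C G \<longleftrightarrow>
     is_product C [] (gone G) [] \<and>
     is_product C [gob G, gob G] (gsq G) (gprs G) \<and>
     gadd G \<in> Hom C (gsq G) (gob G) \<and>
     gzero G \<in> Hom C (gone G) (gob G) \<and>
     (\<exists>Q r\<^sub>1 r\<^sub>2 r\<^sub>3. is_product C [gob G, gob G, gob G] Q [r\<^sub>1, r\<^sub>2, r\<^sub>3] \<and>
        gadd G \<cdot>\<^bsub>C\<^esub> gpair C G (gadd G \<cdot>\<^bsub>C\<^esub> gpair C G r\<^sub>1 r\<^sub>2) r\<^sub>3 =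
        gadd G \<cdot>\<^bsub>C\<^esub> gpair C G r\<^sub>1 (gadd G \<cdot>\<^bsub>C\<^esub> gpair C G r\<^sub>2 r\<^sub>3)) \<and>
     gadd G \<cdot>\<^bsub>C\<^esub> gpair C G (gprs G ! 1) (gprs G ! 0) = gadd G \<and>
     gadd G \<cdot>\<^bsub>C\<^esub> gpair C G (Ident C (gob G)) (gzero G \<cdot>\<^bsub>C\<^esub> to_terminal C (gone G) (gob G)) =
       Ident C (gob G) \<and>
     (\<exists>n. is_neg C G n)"

text \<open>
  The data of an abelian group object in the slice over \<open>X\<close>: the projection \<open>bproj : btot \<rightarrow> X\<close>,
  the fiber square \<open>bsq = btot \<times>\<^sub>X btot\<close> with its projections \<open>bprs\<close>, and the morphisms
  \<open>badd : bsq \<rightarrow> btot\<close> and \<open>bzero : X \<rightarrow> btot\<close> of the ambient category.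
\<close>

record ('o, 'm) group_bundle =
  btot :: 'o
  bproj :: 'm
  bsq :: 'o
  bprs :: "'m list"
  badd :: 'm
  bzero :: 'm

definition bpair :: "('o, 'm) cat \<Rightarrow> ('o, 'm) group_bundle \<Rightarrow> 'm \<Rightarrow> 'm \<Rightarrow> 'm" where
  "bpair C A f g = tuple C (bsq A) (bprs A) [f, g]"

definition slice_group ::
  "('o, 'm) cat \<Rightarrow> 'o \<Rightarrow> ('o, 'm) group_bundle \<Rightarrow> ('m, 'm \<times> 'm \<times> 'm) group_data" where
  "slice_group C X A =
     (let d = bproj A \<cdot>\<^bsub>C\<^esub> (bprs A ! 0) in
      \<lparr> gob = bproj A,
        gone = Ident C X,
        gsq = d,
        gprs = map (\<lambda>r. (d, r, bproj A)) (bprs A),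
        gadd = (d, badd A, bproj A),
        gzero = (Ident C X, bzero A, bproj A) \<rparr>)"

definition abelian_group_bundle :: "('o, 'm) cat \<Rightarrow> 'o \<Rightarrow> ('o, 'm) group_bundle \<Rightarrow> bool" where
  "abelian_group_bundle C X A \<longleftrightarrow>
     bproj A \<in> Hom C (btot A) X \<and>
     is_fiber_product C [bproj A, bproj A] (bsq A) (bprs A) \<and>
     abelian_group_object (slice C X) (slice_group C X A)"

definition sections :: "('o, 'm) cat \<Rightarrow> 'o \<Rightarrow> ('o, 'm) group_bundle \<Rightarrow> 'm set" where
  "sections C X A = {a \<in> Hom C X (btot A). bproj A \<cdot>\<^bsub>C\<^esub> a = Ident C X}"

text \<open>The abelian group of sections, written multiplicatively as in the library.\<close>

definition section_group :: "('o, 'm) cat \<Rightarrow> 'o \<Rightarrow> ('o, 'm) group_bundle \<Rightarrow> 'm monoid" where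
  "section_group C X A =
     \<lparr> carrier = sections C X A,
       monoid.mult = (\<lambda>a b. badd A \<cdot>\<^bsub>C\<^esub> bpair C A a b),
       one = bzero A \<rparr>"

definition lie_bracket :: "'a monoid \<Rightarrow> ('a \<Rightarrow> 'a \<Rightarrow> 'a) \<Rightarrow> bool" where
  "lie_bracket G br \<longleftrightarrow>
     comm_group G \<and>
     br \<in> carrier G \<rightarrow> carrier G \<rightarrow> carrier G \<and>
     (\<forall>a \<in> carrier G. \<forall>b \<in> carrier G. \<forall>c \<in> carrier G.
        br (a \<otimes>\<^bsub>G\<^esub> b) c = br a c \<otimes>\<^bsub>G\<^esub> br b c \<and>
        br a (b \<otimes>\<^bsub>G\<^esub> c) = br a b \<otimes>\<^bsub>G\<^esub> br a c) \<and>
     (\<forall>a \<in> carrier G. \<forall>b \<in> carrier G. br a b = inv\<^bsub>G\<^esub> (br b a)) \<and>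
     (\<forall>a \<in> carrier G. \<forall>b \<in> carrier G. \<forall>c \<in> carrier G.
        br a (br b c) \<otimes>\<^bsub>G\<^esub> br b (br c a) \<otimes>\<^bsub>G\<^esub> br c (br a b) = \<one>\<^bsub>G\<^esub>)"


section \<open>Finite products and ring objects\<close>

record ('o, 'm) products =
  One :: 'o
  Prod :: "'o \<Rightarrow> 'o \<Rightarrow> 'o"
  Pr1 :: "'o \<Rightarrow> 'o \<Rightarrow> 'm"
  Pr2 :: "'o \<Rightarrow> 'o \<Rightarrow> 'm"

locale product_data =
  fixes C :: "('o, 'm) cat" (structure) and F :: "('o, 'm) products"
begin

definition finite_products :: bool where
  "finite_products \<longleftrightarrow>
     is_product C [] (One F) [] \<and>
     (\<forall>A \<in> Ob C. \<forall>B \<in> Ob C. is_product C [A, B] (Prod F A B) [Pr1 F A B, Pr2 F A B])"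

text \<open>\<open>pair f g\<close> is \<open>(f, g) : Z \<rightarrow> A \<times> B\<close>, and \<open>par f g\<close> is \<open>f \<times> g : A \<times> B \<rightarrow> A' \<times> B'\<close>.\<close>

definition pair :: "'m \<Rightarrow> 'm \<Rightarrow> 'm" where
  "pair f g = (let A = Cod C f; B = Cod C g in tuple C (Prod F A B) [Pr1 F A B, Pr2 F A B] [f, g])"

definition par :: "'m \<Rightarrow> 'm \<Rightarrow> 'm" where
  "par f g = (let A = Dom C f; B = Dom C g in pair (f \<cdot> Pr1 F A B) (g \<cdot> Pr2 F A B))"

definition bang :: "'o \<Rightarrow> 'm" where
  "bang A = to_terminal C (One F) A"

text \<open>The three projections of \<open>(A \<times> B) \<times> D\<close>, and the isomorphism \<open>(A \<times> B) \<times> D \<cong> A \<times> (B \<times> D)\<close>.\<close>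

definition pr31 :: "'o \<Rightarrow> 'o \<Rightarrow> 'o \<Rightarrow> 'm" where
  "pr31 A B D = Pr1 F A B \<cdot> Pr1 F (Prod F A B) D"

definition pr32 :: "'o \<Rightarrow> 'o \<Rightarrow> 'o \<Rightarrow> 'm" where
  "pr32 A B D = Pr2 F A B \<cdot> Pr1 F (Prod F A B) D"

definition pr33 :: "'o \<Rightarrow> 'o \<Rightarrow> 'o \<Rightarrow> 'm" where
  "pr33 A B D = Pr2 F (Prod F A B) D"

definition reassoc :: "'o \<Rightarrow> 'o \<Rightarrow> 'o \<Rightarrow> 'm" where
  "reassoc A B D = pair (pr31 A B D) (pair (pr32 A B D) (pr33 A B D))"

end

record ('o, 'm) ring_data =
  Rob :: 'o
  Radd :: 'm
  Rzero :: 'm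
  Rmul :: 'm
  Rone :: 'm

locale ring_object_data = product_data C F
  for C :: "('o, 'm) cat" (structure) and F :: "('o, 'm) products" +
  fixes R :: "('o, 'm) ring_data"
begin

definition ring_additive_group :: "('o, 'm) group_data" where
  "ring_additive_group =
     \<lparr> gob = Rob R, gone = One F, gsq = Prod F (Rob R) (Rob R),
       gprs = [Pr1 F (Rob R) (Rob R), Pr2 F (Rob R) (Rob R)],
       gadd = Radd R, gzero = Rzero R \<rparr>"

definition ring_neg :: 'm where
  "ring_neg = neg C ring_additive_group"

definition commutative_ring_object :: bool where
  "commutative_ring_object \<longleftrightarrow>
     (let R' = Rob R; idR = Ident C R' in
      abelian_group_object C ring_additive_group \<and>
      Rmul R \<in> Hom C (Prod F R' R') R' \<and>
      Rone R \<in> Hom C (One F) R' \<and>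
      Rmul R \<cdot> par (Rmul R) idR = Rmul R \<cdot> par idR (Rmul R) \<cdot> reassoc R' R' R' \<and>
      Rmul R \<cdot> pair (Pr2 F R' R') (Pr1 F R' R') = Rmul R \<and>
      Rmul R \<cdot> pair (Rone R \<cdot> bang R') idR = idR \<and>
      Rmul R \<cdot> par (Radd R) idR =
        Radd R \<cdot> pair (Rmul R \<cdot> pair (pr31 R' R' R') (pr33 R' R' R'))
                      (Rmul R \<cdot> pair (pr32 R' R' R') (pr33 R' R' R')))"

text \<open>
  A bundle of \<open>R\<close>-modules over \<open>X\<close> with action \<open>k : R \<times> A \<rightarrow> A\<close>: \<open>k\<close> is a morphism over \<open>X\<close>,
  associative, unital, and additive in both arguments.
\<close>

definition module_bundle :: "'o \<Rightarrow> ('o, 'm) group_bundle \<Rightarrow> 'm \<Rightarrow> bool" where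
  "module_bundle X A k \<longleftrightarrow>
     (let R' = Rob R; E = btot A; idR = Ident C R'; idE = Ident C E; q = Pr2 F R' (bsq A) in
      abelian_group_bundle C X A \<and>
      k \<in> Hom C (Prod F R' E) E \<and>
      bproj A \<cdot> k = bproj A \<cdot> Pr2 F R' E \<and>
      k \<cdot> par idR k \<cdot> reassoc R' R' E = k \<cdot> par (Rmul R) idE \<and>
      k \<cdot> par (Rone R) idE = Pr2 F (One F) E \<and>
      k \<cdot> par (Radd R) idE =
        badd A \<cdot> bpair C A (k \<cdot> pair (pr31 R' R' E) (pr33 R' R' E))
                          (k \<cdot> pair (pr32 R' R' E) (pr33 R' R' E)) \<and>
      k \<cdot> par idR (badd A) =
        badd A \<cdot> bpair C A (k \<cdot> pair (Pr1 F R' (bsq A)) ((bprs A ! 0) \<cdot> q))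
                          (k \<cdot> pair (Pr1 F R' (bsq A)) ((bprs A ! 1) \<cdot> q)))"

definition module_bundle_morphism ::
  "('o, 'm) group_bundle \<Rightarrow> 'm \<Rightarrow> ('o, 'm) group_bundle \<Rightarrow> 'm \<Rightarrow> 'm \<Rightarrow> bool" where
  "module_bundle_morphism A k B l \<rho> \<longleftrightarrow>
     \<rho> \<in> Hom C (btot A) (btot B) \<and>
     bproj B \<cdot> \<rho> = bproj A \<and>
     \<rho> \<cdot> badd A = badd B \<cdot> bpair C B (\<rho> \<cdot> (bprs A ! 0)) (\<rho> \<cdot> (bprs A ! 1)) \<and>
     \<rho> \<cdot> bzero A = bzero B \<and>
     \<rho> \<cdot> k = l \<cdot> par (Ident C (Rob R)) \<rho>"

end


section \<open>Rosicky tangent structures\<close>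

text \<open>
  \<open>Tob\<close>, \<open>Tar\<close> are the functor \<open>T\<close> on objects and arrows.  \<open>Tpow k X\<close> with its list of projections
  \<open>Tprs k X\<close> is the choice of the fiber product \<open>T\<^sub>k X\<close>.
\<close>

record ('o, 'm) tangent =
  Tob :: "'o \<Rightarrow> 'o"
  Tar :: "'m \<Rightarrow> 'm"
  Tpow :: "nat \<Rightarrow> 'o \<Rightarrow> 'o"
  Tprs :: "nat \<Rightarrow> 'o \<Rightarrow> 'm list"
  Tproj :: "'o \<Rightarrow> 'm"
  Tzero :: "'o \<Rightarrow> 'm"
  Tplus :: "'o \<Rightarrow> 'm"
  Tlift :: "'o \<Rightarrow> 'm"
  Tflip :: "'o \<Rightarrow> 'm"

locale tangent_data =
  fixes C :: "('o, 'm) cat" (structure) and T :: "('o, 'm) tangent"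
begin

text \<open>
  \<open>\<pi>\<close>, \<open>\<zeta>\<close>, \<open>\<sigma>\<close>, \<open>\<l>\<close>, \<open>\<tau>\<close> are the bundle projection, the zero section, the fiberwise addition, the
  vertical lift and the symmetric structure, respectively.
\<close>

abbreviation "\<pi> \<equiv> Tproj T"
abbreviation "\<zeta> \<equiv> Tzero T"
abbreviation "\<sigma> \<equiv> Tplus T"
abbreviation "\<l> \<equiv> Tlift T"
abbreviation "\<tau> \<equiv> Tflip T"
abbreviation "p\<^sub>1 X \<equiv> Tprs T 2 X ! 0"
abbreviation "p\<^sub>2 X \<equiv> Tprs T 2 X ! 1"

definition tpair :: "'o \<Rightarrow> 'm \<Rightarrow> 'm \<Rightarrow> 'm" where
  "tpair X f g = tuple C (Tpow T 2 X) (Tprs T 2 X) [f, g]"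

definition T2ar :: "'m \<Rightarrow> 'm" where
  "T2ar f = tpair (Cod C f) (Tar T f \<cdot> p\<^sub>1 (Dom C f)) (Tar T f \<cdot> p\<^sub>2 (Dom C f))"

definition tangent_bundle :: "'o \<Rightarrow> ('o, 'm) group_bundle" where
  "tangent_bundle X =
     \<lparr> btot = Tob T X, bproj = \<pi> X, bsq = Tpow T 2 X, bprs = Tprs T 2 X, badd = \<sigma> X, bzero = \<zeta> X \<rparr>"

text \<open>
  The natural morphism from \<open>T (T\<^sub>k X)\<close> to a fiber product \<open>Q\<close> of \<open>k\<close> copies of \<open>T \<pi> : T (T X) \<rightarrow> T X\<close>.
\<close>

definition nu :: "nat \<Rightarrow> 'o \<Rightarrow> 'o \<Rightarrow> 'm list \<Rightarrow> 'm" where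
  "nu k X Q qs = tuple C Q qs (map (Tar T) (Tprs T k X))"

definition ext_lift :: "'o \<Rightarrow> 'm" where
  "ext_lift X =
     \<tau> X \<cdot> \<sigma> (Tob T X) \<cdot> tpair (Tob T X) (Tar T (\<zeta> X) \<cdot> p\<^sub>1 X) (\<l> X \<cdot> p\<^sub>2 X)"

definition Tminus :: "'o \<Rightarrow> 'm" where
  "Tminus X =
     \<sigma> X \<cdot> tpair X (p\<^sub>1 X) (underlying (neg (slice C X) (slice_group C X (tangent_bundle X))) \<cdot> p\<^sub>2 X)"

definition vector_fields :: "'o \<Rightarrow> 'm set" where
  "vector_fields X = {v \<in> Hom C X (Tob T X). \<pi> X \<cdot> v = Ident C X}"

definition vf_delta :: "'o \<Rightarrow> 'm \<Rightarrow> 'm \<Rightarrow> 'm" where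
  "vf_delta X v w =
     Tminus (Tob T X) \<cdot> tpair (Tob T X) (Tar T w \<cdot> v) (\<tau> X \<cdot> Tar T v \<cdot> w)"

definition vf_bracket :: "'o \<Rightarrow> 'm \<Rightarrow> 'm \<Rightarrow> 'm" where
  "vf_bracket X v w =
     (THE u. u \<in> vector_fields X \<and> vf_delta X v w = ext_lift X \<cdot> tpair X w u)"

end

locale rosicky_tangent_category = category C + tangent_data C T
  for C :: "('o, 'm) cat" (structure) and T :: "('o, 'm) tangent" +
  assumes T_functor: "is_functor C C (Tob T) (Tar T)"
    and proj_natural: "nat_trans C C (Tob T) (Tar T) id id \<pi>"
    and zero_natural: "nat_trans C C id id (Tob T) (Tar T) \<zeta>"
    and plus_natural: "nat_trans C C (Tpow T 2) T2ar (Tob T) (Tar T) \<sigma>"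
    and lift_natural: "nat_trans C C (Tob T) (Tar T) (Tob T \<circ> Tob T) (Tar T \<circ> Tar T) \<l>"
    and flip_natural:
      "nat_trans C C (Tob T \<circ> Tob T) (Tar T \<circ> Tar T) (Tob T \<circ> Tob T) (Tar T \<circ> Tar T) \<tau>"
    and fiber_powers:
      "X \<in> Ob C \<Longrightarrow> k \<ge> 1 \<Longrightarrow>
         is_fiber_product C (replicate k (\<pi> X)) (Tpow T k X) (Tprs T k X)"
    and fiber_powers_preserved:
      "X \<in> Ob C \<Longrightarrow> k \<ge> 1 \<Longrightarrow>
         \<exists>Q qs. is_fiber_product C (replicate k (Tar T (\<pi> X))) Q qs \<and> is_iso C (nu k X Q qs)"
    and fiberwise_group: "X \<in> Ob C \<Longrightarrow> abelian_group_bundle C X (tangent_bundle X)"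
    and flip_flip: "X \<in> Ob C \<Longrightarrow> \<tau> X \<cdot> \<tau> X = Ident C (Tob T (Tob T X))"
    and flip_braid:
      "X \<in> Ob C \<Longrightarrow> \<tau> (Tob T X) \<cdot> Tar T (\<tau> X) \<cdot> \<tau> (Tob T X) = Tar T (\<tau> X) \<cdot> \<tau> (Tob T X) \<cdot> Tar T (\<tau> X)"
    and proj_flip: "X \<in> Ob C \<Longrightarrow> \<pi> (Tob T X) \<cdot> \<tau> X = Tar T (\<pi> X)"
    and plus_flip:
      "X \<in> Ob C \<Longrightarrow> is_fiber_product C [Tar T (\<pi> X), Tar T (\<pi> X)] Q [q\<^sub>1, q\<^sub>2] \<Longrightarrow>
         \<sigma> (Tob T X) \<cdot> tpair (Tob T X) (\<tau> X \<cdot> q\<^sub>1) (\<tau> X \<cdot> q\<^sub>2) =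
         \<tau> X \<cdot> Tar T (\<sigma> X) \<cdot> inverse_of C (nu 2 X Q [q\<^sub>1, q\<^sub>2])"
    and proj_lift: "X \<in> Ob C \<Longrightarrow> \<pi> (Tob T X) \<cdot> \<l> X = \<zeta> X \<cdot> \<pi> X"
    and lift_lift: "X \<in> Ob C \<Longrightarrow> \<l> (Tob T X) \<cdot> \<l> X = Tar T (\<l> X) \<cdot> \<l> X"
    and plus_lift:
      "X \<in> Ob C \<Longrightarrow> \<sigma> (Tob T X) \<cdot> tpair (Tob T X) (\<l> X \<cdot> p\<^sub>1 X) (\<l> X \<cdot> p\<^sub>2 X) = \<l> X \<cdot> \<sigma> X"
    and flip_lift: "X \<in> Ob C \<Longrightarrow> \<tau> X \<cdot> \<l> X = \<l> X"
    and flip_flip_lift: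
      "X \<in> Ob C \<Longrightarrow> Tar T (\<tau> X) \<cdot> \<tau> (Tob T X) \<cdot> Tar T (\<l> X) = \<l> (Tob T X) \<cdot> \<tau> X"
    and lift_pullback:
      "X \<in> Ob C \<Longrightarrow>
         is_fiber_product C [tpair X (\<pi> (Tob T X)) (Tar T (\<pi> X)), tpair X (\<zeta> X) (\<zeta> X)]
           (Tob T X) [\<l> X, \<pi> X]"


section \<open>Cartesian tangent categories and scalar multiplication\<close>

locale cartesian_tangent_data = product_data C F + tangent_data C T
  for C :: "('o, 'm) cat" (structure) and F :: "('o, 'm) products" and T :: "('o, 'm) tangent"
begin

definition chi :: "'o \<Rightarrow> 'o \<Rightarrow> 'm" where
  "chi X Y = pair (Tar T (Pr1 F X Y)) (Tar T (Pr2 F X Y))"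

definition partial1 :: "'o \<Rightarrow> 'o \<Rightarrow> 'm \<Rightarrow> 'm" where
  "partial1 X Y f = Tar T f \<cdot> inverse_of C (chi X Y) \<cdot> par (Ident C (Tob T X)) (\<zeta> Y)"

definition partial2 :: "'o \<Rightarrow> 'o \<Rightarrow> 'm \<Rightarrow> 'm" where
  "partial2 X Y f = Tar T f \<cdot> inverse_of C (chi X Y) \<cdot> par (\<zeta> X) (Ident C (Tob T Y))"

end

locale cartesian_tangent_category = rosicky_tangent_category C T + cartesian_tangent_data C F T
  for C :: "('o, 'm) cat" (structure) and F :: "('o, 'm) products" and T :: "('o, 'm) tangent" +
  assumes has_finite_products: "finite_products"
    and chi_iso: "X \<in> Ob C \<Longrightarrow> Y \<in> Ob C \<Longrightarrow> is_iso C (chi X Y)"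

text \<open>
  The tangent fiber of \<open>R\<close> at zero: the object \<open>fob\<close> with its inclusion \<open>fincl\<close> into \<open>T R\<close> (the other
  projection, to the terminal object, is unique), and the fixed isomorphism \<open>fiso : fob \<rightarrow> R\<close>.
\<close>

record ('o, 'm) tangent_fiber =
  fob :: 'o
  fincl :: 'm
  fiso :: 'm

locale scalar_data = ring_object_data C F R + cartesian_tangent_data C F T
  for C :: "('o, 'm) cat" (structure) and F :: "('o, 'm) products"
    and T :: "('o, 'm) tangent" and R :: "('o, 'm) ring_data" +
  fixes \<kappa> :: "'o \<Rightarrow> 'm" and S :: "('o, 'm) tangent_fiber"
begin

abbreviation "R' \<equiv> Rob R"
abbreviation "idR \<equiv> Ident C (Rob R)"

definition tangent_module_structure :: bool where
  "tangent_module_structure \<longleftrightarrow>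
     nat_trans C C (\<lambda>X. Prod F R' (Tob T X)) (\<lambda>f. par idR (Tar T f)) (Tob T) (Tar T) \<kappa> \<and>
     (\<forall>X \<in> Ob C. module_bundle X (tangent_bundle X) (\<kappa> X))"

definition into_fiber :: "'m \<Rightarrow> 'm" where
  "into_fiber h = tuple C (fob S) [bang (fob S), fincl S] [bang (Dom C h), h]"

definition fiber_add :: 'm where
  "fiber_add = into_fiber
     (\<sigma> R' \<cdot> tpair R' (fincl S \<cdot> Pr1 F (fob S) (fob S)) (fincl S \<cdot> Pr2 F (fob S) (fob S)))"

definition fiber_zero :: 'm where
  "fiber_zero = into_fiber (\<zeta> R' \<cdot> Rzero R)"

definition fiber_act :: 'm where
  "fiber_act = into_fiber (\<kappa> R' \<cdot> par idR (fincl S))"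

definition tangent_stable :: bool where
  "tangent_stable \<longleftrightarrow>
     is_fiber_product C [Rzero R, \<pi> R'] (fob S) [bang (fob S), fincl S] \<and>
     fiso S \<in> Hom C (fob S) R' \<and> is_iso C (fiso S) \<and>
     fiso S \<cdot> fiber_add = Radd R \<cdot> par (fiso S) (fiso S) \<and>
     fiso S \<cdot> fiber_zero = Rzero R \<and>
     fiso S \<cdot> fiber_act = Rmul R \<cdot> par idR (fiso S)"

definition eta :: 'm where
  "eta = fiso S \<cdot>
     into_fiber (partial2 R' R' (Radd R) \<cdot> pair (ring_neg \<cdot> \<pi> R') (Ident C (Tob T R')))"

definition scalar_multiplication :: bool where
  "scalar_multiplication \<longleftrightarrow>
     tangent_module_structure \<and> tangent_stable \<and>
     (\<forall>X \<in> Ob C.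
        \<l> X \<cdot> \<kappa> X = \<kappa> (Tob T X) \<cdot> par idR (\<l> X) \<and>
        partial1 R' (Tob T X) (\<kappa> X) =
          ext_lift X \<cdot>
          tpair X (\<kappa> X \<cdot> pair (pr31 R' R' (Tob T X)) (pr33 R' R' (Tob T X)))
                  (\<kappa> X \<cdot> pair (pr32 R' R' (Tob T X)) (pr33 R' R' (Tob T X))) \<cdot>
          par (pair (\<pi> R') eta) (Ident C (Tob T X)) \<and>
        partial2 R' (Tob T X) (\<kappa> X) = \<tau> X \<cdot> \<kappa> (Tob T X) \<cdot> par idR (\<tau> X))"

definition derivation :: "'m \<Rightarrow> 'm \<Rightarrow> 'm" where
  "derivation v f = eta \<cdot> Tar T f \<cdot> v"

text \<open>
  Abstract Lie algebroid: the bundle of modules \<open>A\<close> over \<open>X\<close> with action \<open>k : R \<times> A \<rightarrow> A\<close>, the anchor \<open>\<rho>\<close>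
  and the bracket \<open>br\<close> on the sections of \<open>A\<close>.  The product \<open>fa\<close> of a function and a section
  is \<open>k \<cdot> pair f a\<close>.
\<close>

definition abstract_lie_algebroid ::
  "'o \<Rightarrow> ('o, 'm) group_bundle \<Rightarrow> 'm \<Rightarrow> 'm \<Rightarrow> ('m \<Rightarrow> 'm \<Rightarrow> 'm) \<Rightarrow> bool" where
  "abstract_lie_algebroid X A k \<rho> br \<longleftrightarrow>
     module_bundle X A k \<and>
     module_bundle_morphism A k (tangent_bundle X) (\<kappa> X) \<rho> \<and>
     lie_bracket (section_group C X A) br \<and>
     (\<forall>a \<in> sections C X A. \<forall>b \<in> sections C X A. \<forall>f \<in> Hom C X R'.
        br a (k \<cdot> pair f b) =
        badd A \<cdot> bpair C A (k \<cdot> pair f (br a b)) (k \<cdot> pair (derivation (\<rho> \<cdot> a) f) b)) \<and>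
     (\<forall>a \<in> sections C X A. \<forall>b \<in> sections C X A.
        \<rho> \<cdot> br a b = vf_bracket X (\<rho> \<cdot> a) (\<rho> \<cdot> b))"

end

locale scalar_tangent_category = cartesian_tangent_category C F T + scalar_data C F T R \<kappa> S
  for C :: "('o, 'm) cat" (structure) and F :: "('o, 'm) products"
    and T :: "('o, 'm) tangent" and R :: "('o, 'm) ring_data"
    and \<kappa> :: "'o \<Rightarrow> 'm" and S :: "('o, 'm) tangent_fiber" +
  assumes ring_object: "commutative_ring_object"
    and scalar_mult: "scalar_multiplication"

end

theory Submission
  imports Defs
begin

text \<open>
  The infinitesimal squares \<open>Z \<rightarrow> T (T X)\<close> with given edges form a torsor under the tangent vectors at their
  corner, by the universality of the vertical lift, and \<open>[v, w]\<close> is the difference of \<open>T w \<cdot> v\<close> and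
  \<open>\<tau> \<cdot> T v \<cdot> w\<close>.  Exchanging the two directions of a square gives antisymmetry, compatibility of the
  torsor with addition gives biadditivity, and naturality shows that brackets of related vector fields are related.

  For the Jacobi identity, \<open>w : X \<rightarrow> T X\<close> relates \<open>v\<close> to the sum of the complete lift of \<open>v\<close> and
  the vertical lift of \<open>[v, w]\<close>.  Hence it relates \<open>[u, v]\<close> to the bracket of two such sums, which is
  computed from the brackets of complete lifts (\<open>[v\<^sup>c, u\<^sup>c] = [v, u]\<^sup>c\<close>), of a complete and a vertical lift
  (\<open>[v\<^sup>c, s\<^sup>v] = [v, s]\<^sup>v\<close>) and of vertical lifts (zero).

  For the Leibniz rule, \<open>T (f w) \<cdot> v\<close> splits into the two partial tangents of the scalar multiplication;
  the first contributes \<open>(v \<cdot> f) w\<close> and the second \<open>f [v, w]\<close>.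
\<close>

text \<open>The object \<open>T (T X)\<close> carries two partially defined additions, in the fibers
  of \<open>\<pi>\<close> and in the fibers of \<open>T \<pi>\<close>, which \<open>\<tau>\<close>
  exchanges. The calculus of squares rests on their interchange law, which is not an axiom: it comes
  from naturality of \<open>\<sigma>\<close> at the arrow \<open>\<sigma> X\<close> itself. It makes
  the action of tangent vectors on squares symmetric in the two directions and additive in the
  acting vector.

  Fiberwise subtraction and the description operator in the definition of the bracket are awkward to
  compute with. They are traded for the equation
  \<open>T w \<cdot> v = (\<tau> \<cdot> T v \<cdot> w) \<lhd> [v, w]\<close>; an identity of
  brackets then amounts to one equation of squares followed by cancellation.

  Brackets of fields on \<open>T X\<close> are equations of cubes, that is of arrows into
  \<open>T (T (T X))\<close>, whose directions are permuted by \<open>\<tau> (T X)\<close> and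
  \<open>T \<tau>\<close>. The obstacle is that differentiating a square adds a new outermost
  direction, while in a square over \<open>T X\<close> that direction has to be the innermost one.
  Hence the rotation \<open>T \<tau> \<cdot> \<tau>\<close>, and hence the weight of the braid
  relation.\<close>

section \<open>Universal properties of products and fiber products\<close>

lemma ex1_eqI: "\<exists>!u. P u \<Longrightarrow> P u \<Longrightarrow> P u' \<Longrightarrow> u = u'"
  by blast

lemma product_cone_pair [simp]:
  "product_cone C [A, B] Z [a, b] \<longleftrightarrow> a \<in> Hom C Z A \<and> b \<in> Hom C Z B"
  by (auto simp: product_cone_def less_Suc_eq nth_Cons')

lemma product_cone_triple [simp]:
  "product_cone C [A, B, D] Z [a, b, d] \<longleftrightarrow> a \<in> Hom C Z A \<and> b \<in> Hom C Z B \<and> d \<in> Hom C Z D"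
  by (auto simp: product_cone_def less_Suc_eq nth_Cons')

lemma fiber_cone_pair [simp]:
  "fiber_cone C [f, g] Z [a, b] \<longleftrightarrow>
     a \<in> Hom C Z (Dom C f) \<and> b \<in> Hom C Z (Dom C g) \<and> f \<cdot>\<^bsub>C\<^esub> a = g \<cdot>\<^bsub>C\<^esub> b"
proof -
  have "(\<forall>i < 2. \<forall>j < 2. Q i j) \<longleftrightarrow> Q 0 0 \<and> Q 0 1 \<and> Q 1 0 \<and> Q 1 1" for Q :: "nat \<Rightarrow> nat \<Rightarrow> bool"
    by (auto simp: less_2_cases_iff)
  from this[of "\<lambda>i j. [f, g] ! i \<cdot>\<^bsub>C\<^esub> [a, b] ! i = [f, g] ! j \<cdot>\<^bsub>C\<^esub> [a, b] ! j"]
  show ?thesis by (auto simp: fiber_cone_def numeral_2_eq_2)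
qed

context category
begin

lemma comp_arrow [simp]:
  assumes "f \<in> Ar C" "g \<in> Ar C" "Dom C g = Cod C f"
  shows "g \<cdot> f \<in> Ar C" "Dom C (g \<cdot> f) = Dom C f" "Cod C (g \<cdot> f) = Cod C g"
  using comp_in_Hom[of f "Dom C f" "Cod C f" g "Cod C g"] assms by (auto simp: Hom_def)

lemma ident_arrow [simp]:
  assumes "A \<in> Ob C"
  shows "Ident C A \<in> Ar C" "Dom C (Ident C A) = A" "Cod C (Ident C A) = A"
  using ident_in_Hom[OF assms] by (auto simp: Hom_def)

lemma comp_ident [simp]:
  assumes "f \<in> Ar C"
  shows "Dom C f = A \<Longrightarrow> f \<cdot> Ident C A = f" "Cod C f = A \<Longrightarrow> Ident C A \<cdot> f = f"
  using ident_left ident_right assms by (auto simp: Hom_def)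

lemma comp_assoc' [simp]:
  assumes "f \<in> Ar C" "g \<in> Ar C" "h \<in> Ar C" "Dom C g = Cod C f" "Dom C h = Cod C g"
  shows "(h \<cdot> g) \<cdot> f = h \<cdot> (g \<cdot> f)"
  using comp_assoc assms by (auto simp: Hom_def)

text \<open>Simplification keeps composites nested to the right, so the pattern
  \<open>g \<cdot> f\<close> is no longer visible inside \<open>g \<cdot> f \<cdot> h\<close>. Many
  of the primed lemmas below are instances of this form.\<close>

lemma comp_reassoc:
  assumes "g \<cdot> f = k" "f \<in> Ar C" "g \<in> Ar C" "Dom C g = Cod C f" "h \<in> Ar C" "Dom C f = Cod C h"
  shows "g \<cdot> f \<cdot> h = k \<cdot> h"
  using assms comp_assoc'[of h f g] by simp

lemmas arrow_Ob [simp] = dom_in_Ob cod_in_Ob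

lemma inverse_of_inverse:
  assumes "is_iso C f"
  shows "inverse_arrows C f (inverse_of C f)"
proof -
  obtain g where g: "inverse_arrows C f g" using assms by (auto simp: is_iso_def)
  have "h = g" if "inverse_arrows C f h" for h
  proof -
    have "(h \<cdot> f) \<cdot> g = h \<cdot> f \<cdot> g"
      using g that by (intro comp_assoc') (auto simp: inverse_arrows_def Hom_def)
    then show ?thesis using g that by (auto simp: inverse_arrows_def Hom_def simp del: comp_assoc')
  qed
  with g show ?thesis unfolding inverse_of_def by (metis theI)
qed

lemma is_fiber_productD:
  assumes "is_fiber_product C fs P ps" "fiber_cone C fs Z gs" "Z \<in> Ob C"
  shows "\<exists>!u. u \<in> Hom C Z P \<and> map (\<lambda>p. p \<cdot> u) ps = gs"
  using assms unfolding is_fiber_product_def by simp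

lemma is_productD:
  assumes "is_product C As P ps" "product_cone C As Z gs" "Z \<in> Ob C"
  shows "\<exists>!u. u \<in> Hom C Z P \<and> map (\<lambda>p. p \<cdot> u) ps = gs"
  using assms unfolding is_product_def by simp

lemma fiber_tuple:
  assumes "is_fiber_product C [f, g] P [p, q]" "a \<in> Ar C" "b \<in> Ar C" "Dom C a = Dom C b"
    "Cod C a = Dom C f" "Cod C b = Dom C g" "f \<cdot> a = g \<cdot> b"
  shows "tuple C P [p, q] [a, b] \<in> Hom C (Dom C b) P"
    "p \<cdot> tuple C P [p, q] [a, b] = a" "q \<cdot> tuple C P [p, q] [a, b] = b"
proof -
  have "fiber_cone C [f, g] (Dom C b) [a, b]"
    using assms by (simp add: Hom_def)
  then have "\<exists>!u. u \<in> Hom C (Dom C b) P \<and> map (\<lambda>p. p \<cdot> u) [p, q] = [a, b]"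
    by (rule is_fiber_productD[OF assms(1) _ dom_in_Ob[OF assms(3)]])
  from theI'[OF this] show "tuple C P [p, q] [a, b] \<in> Hom C (Dom C b) P"
    "p \<cdot> tuple C P [p, q] [a, b] = a" "q \<cdot> tuple C P [p, q] [a, b] = b"
    using assms by (simp_all add: tuple_def)
qed

lemma fiber_product_pair:
  assumes "is_fiber_product C [f, g] P [p, q]"
  shows "p \<in> Hom C P (Dom C f)" "q \<in> Hom C P (Dom C g)" "P \<in> Ob C" "f \<cdot> p = g \<cdot> q"
    "f \<in> Ar C" "g \<in> Ar C" "Cod C f = Cod C g"
  using assms unfolding is_fiber_product_def by auto

lemma fiber_product_eqI:
  assumes P: "is_fiber_product C [f, g] P [p, q]" and "u \<in> Ar C" "u' \<in> Ar C" "Dom C u = Dom C u'"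
    "Cod C u = P" "Cod C u' = P" and e: "p \<cdot> u = p \<cdot> u'" "q \<cdot> u = q \<cdot> u'"
  shows "u = u'"
proof -
  note P' = fiber_product_pair[OF P]
  let ?gs = "[p \<cdot> u, q \<cdot> u]"
  have "f \<cdot> p \<cdot> u = (g \<cdot> q) \<cdot> u"
    by (rule comp_reassoc[OF P'(4)]) (use P'(1-3,5-7) assms(2-6) in \<open>simp_all add: Hom_def\<close>)
  then have "f \<cdot> p \<cdot> u = g \<cdot> q \<cdot> u"
    using P'(1-3,5-7) assms(2-6) by (simp add: Hom_def)
  then have "fiber_cone C [f, g] (Dom C u) ?gs"
    using assms(2-6) P'(1-3,5-7) by (simp add: Hom_def)
  then have "\<exists>!u'. u' \<in> Hom C (Dom C u) P \<and> map (\<lambda>p. p \<cdot> u') [p, q] = ?gs"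
    by (rule is_fiber_productD[OF P _ dom_in_Ob[OF assms(2)]])
  from ex1_eqI[OF this, of u u'] show ?thesis
    by this (use assms(2-6) e in \<open>simp_all add: Hom_def\<close>)
qed

lemma product_tuple:
  assumes "is_product C [A, B] P [p, q]" "a \<in> Ar C" "b \<in> Ar C" "Dom C a = Dom C b"
    "Cod C a = A" "Cod C b = B"
  shows "tuple C P [p, q] [a, b] \<in> Hom C (Dom C b) P"
    "p \<cdot> tuple C P [p, q] [a, b] = a" "q \<cdot> tuple C P [p, q] [a, b] = b"
proof -
  have "product_cone C [A, B] (Dom C b) [a, b]"
    using assms by (simp add: Hom_def)
  then have "\<exists>!u. u \<in> Hom C (Dom C b) P \<and> map (\<lambda>p. p \<cdot> u) [p, q] = [a, b]"
    by (rule is_productD[OF assms(1) _ dom_in_Ob[OF assms(3)]])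
  from theI'[OF this] show "tuple C P [p, q] [a, b] \<in> Hom C (Dom C b) P"
    "p \<cdot> tuple C P [p, q] [a, b] = a" "q \<cdot> tuple C P [p, q] [a, b] = b"
    using assms by (simp_all add: tuple_def)
qed

lemma product_pair:
  assumes "is_product C [A, B] P [p, q]"
  shows "p \<in> Hom C P A" "q \<in> Hom C P B" "P \<in> Ob C" "A \<in> Ob C" "B \<in> Ob C"
  using assms unfolding is_product_def by auto

lemma product_eqI:
  assumes P: "is_product C [A, B] P [p, q]" and "u \<in> Ar C" "u' \<in> Ar C" "Dom C u = Dom C u'"
    "Cod C u = P" "Cod C u' = P" and e: "p \<cdot> u = p \<cdot> u'" "q \<cdot> u = q \<cdot> u'"
  shows "u = u'"
proof -
  note P' = product_pair[OF P]
  let ?gs = "[p \<cdot> u, q \<cdot> u]"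
  have "product_cone C [A, B] (Dom C u) ?gs"
    using assms(2-6) P' by (simp add: Hom_def)
  then have "\<exists>!u'. u' \<in> Hom C (Dom C u) P \<and> map (\<lambda>p. p \<cdot> u') [p, q] = ?gs"
    by (rule is_productD[OF P _ dom_in_Ob[OF assms(2)]])
  from ex1_eqI[OF this, of u u'] show ?thesis
    by this (use assms(2-6) e in \<open>simp_all add: Hom_def\<close>)
qed

lemma product_triple:
  assumes "is_product C [A, B, D] P [p, q, r]" "a \<in> Hom C Z A" "b \<in> Hom C Z B" "d \<in> Hom C Z D"
  obtains u where "u \<in> Hom C Z P" "p \<cdot> u = a" "q \<cdot> u = b" "r \<cdot> u = d"
proof -
  have "product_cone C [A, B, D] Z [a, b, d]"
    using assms by simp
  moreover have "Z \<in> Ob C" using assms(2) by (auto simp: Hom_def)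
  ultimately have "\<exists>!u. u \<in> Hom C Z P \<and> map (\<lambda>p. p \<cdot> u) [p, q, r] = [a, b, d]"
    by (rule is_productD[OF assms(1)])
  then obtain u where "u \<in> Hom C Z P \<and> map (\<lambda>p. p \<cdot> u) [p, q, r] = [a, b, d]"
    by (rule ex1E)
  then show thesis by (intro that[of u]) simp_all
qed

lemma terminal_arrow:
  assumes "is_product C [] I []" "Z \<in> Ob C"
  shows "to_terminal C I Z \<in> Hom C Z I"
proof -
  have "\<exists>!u. u \<in> Hom C Z I" using assms unfolding is_product_def product_cone_def by simp
  from theI'[OF this] show ?thesis by (simp add: to_terminal_def)
qed

lemma terminal_eqI:
  assumes "is_product C [] I []" "u \<in> Hom C Z I" "u' \<in> Hom C Z I"
  shows "u = u'"
proof -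
  have "Z \<in> Ob C" using assms(2) by (auto simp: Hom_def)
  then have "\<exists>!u. u \<in> Hom C Z I" using assms unfolding is_product_def product_cone_def by simp
  with assms(2,3) show ?thesis by blast
qed

end

section \<open>Abelian group objects: the group laws for generalized elements\<close>

locale abelian_group_obj = category C for C :: "('o, 'm) cat" (structure) +
  fixes G :: "('o, 'm) group_data"
  assumes group_obj: "abelian_group_object C G"
begin

definition gsum :: "'m \<Rightarrow> 'm \<Rightarrow> 'm" where
  "gsum a b = gadd G \<cdot> gpair C G a b"

lemma gprs_pair: "gprs G = [gprs G ! 0, gprs G ! 1]"
proof -
  have "length (gprs G) = 2"
    using group_obj by (auto simp: abelian_group_object_def is_product_def product_cone_def)
  then show ?thesis by (auto intro: nth_equalityI simp: less_2_cases_iff nth_Cons')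
qed

lemma gsq_product: "is_product C [gob G, gob G] (gsq G) [gprs G ! 0, gprs G ! 1]"
  using group_obj gprs_pair by (simp add: abelian_group_object_def)

lemma one_terminal: "is_product C [] (gone G) []"
  using group_obj by (simp add: abelian_group_object_def)

lemma gadd_hom: "gadd G \<in> Hom C (gsq G) (gob G)" and gzero_hom: "gzero G \<in> Hom C (gone G) (gob G)"
  using group_obj by (auto simp: abelian_group_object_def)

lemma gob_Ob [simp]: "gob G \<in> Ob C"
  using product_pair(4)[OF gsq_product] .

lemma gpair:
  assumes "a \<in> Hom C Z (gob G)" "b \<in> Hom C Z (gob G)"
  shows "gpair C G a b \<in> Hom C Z (gsq G)" "gprs G ! 0 \<cdot> gpair C G a b = a"
    "gprs G ! 1 \<cdot> gpair C G a b = b"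
  using product_tuple[OF gsq_product, of a b] assms gprs_pair
  by (auto simp: gpair_def Hom_def)

lemma gpair_comp:
  assumes "a \<in> Hom C Z (gob G)" "b \<in> Hom C Z (gob G)" "h \<in> Hom C Y Z"
  shows "gpair C G a b \<cdot> h = gpair C G (a \<cdot> h) (b \<cdot> h)"
proof (rule product_eqI[OF gsq_product])
  note H = gpair[OF assms(1,2)] product_pair[OF gsq_product]
  have ah: "a \<cdot> h \<in> Hom C Y (gob G)" "b \<cdot> h \<in> Hom C Y (gob G)" using assms by (auto simp: Hom_def)
  note H' = gpair[OF ah]
  show "gprs G ! 0 \<cdot> gpair C G a b \<cdot> h = gprs G ! 0 \<cdot> gpair C G (a \<cdot> h) (b \<cdot> h)"
    "gprs G ! 1 \<cdot> gpair C G a b \<cdot> h = gprs G ! 1 \<cdot> gpair C G (a \<cdot> h) (b \<cdot> h)"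
    unfolding H'(2,3) using H assms
    by (auto intro!: comp_reassoc simp: Hom_def)
  show "gpair C G a b \<cdot> h \<in> Ar C" "gpair C G (a \<cdot> h) (b \<cdot> h) \<in> Ar C"
    "Dom C (gpair C G a b \<cdot> h) = Dom C (gpair C G (a \<cdot> h) (b \<cdot> h))"
    "Cod C (gpair C G a b \<cdot> h) = gsq G" "Cod C (gpair C G (a \<cdot> h) (b \<cdot> h)) = gsq G"
    using H H' assms by (simp_all add: Hom_def)
qed

lemma gsum_hom:
  assumes "a \<in> Hom C Z (gob G)" "b \<in> Hom C Z (gob G)"
  shows "gsum a b \<in> Hom C Z (gob G)"
  using gpair(1)[OF assms] gadd_hom by (auto simp: gsum_def Hom_def)

lemma gsum_comp:
  assumes "a \<in> Hom C Z (gob G)" "b \<in> Hom C Z (gob G)" "h \<in> Hom C Y Z"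
  shows "gsum a b \<cdot> h = gsum (a \<cdot> h) (b \<cdot> h)"
  using gpair(1)[OF assms(1,2)] gadd_hom gpair_comp[OF assms] assms(3)
  by (auto simp: gsum_def Hom_def)

definition gnull :: "'o \<Rightarrow> 'm" where
  "gnull Z = gzero G \<cdot> to_terminal C (gone G) Z"

lemma gnull_hom: "Z \<in> Ob C \<Longrightarrow> gnull Z \<in> Hom C Z (gob G)"
  using terminal_arrow[OF one_terminal, of Z] gzero_hom by (auto simp: gnull_def Hom_def)

lemma gnull_comp:
  assumes "h \<in> Hom C Y Z"
  shows "gnull Z \<cdot> h = gnull Y"
proof -
  have ob: "Y \<in> Ob C" "Z \<in> Ob C" using assms by (auto simp: Hom_def)
  note t = terminal_arrow[OF one_terminal, OF ob(1)] terminal_arrow[OF one_terminal, OF ob(2)]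
  have "to_terminal C (gone G) Z \<cdot> h = to_terminal C (gone G) Y"
    by (rule terminal_eqI[OF one_terminal]) (use t assms in \<open>auto simp: Hom_def\<close>)
  then show ?thesis using t assms gzero_hom by (auto simp: gnull_def Hom_def)
qed

text \<open>The axiom asserts associativity only for the projections of some triple product. These
  form the universal triple: \<open>a\<close>, \<open>b\<close>, \<open>c\<close> arise from them by
  composing with a single arrow \<open>u\<close>, and sums commute with composition.\<close>

lemma gsum_assoc:
  assumes a: "a \<in> Hom C Z (gob G)" and b: "b \<in> Hom C Z (gob G)" and c: "c \<in> Hom C Z (gob G)"
  shows "gsum (gsum a b) c = gsum a (gsum b c)"
proof -
  obtain Q r1 r2 r3 where Q: "is_product C [gob G, gob G, gob G] Q [r1, r2, r3]"
    and eq: "gsum (gsum r1 r2) r3 = gsum r1 (gsum r2 r3)"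
    using group_obj unfolding abelian_group_object_def gsum_def by blast
  obtain u where u: "u \<in> Hom C Z Q" "r1 \<cdot> u = a" "r2 \<cdot> u = b" "r3 \<cdot> u = c"
    using product_triple[OF Q a b c] by metis
  have r: "r1 \<in> Hom C Q (gob G)" "r2 \<in> Hom C Q (gob G)" "r3 \<in> Hom C Q (gob G)"
    using Q unfolding is_product_def by auto
  have "gsum (gsum r1 r2) r3 \<cdot> u = gsum r1 (gsum r2 r3) \<cdot> u" using eq by simp
  then show ?thesis
    using r u by (simp add: gsum_comp[of _ Q _ u Z] gsum_hom)
qed

lemma gsum_commute:
  assumes a: "a \<in> Hom C Z (gob G)" and b: "b \<in> Hom C Z (gob G)"
  shows "gsum a b = gsum b a"
proof -
  have e: "gsum (gprs G ! 1) (gprs G ! 0) = gadd G"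
    using group_obj unfolding abelian_group_object_def gsum_def by blast
  note p = product_pair[OF gsq_product]
  have "gsum b a = gsum (gprs G ! 1) (gprs G ! 0) \<cdot> gpair C G a b"
    using gsum_comp[OF p(2,1) gpair(1)[OF a b]] gpair[OF a b] by simp
  with e show ?thesis by (simp add: gsum_def)
qed

lemma gsum_null:
  assumes a: "a \<in> Hom C Z (gob G)"
  shows "gsum a (gnull Z) = a"
proof -
  have e: "gsum (Ident C (gob G)) (gnull (gob G)) = Ident C (gob G)"
    using group_obj unfolding abelian_group_object_def gsum_def gnull_def by blast
  have "gsum (Ident C (gob G)) (gnull (gob G)) \<cdot> a = gsum a (gnull Z)"
    using gsum_comp[OF _ _ a, of "Ident C (gob G)" "gnull (gob G)"] gnull_hom[of "gob G"] gnull_comp[OF a] a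
    by (auto simp: Hom_def)
  with e show ?thesis using a by (auto simp: Hom_def)
qed

lemma gsum_cancel:
  assumes "a \<in> Hom C Z (gob G)" "b \<in> Hom C Z (gob G)" "c \<in> Hom C Z (gob G)"
    and ab: "gsum a b = gnull Z" and ac: "gsum a c = gnull Z"
  shows "b = c"
proof -
  have "b = gsum b (gsum a c)" by (simp only: ac gsum_null[OF assms(2)])
  also have "\<dots> = gsum (gsum a b) c"
    by (simp only: gsum_assoc[OF assms(2,1,3), symmetric] gsum_commute[OF assms(2,1)])
  also have "\<dots> = gsum c (gsum a b)"
    by (rule gsum_commute[OF gsum_hom[OF assms(1,2)] assms(3)])
  also have "\<dots> = c" by (simp only: ab gsum_null[OF assms(3)])
  finally show ?thesis .
qed

lemma is_neg_iff: "is_neg C G n \<longleftrightarrow> n \<in> Hom C (gob G) (gob G) \<and> gsum (Ident C (gob G)) n = gnull (gob G)"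
  unfolding is_neg_def gsum_def gnull_def ..

text \<open>Uniqueness of inverses among generalized elements makes the description that defines
  \<open>neg\<close> meaningful.\<close>

lemma neg_is_neg: "is_neg C G (neg C G)"
proof -
  obtain n where n: "is_neg C G n"
    using group_obj unfolding abelian_group_object_def by blast
  have "m = n" if m: "is_neg C G m" for m
    using m n gsum_cancel[OF ident_in_Hom[OF gob_Ob]] unfolding is_neg_iff by blast
  with n show ?thesis unfolding neg_def by (rule theI)
qed

lemma gsum_neg:
  assumes a: "a \<in> Hom C Z (gob G)"
  shows "gsum a (neg C G \<cdot> a) = gnull Z"
proof -
  note n = neg_is_neg[unfolded is_neg_iff]
  have "gsum (Ident C (gob G)) (neg C G) \<cdot> a = gsum (Ident C (gob G) \<cdot> a) (neg C G \<cdot> a)"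
    using n by (intro gsum_comp[OF ident_in_Hom[OF gob_Ob] _ a]) simp
  moreover have "Ident C (gob G) \<cdot> a = a" using a by (simp add: Hom_def)
  ultimately show ?thesis by (simp only: conjunct2[OF n] gnull_comp[OF a])
qed

end

text \<open>The fibers of a bundle over \<open>X\<close> form a group object of the slice. Once the
  slice is known to be a category, the results on group objects apply to tangent vectors with a
  common base point.\<close>

lemma (in category) slice_category:
  assumes "X \<in> Ob C"
  shows "category (slice C X)"
proof
  fix p f q g r h t P Q D E
  show "p \<in> Ob (slice C X) \<Longrightarrow> Ident (slice C X) p \<in> Hom (slice C X) p p"
    by (simp add: slice_def Hom_def)
  show "f \<in> Hom (slice C X) P Q \<Longrightarrow> Ident (slice C X) Q \<cdot>\<^bsub>slice C X\<^esub> f = f"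
    by (cases f) (simp add: slice_def Hom_def)
  show "f \<in> Hom (slice C X) P Q \<Longrightarrow> f \<cdot>\<^bsub>slice C X\<^esub> Ident (slice C X) P = f"
    by (cases f) (simp add: slice_def Hom_def)
  show "f \<in> Hom (slice C X) P Q \<Longrightarrow> g \<in> Hom (slice C X) Q D \<Longrightarrow>
      g \<cdot>\<^bsub>slice C X\<^esub> f \<in> Hom (slice C X) P D"
    by (cases f; cases g; simp add: slice_def Hom_def flip: comp_assoc')
  show "f \<in> Hom (slice C X) P Q \<Longrightarrow> g \<in> Hom (slice C X) Q D \<Longrightarrow> h \<in> Hom (slice C X) D E \<Longrightarrow>
      (h \<cdot>\<^bsub>slice C X\<^esub> g) \<cdot>\<^bsub>slice C X\<^esub> f = h \<cdot>\<^bsub>slice C X\<^esub> (g \<cdot>\<^bsub>slice C X\<^esub> f)"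
    by (cases f; cases g; cases h; simp add: slice_def Hom_def)
qed (auto simp: slice_def)

subsection \<open>Addition of generalized tangent vectors\<close>

context rosicky_tangent_category
begin

abbreviation tan_ob ("\<T>") where "\<T> \<equiv> Tob T"
abbreviation tan_ar ("\<D>") where "\<D> \<equiv> Tar T"

lemma tan_ob_Ob [simp]: "X \<in> Ob C \<Longrightarrow> \<T> X \<in> Ob C"
  using T_functor by (simp add: is_functor_def)

lemma tan_ar [simp]:
  assumes "f \<in> Ar C"
  shows "\<D> f \<in> Ar C" "Dom C (\<D> f) = \<T> (Dom C f)" "Cod C (\<D> f) = \<T> (Cod C f)"
  using T_functor assms by (auto simp: is_functor_def Hom_def)

lemma tan_ar_comp [simp]:
  "f \<in> Ar C \<Longrightarrow> g \<in> Ar C \<Longrightarrow> Dom C g = Cod C f \<Longrightarrow> \<D> (g \<cdot> f) = \<D> g \<cdot> \<D> f"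
  using T_functor by (auto simp: is_functor_def)

lemma tan_ar_ident [simp]: "X \<in> Ob C \<Longrightarrow> \<D> (Ident C X) = Ident C (\<T> X)"
  using T_functor by (auto simp: is_functor_def)

lemma proj_arrow [simp]:
  assumes "X \<in> Ob C"
  shows "\<pi> X \<in> Ar C" "Dom C (\<pi> X) = \<T> X" "Cod C (\<pi> X) = X"
  using proj_natural assms by (auto simp: nat_trans_def Hom_def)

lemma zero_arrow [simp]:
  assumes "X \<in> Ob C"
  shows "\<zeta> X \<in> Ar C" "Dom C (\<zeta> X) = X" "Cod C (\<zeta> X) = \<T> X"
  using zero_natural assms by (auto simp: nat_trans_def Hom_def)

lemma lift_arrow [simp]:
  assumes "X \<in> Ob C"
  shows "\<l> X \<in> Ar C" "Dom C (\<l> X) = \<T> X" "Cod C (\<l> X) = \<T> (\<T> X)"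
  using lift_natural assms by (auto simp: nat_trans_def Hom_def)

lemma flip_arrow [simp]:
  assumes "X \<in> Ob C"
  shows "\<tau> X \<in> Ar C" "Dom C (\<tau> X) = \<T> (\<T> X)" "Cod C (\<tau> X) = \<T> (\<T> X)"
  using flip_natural assms by (auto simp: nat_trans_def Hom_def)

lemma plus_arrow [simp]:
  assumes "X \<in> Ob C"
  shows "\<sigma> X \<in> Ar C" "Dom C (\<sigma> X) = Tpow T 2 X" "Cod C (\<sigma> X) = \<T> X"
  using plus_natural assms by (auto simp: nat_trans_def Hom_def)

lemma proj_nat:
  "f \<in> Ar C \<Longrightarrow> Cod C f = Y \<Longrightarrow> \<pi> Y \<cdot> \<D> f = f \<cdot> \<pi> (Dom C f)"
  using proj_natural by (auto simp: nat_trans_def)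

lemma proj_nat':
  assumes "f \<in> Ar C" "Cod C f = Y" "h \<in> Ar C" "Cod C h = \<T> (Dom C f)"
  shows "\<pi> Y \<cdot> \<D> f \<cdot> h = f \<cdot> \<pi> (Dom C f) \<cdot> h"
  using comp_reassoc[OF proj_nat, of f Y h] assms by auto

lemma zero_nat:
  "f \<in> Ar C \<Longrightarrow> Dom C f = X \<Longrightarrow> \<D> f \<cdot> \<zeta> X = \<zeta> (Cod C f) \<cdot> f"
  using zero_natural by (auto simp: nat_trans_def)

lemma zero_nat':
  assumes "f \<in> Ar C" "Dom C f = X" "h \<in> Ar C" "Cod C h = X"
  shows "\<D> f \<cdot> \<zeta> X \<cdot> h = \<zeta> (Cod C f) \<cdot> f \<cdot> h"
  using comp_reassoc[OF zero_nat, of f X h] assms by auto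

lemma lift_nat:
  "f \<in> Ar C \<Longrightarrow> Dom C f = X \<Longrightarrow> \<D> (\<D> f) \<cdot> \<l> X = \<l> (Cod C f) \<cdot> \<D> f"
  using lift_natural by (auto simp: nat_trans_def)

lemma lift_nat':
  assumes "f \<in> Ar C" "Dom C f = X" "h \<in> Ar C" "Cod C h = \<T> X"
  shows "\<D> (\<D> f) \<cdot> \<l> X \<cdot> h = \<l> (Cod C f) \<cdot> \<D> f \<cdot> h"
  using comp_reassoc[OF lift_nat, of f X h] assms by auto

lemma flip_nat:
  "f \<in> Ar C \<Longrightarrow> Dom C f = X \<Longrightarrow> \<D> (\<D> f) \<cdot> \<tau> X = \<tau> (Cod C f) \<cdot> \<D> (\<D> f)"
  using flip_natural by (auto simp: nat_trans_def)

lemma flip_nat':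
  assumes "f \<in> Ar C" "Dom C f = X" "h \<in> Ar C" "Cod C h = \<T> (\<T> X)"
  shows "\<D> (\<D> f) \<cdot> \<tau> X \<cdot> h = \<tau> (Cod C f) \<cdot> \<D> (\<D> f) \<cdot> h"
  using comp_reassoc[OF flip_nat, of f X h] assms by auto

lemma square_power: "X \<in> Ob C \<Longrightarrow> is_fiber_product C [\<pi> X, \<pi> X] (Tpow T 2 X) [p\<^sub>1 X, p\<^sub>2 X]"
  and square_projections: "X \<in> Ob C \<Longrightarrow> Tprs T 2 X = [p\<^sub>1 X, p\<^sub>2 X]"
proof -
  assume X: "X \<in> Ob C"
  have *: "is_fiber_product C [\<pi> X, \<pi> X] (Tpow T 2 X) (Tprs T 2 X)"
    using fiber_powers[OF X, of 2] by (simp add: numeral_2_eq_2)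
  then have "length (Tprs T 2 X) = 2"
    by (simp add: is_fiber_product_def fiber_cone_def product_cone_def)
  then show "Tprs T 2 X = [p\<^sub>1 X, p\<^sub>2 X]"
    by (auto intro: nth_equalityI simp: less_2_cases_iff nth_Cons')
  with * show "is_fiber_product C [\<pi> X, \<pi> X] (Tpow T 2 X) [p\<^sub>1 X, p\<^sub>2 X]" by simp
qed

text \<open>The second projection is written with index \<open>Suc 0\<close> because this is what
  the simplifier makes of the index 1 in \<open>p\<^sub>2\<close>.\<close>

lemma square_arrow [simp]:
  assumes "X \<in> Ob C"
  shows "p\<^sub>1 X \<in> Ar C" "Dom C (p\<^sub>1 X) = Tpow T 2 X" "Cod C (p\<^sub>1 X) = \<T> X"
    "Tprs T 2 X ! Suc 0 \<in> Ar C" "Dom C (Tprs T 2 X ! Suc 0) = Tpow T 2 X" "Cod C (Tprs T 2 X ! Suc 0) = \<T> X"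
    "Tpow T 2 X \<in> Ob C" "\<pi> X \<cdot> Tprs T 2 X ! Suc 0 = \<pi> X \<cdot> p\<^sub>1 X"
  using fiber_product_pair[OF square_power[OF assms]] assms by (auto simp: Hom_def)

text \<open>Arrows \<open>a : Z \<rightarrow> T X\<close> are treated as generalized tangent vectors with base point \<open>\<pi> \<cdot> a\<close>.\<close>

definition cofib :: "'o \<Rightarrow> 'm \<Rightarrow> 'm \<Rightarrow> bool" where
  "cofib X a b \<longleftrightarrow> X \<in> Ob C \<and> a \<in> Ar C \<and> b \<in> Ar C \<and> Dom C a = Dom C b \<and>
     Cod C a = \<T> X \<and> Cod C b = \<T> X \<and> \<pi> X \<cdot> a = \<pi> X \<cdot> b"

definition vadd :: "'m \<Rightarrow> 'o \<Rightarrow> 'm \<Rightarrow> 'm" ("(_ \<oplus>\<^bsub>_\<^esub> _)" [66, 0, 67] 66) where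
  "a \<oplus>\<^bsub>X\<^esub> b = \<sigma> X \<cdot> tpair X a b"

lemma tpair:
  assumes "cofib X a b"
  shows "tpair X a b \<in> Ar C" "Dom C (tpair X a b) = Dom C b" "Cod C (tpair X a b) = Tpow T 2 X"
    "p\<^sub>1 X \<cdot> tpair X a b = a" "Tprs T 2 X ! Suc 0 \<cdot> tpair X a b = b"
  using fiber_tuple[OF square_power, of X a b] assms square_projections[of X]
  by (auto simp: cofib_def Hom_def tpair_def)

lemma tpair_eqI:
  assumes "cofib X a b" "u \<in> Ar C" "Cod C u = Tpow T 2 X" "p\<^sub>1 X \<cdot> u = a" "p\<^sub>2 X \<cdot> u = b"
  shows "u = tpair X a b"
proof (rule fiber_product_eqI[OF square_power])
  show X: "X \<in> Ob C" using assms by (simp add: cofib_def)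
  show "Dom C u = Dom C (tpair X a b)"
    using assms(2,3,5) X by (auto simp: tpair[OF assms(1)])
qed (use assms tpair[OF assms(1)] in simp_all)

lemma tpair_comp:
  assumes "cofib X a b" "h \<in> Ar C" "Cod C h = Dom C b"
  shows "tpair X a b \<cdot> h = tpair X (a \<cdot> h) (b \<cdot> h)"
proof (rule tpair_eqI)
  have X: "X \<in> Ob C" using assms by (simp add: cofib_def)
  note t = tpair[OF assms(1)]
  show "p\<^sub>1 X \<cdot> tpair X a b \<cdot> h = a \<cdot> h" "p\<^sub>2 X \<cdot> tpair X a b \<cdot> h = b \<cdot> h"
    by (rule comp_reassoc; use X t assms(2,3) in simp)+
  have "\<pi> X \<cdot> a \<cdot> h = (\<pi> X \<cdot> b) \<cdot> h"
    by (rule comp_reassoc) (use assms in \<open>simp_all add: cofib_def\<close>)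
  then show "cofib X (a \<cdot> h) (b \<cdot> h)" using assms by (simp add: cofib_def)
qed (use assms tpair[OF assms(1)] in simp_all)

section \<open>The group laws in the fibers of the tangent bundle\<close>

lemma slice_group_obj:
  assumes "X \<in> Ob C"
  shows "abelian_group_obj (slice C X) (slice_group C X (tangent_bundle X))"
  using fiberwise_group[OF assms] slice_category[OF assms]
  by (simp add: abelian_group_obj_def abelian_group_obj_axioms_def abelian_group_bundle_def)

lemma slice_Hom: "(p, f, q) \<in> Hom (slice C X) P Q \<longleftrightarrow> p = P \<and> q = Q \<and> p \<in> Ar C \<and> q \<in> Ar C \<and>
    Cod C p = X \<and> Cod C q = X \<and> f \<in> Hom C (Dom C p) (Dom C q) \<and> q \<cdot> f = p"
  by (auto simp: slice_def Hom_def)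

lemma slice_Hom': "h \<in> Hom (slice C X) P Q \<longleftrightarrow> (\<exists>f. h = (P, f, Q) \<and> P \<in> Ar C \<and> Q \<in> Ar C \<and>
    Cod C P = X \<and> Cod C Q = X \<and> f \<in> Hom C (Dom C P) (Dom C Q) \<and> Q \<cdot> f = P)"
  by (cases h) (auto simp: slice_Hom)

lemma slice_Comp: "(q, g, r) \<cdot>\<^bsub>slice C X\<^esub> (p, f, q') = (p, g \<cdot> f, r)"
  by (simp add: slice_def)

lemma slice_group_simps [simp]:
  "gob (slice_group C X (tangent_bundle X)) = \<pi> X"
  "gone (slice_group C X (tangent_bundle X)) = Ident C X"
  "gsq (slice_group C X (tangent_bundle X)) = \<pi> X \<cdot> p\<^sub>1 X"
  "gprs (slice_group C X (tangent_bundle X)) = map (\<lambda>r. (\<pi> X \<cdot> p\<^sub>1 X, r, \<pi> X)) (Tprs T 2 X)"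
  "gadd (slice_group C X (tangent_bundle X)) = (\<pi> X \<cdot> p\<^sub>1 X, \<sigma> X, \<pi> X)"
  "gzero (slice_group C X (tangent_bundle X)) = (Ident C X, \<zeta> X, \<pi> X)"
  by (simp_all add: slice_group_def tangent_bundle_def Let_def)

lemma slice_vector:
  "cofib X a b \<Longrightarrow> (\<pi> X \<cdot> a, b, \<pi> X) \<in> Hom (slice C X) (\<pi> X \<cdot> a) (\<pi> X)"
  unfolding slice_Hom by (simp add: cofib_def Hom_def)

text \<open>A product in the slice over \<open>X\<close> is a fiber product over \<open>X\<close>,
  so the abstract pairing is \<open>tpair\<close> underneath. Through this lemma the laws of a group
  object become laws of \<open>\<oplus>\<close>.\<close>

lemma slice_gsum:
  assumes ab: "cofib X a b"
  shows "abelian_group_obj.gsum (slice C X) (slice_group C X (tangent_bundle X))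
      (\<pi> X \<cdot> a, a, \<pi> X) (\<pi> X \<cdot> a, b, \<pi> X) = (\<pi> X \<cdot> a, a \<oplus>\<^bsub>X\<^esub> b, \<pi> X)"
proof -
  have X: "X \<in> Ob C" using ab by (simp add: cofib_def)
  interpret G: abelian_group_obj "slice C X" "slice_group C X (tangent_bundle X)"
    by (rule slice_group_obj[OF X])
  let ?u = "gpair (slice C X) (slice_group C X (tangent_bundle X)) (\<pi> X \<cdot> a, a, \<pi> X) (\<pi> X \<cdot> a, b, \<pi> X)"
  have "(\<pi> X \<cdot> a, a, \<pi> X) \<in> Hom (slice C X) (\<pi> X \<cdot> a) (\<pi> X)"
    "(\<pi> X \<cdot> a, b, \<pi> X) \<in> Hom (slice C X) (\<pi> X \<cdot> a) (\<pi> X)"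
    using ab by (auto intro!: slice_vector simp: cofib_def)
  note g = G.gpair[simplified, OF this]
  obtain u where u: "?u = (\<pi> X \<cdot> a, u, \<pi> X \<cdot> p\<^sub>1 X)" and uH: "u \<in> Hom C (Dom C a) (Tpow T 2 X)"
    using g(1) X ab unfolding slice_Hom' by (auto simp: cofib_def)
  have l: "length (Tprs T 2 X) = 2" using square_projections[OF X] by (metis length_Cons list.size(3) numeral_2_eq_2)
  have "u = tpair X a b"
    using g(2,3) u uH X l by (intro tpair_eqI[OF ab]) (auto simp: slice_Comp Hom_def)
  then show ?thesis unfolding G.gsum_def u by (simp add: slice_Comp vadd_def)
qed

lemma vadd_arrow:
  assumes "cofib X a b"
  shows "a \<oplus>\<^bsub>X\<^esub> b \<in> Ar C" "Dom C (a \<oplus>\<^bsub>X\<^esub> b) = Dom C b" "Cod C (a \<oplus>\<^bsub>X\<^esub> b) = \<T> X"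
    "\<pi> X \<cdot> (a \<oplus>\<^bsub>X\<^esub> b) = \<pi> X \<cdot> b"
proof -
  have X: "X \<in> Ob C" using assms by (simp add: cofib_def)
  interpret G: abelian_group_obj "slice C X" "slice_group C X (tangent_bundle X)"
    by (rule slice_group_obj[OF X])
  have "(\<pi> X \<cdot> a, a, \<pi> X) \<in> Hom (slice C X) (\<pi> X \<cdot> a) (\<pi> X)"
    "(\<pi> X \<cdot> a, b, \<pi> X) \<in> Hom (slice C X) (\<pi> X \<cdot> a) (\<pi> X)"
    using assms by (auto intro!: slice_vector simp: cofib_def)
  from G.gsum_hom[simplified, OF this]
  show "\<pi> X \<cdot> (a \<oplus>\<^bsub>X\<^esub> b) = \<pi> X \<cdot> b"
    using assms unfolding slice_gsum[OF assms] slice_Hom by (simp add: cofib_def)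
  show "a \<oplus>\<^bsub>X\<^esub> b \<in> Ar C" "Dom C (a \<oplus>\<^bsub>X\<^esub> b) = Dom C b" "Cod C (a \<oplus>\<^bsub>X\<^esub> b) = \<T> X"
    using tpair[OF assms] X by (auto simp: vadd_def)
qed

lemma vadd_assoc:
  assumes "cofib X a b" "cofib X b c"
  shows "(a \<oplus>\<^bsub>X\<^esub> b) \<oplus>\<^bsub>X\<^esub> c = a \<oplus>\<^bsub>X\<^esub> (b \<oplus>\<^bsub>X\<^esub> c)"
proof -
  have X: "X \<in> Ob C" using assms by (simp add: cofib_def)
  interpret G: abelian_group_obj "slice C X" "slice_group C X (tangent_bundle X)"
    by (rule slice_group_obj[OF X])
  have e: "\<pi> X \<cdot> b = \<pi> X \<cdot> a" "\<pi> X \<cdot> c = \<pi> X \<cdot> a" using assms by (simp_all add: cofib_def)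
  have H: "(\<pi> X \<cdot> a, a, \<pi> X) \<in> Hom (slice C X) (\<pi> X \<cdot> a) (\<pi> X)"
    "(\<pi> X \<cdot> a, b, \<pi> X) \<in> Hom (slice C X) (\<pi> X \<cdot> a) (\<pi> X)"
    "(\<pi> X \<cdot> a, c, \<pi> X) \<in> Hom (slice C X) (\<pi> X \<cdot> a) (\<pi> X)"
    using assms by (auto intro!: slice_vector simp: cofib_def)
  have ab: "cofib X (a \<oplus>\<^bsub>X\<^esub> b) c" "cofib X a (b \<oplus>\<^bsub>X\<^esub> c)"
    using vadd_arrow[OF assms(1)] vadd_arrow[OF assms(2)] assms by (auto simp: cofib_def)
  show ?thesis
    using G.gsum_assoc[simplified, OF H] slice_gsum[OF assms(1)] slice_gsum[OF assms(2)]
      slice_gsum[OF ab(1)] slice_gsum[OF ab(2)] vadd_arrow(4)[OF assms(1)] e by simp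
qed

lemma vadd_commute:
  assumes "cofib X a b"
  shows "a \<oplus>\<^bsub>X\<^esub> b = b \<oplus>\<^bsub>X\<^esub> a"
proof -
  have X: "X \<in> Ob C" using assms by (simp add: cofib_def)
  interpret G: abelian_group_obj "slice C X" "slice_group C X (tangent_bundle X)"
    by (rule slice_group_obj[OF X])
  have H: "(\<pi> X \<cdot> a, a, \<pi> X) \<in> Hom (slice C X) (\<pi> X \<cdot> a) (\<pi> X)"
    "(\<pi> X \<cdot> a, b, \<pi> X) \<in> Hom (slice C X) (\<pi> X \<cdot> a) (\<pi> X)"
    using assms by (auto intro!: slice_vector simp: cofib_def)
  have "cofib X b a" "\<pi> X \<cdot> b = \<pi> X \<cdot> a" using assms by (auto simp: cofib_def)
  with slice_gsum[OF this(1)] show ?thesis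
    using G.gsum_commute[simplified, OF H] slice_gsum[OF assms] by simp
qed

text \<open>The identity of \<open>X\<close> is terminal in the slice, and the unique arrow to it
  from \<open>\<pi> \<cdot> a\<close> has \<open>\<pi> \<cdot> a\<close> itself as underlying arrow.
  So the abstract null element is the zero vector at the base point of \<open>a\<close>.\<close>

lemma slice_gnull:
  assumes a: "cofib X a a"
  shows "abelian_group_obj.gnull (slice C X) (slice_group C X (tangent_bundle X)) (\<pi> X \<cdot> a)
    = (\<pi> X \<cdot> a, \<zeta> X \<cdot> \<pi> X \<cdot> a, \<pi> X)"
proof -
  have X: "X \<in> Ob C" using a by (simp add: cofib_def)
  interpret G: abelian_group_obj "slice C X" "slice_group C X (tangent_bundle X)"
    by (rule slice_group_obj[OF X])
  have "\<pi> X \<cdot> a \<in> Ob (slice C X)" using a by (auto simp: slice_def cofib_def)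
  from G.terminal_arrow[OF G.one_terminal this]
  have "to_terminal (slice C X) (Ident C X) (\<pi> X \<cdot> a) = (\<pi> X \<cdot> a, \<pi> X \<cdot> a, Ident C X)"
    unfolding slice_Hom' using X by (auto simp: Hom_def)
  then show ?thesis by (simp add: G.gnull_def slice_Comp)
qed

lemma vadd_zero:
  assumes a: "X \<in> Ob C" "a \<in> Ar C" "Cod C a = \<T> X"
  shows "a \<oplus>\<^bsub>X\<^esub> (\<zeta> X \<cdot> \<pi> X \<cdot> a) = a" "\<pi> X \<cdot> \<zeta> X = Ident C X"
proof -
  interpret G: abelian_group_obj "slice C X" "slice_group C X (tangent_bundle X)"
    by (rule slice_group_obj[OF a(1)])
  have aa: "cofib X a a" using a by (simp add: cofib_def)
  show z: "\<pi> X \<cdot> \<zeta> X = Ident C X" using G.gzero_hom by (simp add: slice_Hom)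
  have "\<pi> X \<cdot> \<zeta> X \<cdot> \<pi> X \<cdot> a = Ident C X \<cdot> \<pi> X \<cdot> a"
    by (rule comp_reassoc[OF z]) (use a in auto)
  then have "cofib X a (\<zeta> X \<cdot> \<pi> X \<cdot> a)" using a by (simp add: cofib_def)
  from slice_gsum[OF this] show "a \<oplus>\<^bsub>X\<^esub> (\<zeta> X \<cdot> \<pi> X \<cdot> a) = a"
    using G.gsum_null[simplified, OF slice_vector[OF aa]] slice_gnull[OF aa] by simp
qed

text \<open>The negation hidden inside \<open>Tminus\<close>, isolated so that subtraction can be
  undone by the group laws.\<close>

definition vneg :: "'o \<Rightarrow> 'm" where
  "vneg X = underlying (neg (slice C X) (slice_group C X (tangent_bundle X)))"

lemma vneg:
  assumes X: "X \<in> Ob C"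
  shows "vneg X \<in> Ar C" "Dom C (vneg X) = \<T> X" "Cod C (vneg X) = \<T> X" "\<pi> X \<cdot> vneg X = \<pi> X"
    and vadd_neg: "a \<in> Ar C \<Longrightarrow> Cod C a = \<T> X \<Longrightarrow> a \<oplus>\<^bsub>X\<^esub> (vneg X \<cdot> a) = \<zeta> X \<cdot> \<pi> X \<cdot> a"
proof -
  interpret G: abelian_group_obj "slice C X" "slice_group C X (tangent_bundle X)"
    by (rule slice_group_obj[OF X])
  have "neg (slice C X) (slice_group C X (tangent_bundle X)) \<in> Hom (slice C X) (\<pi> X) (\<pi> X)"
    using G.neg_is_neg[unfolded G.is_neg_iff] by simp
  then have n: "neg (slice C X) (slice_group C X (tangent_bundle X)) = (\<pi> X, vneg X, \<pi> X)"
    and v: "vneg X \<in> Hom C (\<T> X) (\<T> X)" "\<pi> X \<cdot> vneg X = \<pi> X"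
    using X unfolding vneg_def underlying_def slice_Hom' by auto
  then show "vneg X \<in> Ar C" "Dom C (vneg X) = \<T> X" "Cod C (vneg X) = \<T> X" "\<pi> X \<cdot> vneg X = \<pi> X"
    by (auto simp: Hom_def)
  assume a: "a \<in> Ar C" "Cod C a = \<T> X"
  have aa: "cofib X a a" using a X by (simp add: cofib_def)
  have "\<pi> X \<cdot> vneg X \<cdot> a = \<pi> X \<cdot> a"
    by (rule comp_reassoc) (use a v X in \<open>auto simp: Hom_def\<close>)
  then have an: "cofib X a (vneg X \<cdot> a)" using a X v by (simp add: cofib_def Hom_def)
  show "a \<oplus>\<^bsub>X\<^esub> (vneg X \<cdot> a) = \<zeta> X \<cdot> \<pi> X \<cdot> a"
    using G.gsum_neg[simplified, OF slice_vector[OF aa]] slice_gsum[OF an] slice_gnull[OF aa]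
    by (simp add: n slice_Comp)
qed

lemma cofibD:
  assumes "cofib X a b"
  shows "X \<in> Ob C" "a \<in> Ar C" "b \<in> Ar C" "Dom C a = Dom C b" "Cod C a = \<T> X" "Cod C b = \<T> X"
    "\<pi> X \<cdot> a = \<pi> X \<cdot> b"
  using assms by (simp_all add: cofib_def)

lemma cofib_sym: "cofib X a b \<Longrightarrow> cofib X b a"
  by (simp add: cofib_def)

lemma cofib_trans: "cofib X a b \<Longrightarrow> cofib X b c \<Longrightarrow> cofib X a c"
  by (simp add: cofib_def)

lemma cofib_comp:
  assumes "cofib X a b" "h \<in> Ar C" "Cod C h = Dom C b"
  shows "cofib X (a \<cdot> h) (b \<cdot> h)"
proof -
  note c = cofibD[OF assms(1)]
  have "\<pi> X \<cdot> a \<cdot> h = (\<pi> X \<cdot> b) \<cdot> h"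
    by (rule comp_reassoc[OF c(7)]) (use assms c(1-6) in simp_all)
  then show ?thesis using assms c(1-6) by (simp add: cofib_def)
qed

lemma cofib_tan:
  assumes "cofib X a b" "f \<in> Ar C" "Dom C f = X"
  shows "cofib (Cod C f) (\<D> f \<cdot> a) (\<D> f \<cdot> b)"
  using cofibD[OF assms(1)] assms(2,3) by (simp add: cofib_def proj_nat')

declare vadd_arrow [simp]

lemma cofib_vadd:
  "cofib X a b \<Longrightarrow> cofib X b c \<Longrightarrow> cofib X (a \<oplus>\<^bsub>X\<^esub> b) c"
  "cofib X a b \<Longrightarrow> cofib X b c \<Longrightarrow> cofib X a (b \<oplus>\<^bsub>X\<^esub> c)"
  using vadd_arrow[of X a b] vadd_arrow[of X b c] by (simp_all add: cofib_def)

lemma vadd_comp [simp]: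
  assumes "cofib X a b" "h \<in> Ar C" "Cod C h = Dom C b"
  shows "(a \<oplus>\<^bsub>X\<^esub> b) \<cdot> h = (a \<cdot> h) \<oplus>\<^bsub>X\<^esub> (b \<cdot> h)"
  using tpair[OF assms(1)] tpair_comp[OF assms] assms cofibD(1)[OF assms(1)] by (simp add: vadd_def)

text \<open>Naturality of \<open>\<sigma>\<close>. Its strength lies in taking structure maps for
  \<open>f\<close>: below it is applied to \<open>\<pi> X\<close>, \<open>\<zeta> X\<close>,
  \<open>\<l> X\<close>, \<open>\<sigma> X\<close>, \<open>\<tau> X\<close> and
  \<open>\<kappa> X\<close>.\<close>

lemma vadd_nat:
  assumes "cofib X a b" "f \<in> Ar C" "Dom C f = X"
  shows "\<D> f \<cdot> (a \<oplus>\<^bsub>X\<^esub> b) = (\<D> f \<cdot> a) \<oplus>\<^bsub>Cod C f\<^esub> (\<D> f \<cdot> b)"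
proof -
  have X: "X \<in> Ob C" using assms by (simp add: cofib_def)
  note t = tpair[OF assms(1)]
  have "cofib X (p\<^sub>1 X) (p\<^sub>2 X)" using X by (auto simp: cofib_def)
  note c = cofib_tan[OF this assms(2,3)]
  have "\<D> f \<cdot> \<sigma> X = \<sigma> (Cod C f) \<cdot> T2ar f"
    using plus_natural assms(2,3) by (auto simp: nat_trans_def)
  then have "\<D> f \<cdot> \<sigma> X \<cdot> tpair X a b = (\<sigma> (Cod C f) \<cdot> T2ar f) \<cdot> tpair X a b"
    by (rule comp_reassoc) (use t assms X in auto)
  then show ?thesis
    using tpair[OF c] tpair_comp[OF c, of "tpair X a b"] t assms X by (simp add: vadd_def T2ar_def)
qed

lemma vadd_cancel:
  assumes ab: "cofib X a b" and ac: "cofib X a c" and e: "a \<oplus>\<^bsub>X\<^esub> b = a \<oplus>\<^bsub>X\<^esub> c"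
  shows "b = c"
proof -
  note c = cofibD[OF ab]
  have n: "cofib X (vneg X \<cdot> a) a"
    using c vneg[OF c(1)] comp_reassoc[OF vneg(4)[OF c(1)], of a] by (simp add: cofib_def)
  have left: "(vneg X \<cdot> a) \<oplus>\<^bsub>X\<^esub> (a \<oplus>\<^bsub>X\<^esub> b) = b" if "cofib X a b" for b
  proof -
    note d = cofibD[OF that]
    have "(vneg X \<cdot> a) \<oplus>\<^bsub>X\<^esub> (a \<oplus>\<^bsub>X\<^esub> b) = (a \<oplus>\<^bsub>X\<^esub> (vneg X \<cdot> a)) \<oplus>\<^bsub>X\<^esub> b"
      using vadd_assoc[OF n that] vadd_commute[OF n] by simp
    also have "\<dots> = (\<zeta> X \<cdot> \<pi> X \<cdot> b) \<oplus>\<^bsub>X\<^esub> b" using vadd_neg[of X a] d by simp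
    also have "\<dots> = b"
      using vadd_zero[of X b] vadd_commute[of X b "\<zeta> X \<cdot> \<pi> X \<cdot> b"] d
        comp_reassoc[OF vadd_zero(2), of X b "\<pi> X \<cdot> b"] by (simp add: cofib_def)
    finally show ?thesis .
  qed
  show ?thesis by (rule trans[OF left[OF ab, symmetric, unfolded e] left[OF ac]])
qed

lemma proj_zero [simp]: "X \<in> Ob C \<Longrightarrow> \<pi> X \<cdot> \<zeta> X = Ident C X"
  using vadd_zero(2)[of X "Ident C (\<T> X)"] by simp

lemma proj_zero' [simp]:
  "X \<in> Ob C \<Longrightarrow> h \<in> Ar C \<Longrightarrow> Cod C h = X \<Longrightarrow> \<pi> X \<cdot> \<zeta> X \<cdot> h = h"
  using comp_reassoc[OF proj_zero, of X h] by simp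

lemma vadd_zero_right [simp]:
  "X \<in> Ob C \<Longrightarrow> a \<in> Ar C \<Longrightarrow> Cod C a = \<T> X \<Longrightarrow> \<pi> X \<cdot> a = x \<Longrightarrow> a \<oplus>\<^bsub>X\<^esub> (\<zeta> X \<cdot> x) = a"
  using vadd_zero(1) by auto

lemma vadd_zero_left [simp]:
  assumes "X \<in> Ob C" "a \<in> Ar C" "Cod C a = \<T> X" "\<pi> X \<cdot> a = x"
  shows "(\<zeta> X \<cdot> x) \<oplus>\<^bsub>X\<^esub> a = a"
proof -
  have "cofib X (\<zeta> X \<cdot> x) a" using assms by (auto simp: cofib_def)
  from vadd_commute[OF this] show ?thesis using assms by simp
qed

text \<open>An idempotent of a group is the zero element. This is how additive operations, such as
  \<open>\<l> X\<close> or multiplication by a scalar, are shown to preserve zero vectors.\<close>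

lemma vadd_idem:
  assumes "X \<in> Ob C" "a \<in> Ar C" "Cod C a = \<T> X" "a \<oplus>\<^bsub>X\<^esub> a = a"
  shows "a = \<zeta> X \<cdot> \<pi> X \<cdot> a"
  by (rule vadd_cancel[of X a]) (use assms in \<open>auto simp: cofib_def\<close>)

section \<open>The flip and the addition in the fibers of the tangent of the projection\<close>

lemma flip_flip' [simp]:
  "X \<in> Ob C \<Longrightarrow> h \<in> Ar C \<Longrightarrow> Cod C h = \<T> (\<T> X) \<Longrightarrow> \<tau> X \<cdot> \<tau> X \<cdot> h = h"
  using comp_reassoc[OF flip_flip, of X h] by simp

lemma proj_flip' [simp]:
  "X \<in> Ob C \<Longrightarrow> h \<in> Ar C \<Longrightarrow> Cod C h = \<T> (\<T> X) \<Longrightarrow> \<pi> (\<T> X) \<cdot> \<tau> X \<cdot> h = \<D> (\<pi> X) \<cdot> h"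
  using comp_reassoc[OF proj_flip, of X h] by simp

lemma tan_proj_flip:
  assumes "X \<in> Ob C"
  shows "\<D> (\<pi> X) \<cdot> \<tau> X = \<pi> (\<T> X)"
  using proj_flip'[of X "\<tau> X"] flip_flip[of X] assms by simp

lemma tan_proj_flip' [simp]:
  "X \<in> Ob C \<Longrightarrow> h \<in> Ar C \<Longrightarrow> Cod C h = \<T> (\<T> X) \<Longrightarrow> \<D> (\<pi> X) \<cdot> \<tau> X \<cdot> h = \<pi> (\<T> X) \<cdot> h"
  using comp_reassoc[OF tan_proj_flip, of X h] by simp

text \<open>Since \<open>T\<close> preserves the fiber product \<open>Tpow T 2 X\<close>, two
  squares with the same \<open>T \<pi>\<close>-edge are one tangent vector \<open>K\<close> to it.
  The addition formula is proved along with this because both need the comparison morphism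
  \<open>nu\<close> and its inverse for a common \<open>Q\<close>.\<close>

lemma tan_square:
  assumes X: "X \<in> Ob C" and "a \<in> Ar C" "b \<in> Ar C" "Dom C a = Dom C b" "Cod C a = \<T> (\<T> X)"
    "Cod C b = \<T> (\<T> X)" "\<D> (\<pi> X) \<cdot> a = \<D> (\<pi> X) \<cdot> b"
  obtains K where "K \<in> Hom C (Dom C a) (\<T> (Tpow T 2 X))" "\<D> (p\<^sub>1 X) \<cdot> K = a" "\<D> (p\<^sub>2 X) \<cdot> K = b"
    and "\<tau> X \<cdot> \<D> (\<sigma> X) = (\<tau> X \<cdot> \<D> (p\<^sub>1 X)) \<oplus>\<^bsub>\<T> X\<^esub> (\<tau> X \<cdot> \<D> (p\<^sub>2 X))"
proof -
  obtain Q qs where Q: "is_fiber_product C [\<D> (\<pi> X), \<D> (\<pi> X)] Q qs" and N: "is_iso C (nu 2 X Q qs)"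
    using fiber_powers_preserved[OF X, of 2] by (auto simp: numeral_2_eq_2)
  have "length qs = 2"
    using Q by (simp add: is_fiber_product_def fiber_cone_def product_cone_def)
  then obtain q1 q2 where q: "qs = [q1, q2]" by (metis One_nat_def Suc_1 length_0_conv length_Suc_conv)
  note Q = Q[unfolded q]
  note q' = fiber_product_pair[OF Q]
  have pp: "\<D> (\<pi> X) \<cdot> \<D> (p\<^sub>1 X) = \<D> (\<pi> X) \<cdot> \<D> (p\<^sub>2 X)"
    using X arg_cong[OF square_arrow(8)[OF X], of "\<D>"] by (simp del: square_arrow(8))
  let ?N = "tuple C Q [q1, q2] [\<D> (p\<^sub>1 X), \<D> (p\<^sub>2 X)]"
  have n: "nu 2 X Q qs = ?N" unfolding nu_def q by (subst square_projections[OF X]) simp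
  have t: "?N \<in> Hom C (\<T> (Tpow T 2 X)) Q" "q1 \<cdot> ?N = \<D> (p\<^sub>1 X)" "q2 \<cdot> ?N = \<D> (p\<^sub>2 X)"
    using fiber_tuple[OF Q, of "\<D> (p\<^sub>1 X)" "\<D> (p\<^sub>2 X)"] X pp by auto
  let ?N' = "inverse_of C ?N"
  have N': "?N' \<in> Hom C Q (\<T> (Tpow T 2 X))" "?N' \<cdot> ?N = Ident C (\<T> (Tpow T 2 X))" "?N \<cdot> ?N' = Ident C Q"
    using inverse_of_inverse[OF N[unfolded n]] t(1) by (auto simp: inverse_arrows_def Hom_def)
  let ?t = "tuple C Q [q1, q2] [a, b]"
  have ab: "?t \<in> Hom C (Dom C a) Q" "q1 \<cdot> ?t = a" "q2 \<cdot> ?t = b"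
    using fiber_tuple[OF Q, of a b] assms by auto
  have "\<D> (p\<^sub>1 X) \<cdot> ?N' \<cdot> ?t = (q1 \<cdot> ?N) \<cdot> ?N' \<cdot> ?t" using t by simp
  also have "\<dots> = q1 \<cdot> ?N \<cdot> ?N' \<cdot> ?t" using t(1) N'(1) ab(1) q' by (intro comp_assoc') (auto simp: Hom_def)
  also have "\<dots> = a" using comp_reassoc[OF N'(3), of ?t] t(1) N'(1) ab q' by (auto simp: Hom_def)
  finally have K1: "\<D> (p\<^sub>1 X) \<cdot> ?N' \<cdot> ?t = a" .
  have "\<D> (p\<^sub>2 X) \<cdot> ?N' \<cdot> ?t = (q2 \<cdot> ?N) \<cdot> ?N' \<cdot> ?t" using t by simp
  also have "\<dots> = q2 \<cdot> ?N \<cdot> ?N' \<cdot> ?t" using t(1) N'(1) ab(1) q' by (intro comp_assoc') (auto simp: Hom_def)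
  also have "\<dots> = b" using comp_reassoc[OF N'(3), of ?t] t(1) N'(1) ab q' by (auto simp: Hom_def)
  finally have K2: "\<D> (p\<^sub>2 X) \<cdot> ?N' \<cdot> ?t = b" .
  have c: "cofib (\<T> X) (\<tau> X \<cdot> q1) (\<tau> X \<cdot> q2)"
    using q' X by (auto simp: cofib_def Hom_def)
  have e: "(\<tau> X \<cdot> q1) \<oplus>\<^bsub>\<T> X\<^esub> (\<tau> X \<cdot> q2) = \<tau> X \<cdot> \<D> (\<sigma> X) \<cdot> ?N'"
    using plus_flip[OF X Q] n[unfolded q] by (simp add: vadd_def)
  \<comment> \<open>Precomposing the axiom \<open>plus_flip\<close> with the comparison morphism
    removes its inverse from the formula.\<close>
  have "(\<tau> X \<cdot> \<D> (p\<^sub>1 X)) \<oplus>\<^bsub>\<T> X\<^esub> (\<tau> X \<cdot> \<D> (p\<^sub>2 X)) = ((\<tau> X \<cdot> q1) \<cdot> ?N) \<oplus>\<^bsub>\<T> X\<^esub> ((\<tau> X \<cdot> q2) \<cdot> ?N)"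
    using t q' X by (simp add: Hom_def)
  also have "\<dots> = ((\<tau> X \<cdot> q1) \<oplus>\<^bsub>\<T> X\<^esub> (\<tau> X \<cdot> q2)) \<cdot> ?N"
    by (rule vadd_comp[OF c, symmetric]) (use t q' X in \<open>auto simp: Hom_def\<close>)
  also have "\<dots> = \<tau> X \<cdot> \<D> (\<sigma> X)"
    unfolding e using N' t(1) X by (simp add: Hom_def)
  finally show thesis using that[OF _ K1 K2] N'(1) ab(1) by (auto simp: Hom_def)
qed

lemma flip_tan_plus:
  assumes X: "X \<in> Ob C"
  shows "\<tau> X \<cdot> \<D> (\<sigma> X) = (\<tau> X \<cdot> \<D> (p\<^sub>1 X)) \<oplus>\<^bsub>\<T> X\<^esub> (\<tau> X \<cdot> \<D> (p\<^sub>2 X))"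
  \<comment> \<open>The addition formula in \<open>tan_square\<close> does not mention
    \<open>a\<close> and \<open>b\<close>, so identities may be taken for them.\<close>
  by (rule tan_square[of X "Ident C (\<T> (\<T> X))" "Ident C (\<T> (\<T> X))"]) (use X in auto)

lemma cofib_flip_tan:
  assumes "cofib X a b"
  shows "cofib (\<T> X) (\<tau> X \<cdot> \<D> a) (\<tau> X \<cdot> \<D> b)"
proof -
  note c = cofibD[OF assms]
  have "\<D> (\<pi> X) \<cdot> \<D> a = \<D> (\<pi> X) \<cdot> \<D> b"
    using arg_cong[OF c(7), of \<D>] c(1-6) by simp
  then show ?thesis using c by (simp add: cofib_def)
qed

lemma flip_tan_comp:
  assumes X: "X \<in> Ob C" and K: "K \<in> Ar C" "Cod C K = \<T> (Tpow T 2 X)"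
  shows "\<tau> X \<cdot> \<D> (\<sigma> X) \<cdot> K = (\<tau> X \<cdot> \<D> (p\<^sub>1 X) \<cdot> K) \<oplus>\<^bsub>\<T> X\<^esub> (\<tau> X \<cdot> \<D> (p\<^sub>2 X) \<cdot> K)"
proof -
  have "cofib X (p\<^sub>1 X) (p\<^sub>2 X)" using X by (auto simp: cofib_def)
  note c = cofib_flip_tan[OF this]
  show ?thesis
    using comp_reassoc[OF flip_tan_plus, of X K] vadd_comp[OF c K(1)] K X by simp
qed

text \<open>Applying \<open>T\<close> to a sum gives a sum in the fibers of \<open>T \<pi>\<close>;
  the flip moves it to the fibers of \<open>\<pi>\<close>, where \<open>\<oplus>\<close>
  lives.\<close>

lemma flip_tan_vadd:
  assumes "cofib X a b"
  shows "\<tau> X \<cdot> \<D> (a \<oplus>\<^bsub>X\<^esub> b) = (\<tau> X \<cdot> \<D> a) \<oplus>\<^bsub>\<T> X\<^esub> (\<tau> X \<cdot> \<D> b)"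
proof -
  have X: "X \<in> Ob C" using assms by (simp add: cofib_def)
  note t = tpair[OF assms]
  have "\<D> (p\<^sub>1 X) \<cdot> \<D> (tpair X a b) = \<D> a" "\<D> (p\<^sub>2 X) \<cdot> \<D> (tpair X a b) = \<D> b"
    using arg_cong[OF t(4), of \<D>] arg_cong[OF t(5), of \<D>] t(1-3) X by simp_all
  then show ?thesis
    using flip_tan_comp[of X "\<D> (tpair X a b)"] t(1-3) X by (simp add: vadd_def)
qed

text \<open>Addition in the fibers of \<open>T \<pi>\<close> instead of \<open>\<pi>\<close>.\<close>

definition hadd :: "'m \<Rightarrow> 'o \<Rightarrow> 'm \<Rightarrow> 'm" ("(_ \<boxplus>\<^bsub>_\<^esub> _)" [66, 0, 67] 66) where
  "a \<boxplus>\<^bsub>X\<^esub> b = \<tau> X \<cdot> ((\<tau> X \<cdot> a) \<oplus>\<^bsub>\<T> X\<^esub> (\<tau> X \<cdot> b))"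

text \<open>Read the pairs (a, c) and (b, d) as vectors \<open>K\<close> and \<open>L\<close>
  tangent to \<open>Tpow T 2 X\<close>. There \<open>T \<sigma>\<close> is the addition
  \<open>\<boxplus>\<close> of the two components, and naturality of \<open>\<sigma>\<close> at
  \<open>\<sigma> X\<close> says that \<open>T \<sigma>\<close> commutes with
  \<open>\<oplus>\<close>. Evaluating \<open>T \<sigma>\<close> on the sum of \<open>K\<close> and
  \<open>L\<close> in both ways gives the two sides.\<close>

lemma interchange:
  assumes ab: "cofib (\<T> X) a b" and cd: "cofib (\<T> X) c d"
    and ac: "\<D> (\<pi> X) \<cdot> a = \<D> (\<pi> X) \<cdot> c" and bd: "\<D> (\<pi> X) \<cdot> b = \<D> (\<pi> X) \<cdot> d"
    and X: "X \<in> Ob C" and dom: "Dom C a = Dom C c"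
  shows "(a \<oplus>\<^bsub>\<T> X\<^esub> b) \<boxplus>\<^bsub>X\<^esub> (c \<oplus>\<^bsub>\<T> X\<^esub> d) = (a \<boxplus>\<^bsub>X\<^esub> c) \<oplus>\<^bsub>\<T> X\<^esub> (b \<boxplus>\<^bsub>X\<^esub> d)"
proof -
  note ab' = cofibD[OF ab] and cd' = cofibD[OF cd]
  obtain K where K: "K \<in> Hom C (Dom C a) (\<T> (Tpow T 2 X))" "\<D> (p\<^sub>1 X) \<cdot> K = a" "\<D> (p\<^sub>2 X) \<cdot> K = c"
    by (rule tan_square[of X a c]) (use X ab' cd' ac dom in auto)
  obtain L where L: "L \<in> Hom C (Dom C b) (\<T> (Tpow T 2 X))" "\<D> (p\<^sub>1 X) \<cdot> L = b" "\<D> (p\<^sub>2 X) \<cdot> L = d"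
    by (rule tan_square[of X b d]) (use X ab' cd' bd dom in auto)
  have S: "\<D> (\<sigma> X) \<cdot> H = (\<D> (p\<^sub>1 X) \<cdot> H) \<boxplus>\<^bsub>X\<^esub> (\<D> (p\<^sub>2 X) \<cdot> H)"
    if "H \<in> Ar C" "Cod C H = \<T> (Tpow T 2 X)" for H
    using arg_cong[OF flip_tan_comp[OF X that], of "\<lambda>u. \<tau> X \<cdot> u"] that X by (simp add: hadd_def)
  \<comment> \<open>\<open>K\<close> and \<open>L\<close> may be added only over a common base
    point. It is compared in both components, where naturality of \<open>\<pi>\<close> reduces it to
    the base points of \<open>a\<close>, \<open>b\<close> and of \<open>c\<close>,
    \<open>d\<close>.\<close>
  have "\<pi> (Tpow T 2 X) \<cdot> K = \<pi> (Tpow T 2 X) \<cdot> L"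
  proof (rule fiber_product_eqI[OF square_power[OF X]])
    have "\<pi> (\<T> X) \<cdot> \<D> (p\<^sub>1 X) \<cdot> K = \<pi> (\<T> X) \<cdot> \<D> (p\<^sub>1 X) \<cdot> L"
      "\<pi> (\<T> X) \<cdot> \<D> (p\<^sub>2 X) \<cdot> K = \<pi> (\<T> X) \<cdot> \<D> (p\<^sub>2 X) \<cdot> L"
      unfolding K L using ab' cd' by simp_all
    then show "p\<^sub>1 X \<cdot> \<pi> (Tpow T 2 X) \<cdot> K = p\<^sub>1 X \<cdot> \<pi> (Tpow T 2 X) \<cdot> L"
      "p\<^sub>2 X \<cdot> \<pi> (Tpow T 2 X) \<cdot> K = p\<^sub>2 X \<cdot> \<pi> (Tpow T 2 X) \<cdot> L"
      using X K(1) L(1) by (simp_all add: proj_nat' Hom_def)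
  qed (use K(1) L(1) X ab' in \<open>auto simp: Hom_def\<close>)
  then have KL: "cofib (Tpow T 2 X) K L" using K(1) L(1) X ab' by (auto simp: cofib_def Hom_def)
  have "\<D> (\<sigma> X) \<cdot> (K \<oplus>\<^bsub>Tpow T 2 X\<^esub> L) = (a \<boxplus>\<^bsub>X\<^esub> c) \<oplus>\<^bsub>\<T> X\<^esub> (b \<boxplus>\<^bsub>X\<^esub> d)"
    using vadd_nat[OF KL, of "\<sigma> X"] S[of K] S[of L] K L X by (simp add: Hom_def)
  moreover have "\<D> (\<sigma> X) \<cdot> (K \<oplus>\<^bsub>Tpow T 2 X\<^esub> L) = (a \<oplus>\<^bsub>\<T> X\<^esub> b) \<boxplus>\<^bsub>X\<^esub> (c \<oplus>\<^bsub>\<T> X\<^esub> d)"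
    using vadd_nat[OF KL, of "p\<^sub>1 X"] vadd_nat[OF KL, of "p\<^sub>2 X"] S[of "K \<oplus>\<^bsub>Tpow T 2 X\<^esub> L"]
      vadd_arrow[OF KL] K L X by simp
  ultimately show ?thesis by simp
qed

subsection \<open>The vertical lift and the action on infinitesimal squares\<close>

text \<open>Since \<open>\<tau> \<cdot> T\<close> is additive and the zero section is its own
  double, \<open>\<tau> \<cdot> T \<zeta>\<close> is idempotent, hence zero over its base point,
  which is the identity of \<open>T X\<close>.\<close>

lemma flip_tan_zero [simp]:
  assumes X: "X \<in> Ob C"
  shows "\<tau> X \<cdot> \<D> (\<zeta> X) = \<zeta> (\<T> X)"
proof -
  have c: "cofib X (\<zeta> X) (\<zeta> X)" using X by (auto simp: cofib_def)
  have z: "\<zeta> X \<oplus>\<^bsub>X\<^esub> \<zeta> X = \<zeta> X" using vadd_zero_right[of X "\<zeta> X" "Ident C X"] X by simp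
  have "\<tau> X \<cdot> \<D> (\<zeta> X) = \<zeta> (\<T> X) \<cdot> \<pi> (\<T> X) \<cdot> \<tau> X \<cdot> \<D> (\<zeta> X)"
    using flip_tan_vadd[OF c] X z by (intro vadd_idem) simp_all
  also have "\<D> (\<pi> X) \<cdot> \<D> (\<zeta> X) = Ident C (\<T> X)"
    using X arg_cong[OF proj_zero[OF X], of \<D>] by (simp del: proj_zero)
  then have "\<zeta> (\<T> X) \<cdot> \<pi> (\<T> X) \<cdot> \<tau> X \<cdot> \<D> (\<zeta> X) = \<zeta> (\<T> X)" using X by simp
  finally show ?thesis .
qed

lemma flip_tan_zero' [simp]:
  "X \<in> Ob C \<Longrightarrow> h \<in> Ar C \<Longrightarrow> Cod C h = \<T> X \<Longrightarrow> \<tau> X \<cdot> \<D> (\<zeta> X) \<cdot> h = \<zeta> (\<T> X) \<cdot> h"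
  using comp_reassoc[OF flip_tan_zero, of X h] by simp

lemma flip_zero' [simp]:
  "X \<in> Ob C \<Longrightarrow> h \<in> Ar C \<Longrightarrow> Cod C h = \<T> X \<Longrightarrow> \<tau> X \<cdot> \<zeta> (\<T> X) \<cdot> h = \<D> (\<zeta> X) \<cdot> h"
  using flip_flip'[of X "\<D> (\<zeta> X) \<cdot> h"] by simp

lemma flip_zero [simp]: "X \<in> Ob C \<Longrightarrow> \<tau> X \<cdot> \<zeta> (\<T> X) = \<D> (\<zeta> X)"
  using flip_zero'[of X "Ident C (\<T> X)"] by simp

lemma tan_proj_zero' [simp]:
  "X \<in> Ob C \<Longrightarrow> h \<in> Ar C \<Longrightarrow> Cod C h = \<T> X \<Longrightarrow> \<D> (\<pi> X) \<cdot> \<D> (\<zeta> X) \<cdot> h = h"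
  using comp_reassoc[of "\<D> (\<pi> X)" "\<D> (\<zeta> X)" "Ident C (\<T> X)" h]
    arg_cong[OF proj_zero[of X], of \<D>] by (simp del: proj_zero)

lemma proj_lift' [simp]:
  "X \<in> Ob C \<Longrightarrow> h \<in> Ar C \<Longrightarrow> Cod C h = \<T> X \<Longrightarrow> \<pi> (\<T> X) \<cdot> \<l> X \<cdot> h = \<zeta> X \<cdot> \<pi> X \<cdot> h"
  using comp_reassoc[OF proj_lift, of X h] by simp

lemma flip_lift' [simp]:
  "X \<in> Ob C \<Longrightarrow> h \<in> Ar C \<Longrightarrow> Cod C h = \<T> X \<Longrightarrow> \<tau> X \<cdot> \<l> X \<cdot> h = \<l> X \<cdot> h"
  using comp_reassoc[OF flip_lift, of X h] by simp

lemma tan_proj_lift' [simp]: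
  "X \<in> Ob C \<Longrightarrow> h \<in> Ar C \<Longrightarrow> Cod C h = \<T> X \<Longrightarrow> \<D> (\<pi> X) \<cdot> \<l> X \<cdot> h = \<zeta> X \<cdot> \<pi> X \<cdot> h"
  using tan_proj_flip'[of X "\<l> X \<cdot> h"] by simp

lemma cofib_lift:
  assumes "cofib X a b"
  shows "cofib (\<T> X) (\<l> X \<cdot> a) (\<l> X \<cdot> b)"
  using assms by (simp add: cofib_def)

lemma lift_vadd:
  assumes ab: "cofib X a b"
  shows "\<l> X \<cdot> (a \<oplus>\<^bsub>X\<^esub> b) = (\<l> X \<cdot> a) \<oplus>\<^bsub>\<T> X\<^esub> (\<l> X \<cdot> b)"
proof -
  note c = cofibD[OF ab] and t = tpair[OF ab]
  have p: "cofib (\<T> X) (\<l> X \<cdot> p\<^sub>1 X) (\<l> X \<cdot> p\<^sub>2 X)"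
    using c(1) by (intro cofib_lift) (auto simp: cofib_def)
  have "((\<l> X \<cdot> p\<^sub>1 X) \<oplus>\<^bsub>\<T> X\<^esub> (\<l> X \<cdot> p\<^sub>2 X)) \<cdot> tpair X a b = \<l> X \<cdot> \<sigma> X \<cdot> tpair X a b"
    using plus_lift[OF c(1)] t c(1) by (simp add: vadd_def)
  then show ?thesis using vadd_comp[OF p, of "tpair X a b"] c(1) t by (simp add: vadd_def)
qed

lemma lift_zero' [simp]:
  assumes X: "X \<in> Ob C" and h: "h \<in> Ar C" "Cod C h = X"
  shows "\<l> X \<cdot> \<zeta> X \<cdot> h = \<zeta> (\<T> X) \<cdot> \<zeta> X \<cdot> h"
proof -
  have c: "cofib X (\<zeta> X \<cdot> h) (\<zeta> X \<cdot> h)" using X h by (auto simp: cofib_def)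
  have "\<l> X \<cdot> \<zeta> X \<cdot> h = \<zeta> (\<T> X) \<cdot> \<pi> (\<T> X) \<cdot> \<l> X \<cdot> \<zeta> X \<cdot> h"
    using lift_vadd[OF c] X h by (intro vadd_idem) simp_all
  then show ?thesis using X h by simp
qed

lemma vneg_nat:
  assumes "f \<in> Ar C" "Dom C f = X" "h \<in> Ar C" "Cod C h = \<T> X"
  shows "\<D> f \<cdot> vneg X \<cdot> h = vneg (Cod C f) \<cdot> \<D> f \<cdot> h"
proof -
  have X: "X \<in> Ob C" and Y: "Cod C f \<in> Ob C" using assms by auto
  note n = vneg(1-4)[OF X] and m = vneg(1-4)[OF Y]
  have "\<pi> X \<cdot> vneg X \<cdot> h = \<pi> X \<cdot> h" by (rule comp_reassoc) (use n X assms in auto)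
  then have c: "cofib X h (vneg X \<cdot> h)" using n X assms by (simp add: cofib_def)
  have "\<pi> (Cod C f) \<cdot> vneg (Cod C f) \<cdot> \<D> f \<cdot> h = \<pi> (Cod C f) \<cdot> \<D> f \<cdot> h"
    by (rule comp_reassoc) (use m Y assms in auto)
  then have d: "cofib (Cod C f) (\<D> f \<cdot> h) (vneg (Cod C f) \<cdot> \<D> f \<cdot> h)"
    using m Y assms by (simp add: cofib_def)
  show ?thesis
  proof (rule vadd_cancel[OF cofib_tan[OF c assms(1,2)] d])
    show "(\<D> f \<cdot> h) \<oplus>\<^bsub>Cod C f\<^esub> (\<D> f \<cdot> vneg X \<cdot> h) = (\<D> f \<cdot> h) \<oplus>\<^bsub>Cod C f\<^esub> (vneg (Cod C f) \<cdot> \<D> f \<cdot> h)"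
      using vadd_nat[OF c assms(1,2)] vadd_neg[OF X assms(3,4)] vadd_neg[OF Y, of "\<D> f \<cdot> h"] assms X Y
      by (simp add: zero_nat' proj_nat')
  qed
qed

lemma cofib_neg:
  assumes "cofib X a b"
  shows "cofib X a (vneg X \<cdot> b)"
proof -
  note c = cofibD[OF assms]
  have "\<pi> X \<cdot> vneg X \<cdot> b = \<pi> X \<cdot> b" by (rule comp_reassoc) (use vneg(1-4)[OF c(1)] c in auto)
  then show ?thesis using c vneg(1-4)[OF c(1)] by (simp add: cofib_def)
qed

text \<open>In coordinates, \<open>vlift X a u\<close> is the infinitesimal square \<open>(s, t) \<mapsto> a(t) + s t u\<close>.\<close>

definition vlift :: "'o \<Rightarrow> 'm \<Rightarrow> 'm \<Rightarrow> 'm" where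
  "vlift X a u = \<tau> X \<cdot> ((\<D> (\<zeta> X) \<cdot> a) \<oplus>\<^bsub>\<T> X\<^esub> (\<l> X \<cdot> u))"

lemma cofib_vlift:
  assumes "cofib X a u"
  shows "cofib (\<T> X) (\<D> (\<zeta> X) \<cdot> a) (\<l> X \<cdot> u)"
  using assms by (simp add: cofib_def proj_nat')

lemma vlift_arrow [simp]:
  assumes "cofib X a u"
  shows "vlift X a u \<in> Ar C" "Dom C (vlift X a u) = Dom C u" "Cod C (vlift X a u) = \<T> (\<T> X)"
    "\<pi> (\<T> X) \<cdot> vlift X a u = a" "\<D> (\<pi> X) \<cdot> vlift X a u = \<zeta> X \<cdot> \<pi> X \<cdot> u"
proof -
  note c = cofibD[OF assms] and d = cofib_vlift[OF assms]
  show "vlift X a u \<in> Ar C" "Dom C (vlift X a u) = Dom C u" "Cod C (vlift X a u) = \<T> (\<T> X)"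
    "\<D> (\<pi> X) \<cdot> vlift X a u = \<zeta> X \<cdot> \<pi> X \<cdot> u"
    using c vadd_arrow[OF d] by (simp_all add: vlift_def)
  have "\<D> (\<pi> X) \<cdot> ((\<D> (\<zeta> X) \<cdot> a) \<oplus>\<^bsub>\<T> X\<^esub> (\<l> X \<cdot> u)) = a"
    using vadd_nat[OF d, of "\<pi> X"] c by simp
  then show "\<pi> (\<T> X) \<cdot> vlift X a u = a" using c vadd_arrow[OF d] by (simp add: vlift_def)
qed

lemma ext_lift_vlift:
  assumes "cofib X a u"
  shows "ext_lift X \<cdot> tpair X a u = vlift X a u"
proof -
  note c = cofibD[OF assms] and t = tpair[OF assms]
  have p: "cofib (\<T> X) (\<D> (\<zeta> X) \<cdot> p\<^sub>1 X) (\<l> X \<cdot> p\<^sub>2 X)"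
    by (rule cofib_vlift) (use c(1) in \<open>auto simp: cofib_def\<close>)
  have "ext_lift X \<cdot> tpair X a u = (\<tau> X \<cdot> ((\<D> (\<zeta> X) \<cdot> p\<^sub>1 X) \<oplus>\<^bsub>\<T> X\<^esub> (\<l> X \<cdot> p\<^sub>2 X))) \<cdot> tpair X a u"
    by (simp add: ext_lift_def vadd_def)
  also have "\<dots> = \<tau> X \<cdot> ((\<D> (\<zeta> X) \<cdot> p\<^sub>1 X) \<oplus>\<^bsub>\<T> X\<^esub> (\<l> X \<cdot> p\<^sub>2 X)) \<cdot> tpair X a u"
    using c(1) t vadd_arrow[OF p] by simp
  also have "\<dots> = vlift X a u"
    using c(1) t vadd_comp[OF p, of "tpair X a u"] by (simp add: vlift_def)
  finally show ?thesis .
qed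

lemma vlift_comp [simp]:
  assumes "cofib X a u" "h \<in> Ar C" "Cod C h = Dom C u"
  shows "vlift X a u \<cdot> h = vlift X (a \<cdot> h) (u \<cdot> h)"
  using vadd_arrow[OF cofib_vlift[OF assms(1)]] vadd_comp[OF cofib_vlift[OF assms(1)] assms(2)]
    assms cofibD[OF assms(1)] by (simp add: vlift_def)

lemma vlift_nat:
  assumes "cofib X a u" "f \<in> Ar C" "Dom C f = X"
  shows "\<D> (\<D> f) \<cdot> vlift X a u = vlift (Cod C f) (\<D> f \<cdot> a) (\<D> f \<cdot> u)"
proof -
  note c = cofibD[OF assms(1)] and d = cofib_vlift[OF assms(1)]
  have z: "\<D> (\<D> f) \<cdot> \<D> (\<zeta> X) \<cdot> a = \<D> (\<zeta> (Cod C f)) \<cdot> \<D> f \<cdot> a"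
    using arg_cong[OF zero_nat[OF assms(2,3)], of \<D>] assms c
      comp_reassoc[of "\<D> (\<D> f)" "\<D> (\<zeta> X)" "\<D> (\<zeta> (Cod C f)) \<cdot> \<D> f" a] by simp
  show ?thesis
    using c assms vadd_arrow[OF d] vadd_nat[OF d, of "\<D> f"] z
    by (simp add: vlift_def flip_nat' lift_nat')
qed

lemma flip_vlift:
  "cofib X a u \<Longrightarrow> \<tau> X \<cdot> vlift X a u = (\<D> (\<zeta> X) \<cdot> a) \<oplus>\<^bsub>\<T> X\<^esub> (\<l> X \<cdot> u)"
  using vadd_arrow[OF cofib_vlift, of X a u] by (simp add: vlift_def cofib_def)

text \<open>The flip fixes \<open>\<l>\<close> and exchanges \<open>\<zeta> (T X)\<close> with
  \<open>T \<zeta>\<close>. In this form the lift is accessible to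
  \<open>interchange\<close>.\<close>

lemma vlift_hadd: "cofib X a u \<Longrightarrow> vlift X a u = (\<zeta> (\<T> X) \<cdot> a) \<boxplus>\<^bsub>X\<^esub> (\<l> X \<cdot> u)"
  by (simp add: vlift_def hadd_def cofib_def)

lemma vlift_zero:
  assumes "X \<in> Ob C" "a \<in> Ar C" "Cod C a = \<T> X" "\<pi> X \<cdot> a = x"
  shows "vlift X a (\<zeta> X \<cdot> x) = \<zeta> (\<T> X) \<cdot> a"
proof -
  have "(\<D> (\<zeta> X) \<cdot> a) \<oplus>\<^bsub>\<T> X\<^esub> (\<zeta> (\<T> X) \<cdot> \<zeta> X \<cdot> x) = \<D> (\<zeta> X) \<cdot> a"
    by (rule vadd_zero_right) (use assms in \<open>auto simp: proj_nat'\<close>)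
  then show ?thesis using assms by (auto simp: vlift_def)
qed

text \<open>After a flip the outer sum becomes \<open>\<boxplus>\<close>, and
  \<open>interchange\<close> separates the two kinds of summand. The summands
  \<open>T \<zeta> \<cdot> a\<close> are neutral for \<open>\<boxplus>\<close> and do not double;
  the lifts \<open>\<l> \<cdot> u\<close> and \<open>\<l> \<cdot> w\<close> add up because
  \<open>\<l>\<close> is additive and fixed by the flip.\<close>

lemma vlift_vadd:
  assumes au: "cofib X a u" and uw: "cofib X u w"
  shows "vlift X a u \<oplus>\<^bsub>\<T> X\<^esub> vlift X a w = vlift X a (u \<oplus>\<^bsub>X\<^esub> w)"
proof -
  have aw: "cofib X a w" using cofib_trans[OF au uw] .
  note c = cofibD[OF au] and d = cofibD[OF uw]
  note cu = cofib_vlift[OF au] and cw = cofib_vlift[OF aw]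
  have vv: "cofib (\<T> X) (vlift X a u) (vlift X a w)"
    using vlift_arrow[OF au] vlift_arrow[OF aw] c d by (simp add: cofib_def)
  have "\<tau> X \<cdot> (vlift X a u \<oplus>\<^bsub>\<T> X\<^esub> vlift X a w)
      = ((\<D> (\<zeta> X) \<cdot> a) \<oplus>\<^bsub>\<T> X\<^esub> (\<l> X \<cdot> u)) \<boxplus>\<^bsub>X\<^esub> ((\<D> (\<zeta> X) \<cdot> a) \<oplus>\<^bsub>\<T> X\<^esub> (\<l> X \<cdot> w))"
    by (simp add: hadd_def vlift_def)
  also have "\<dots> = ((\<D> (\<zeta> X) \<cdot> a) \<boxplus>\<^bsub>X\<^esub> (\<D> (\<zeta> X) \<cdot> a)) \<oplus>\<^bsub>\<T> X\<^esub> ((\<l> X \<cdot> u) \<boxplus>\<^bsub>X\<^esub> (\<l> X \<cdot> w))"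
    by (rule interchange[OF cu cw]) (use c d in simp_all)
  also have "(\<D> (\<zeta> X) \<cdot> a) \<boxplus>\<^bsub>X\<^esub> (\<D> (\<zeta> X) \<cdot> a) = \<D> (\<zeta> X) \<cdot> a"
    using c vadd_zero_right[of "\<T> X" "\<zeta> (\<T> X) \<cdot> a" a] by (simp add: hadd_def)
  also have "(\<l> X \<cdot> u) \<boxplus>\<^bsub>X\<^esub> (\<l> X \<cdot> w) = \<l> X \<cdot> (u \<oplus>\<^bsub>X\<^esub> w)"
    using c d lift_vadd[OF uw] flip_lift'[of X "u \<oplus>\<^bsub>X\<^esub> w"] vadd_arrow[OF uw] by (simp add: hadd_def)
  finally have "\<tau> X \<cdot> \<tau> X \<cdot> (vlift X a u \<oplus>\<^bsub>\<T> X\<^esub> vlift X a w) = vlift X a (u \<oplus>\<^bsub>X\<^esub> w)"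
    by (simp add: vlift_def)
  then show ?thesis using vadd_arrow[OF vv] c by simp
qed

text \<open>The legs \<open>\<l>\<close> and \<open>\<pi>\<close> of the pullback square of the
  vertical lift are jointly monic.\<close>

lemma lift_mono:
  assumes X: "X \<in> Ob C" and "u \<in> Ar C" "w \<in> Ar C" "Cod C u = \<T> X" "Cod C w = \<T> X" "\<pi> X \<cdot> u = \<pi> X \<cdot> w"
    "\<l> X \<cdot> u = \<l> X \<cdot> w"
  shows "u = w"
proof (rule fiber_product_eqI[OF lift_pullback[OF X]])
  show "Dom C u = Dom C w" using assms comp_arrow(2)[of u "\<pi> X"] comp_arrow(2)[of w "\<pi> X"] by simp
qed (use assms in auto)

lemma vlift_eqD:
  assumes u: "cofib X a u" and w: "cofib X a w" and e: "vlift X a u = vlift X a w"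
  shows "u = w"
proof -
  note c = cofibD[OF u] and d = cofibD[OF w]
  have cw: "cofib (\<T> X) (\<D> (\<zeta> X) \<cdot> a) (\<l> X \<cdot> w)" by (rule cofib_vlift[OF w])
  have "\<l> X \<cdot> u = \<l> X \<cdot> w"
    by (rule vadd_cancel[OF cofib_vlift[OF u] cw])
      (simp only: flip_vlift[OF u, symmetric] flip_vlift[OF w, symmetric] e)
  then show ?thesis by (rule lift_mono[OF c(1,3) d(3) c(6) d(6) trans[OF c(7)[symmetric] d(7)]])
qed

text \<open>Existence in the pullback property of the extended lift, reduced to that of
  \<open>\<l>\<close>: the part of \<open>s\<close> that does not vanish on the edges is subtracted,
  the remainder is a vertical lift, and the subtracted part is added again.\<close>

lemma vlift_ex:
  assumes X: "X \<in> Ob C" and s: "s \<in> Ar C" "Cod C s = \<T> (\<T> X)"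
    and y: "y \<in> Ar C" "Cod C y = X" "\<D> (\<pi> X) \<cdot> s = \<zeta> X \<cdot> y"
  obtains u where "cofib X (\<pi> (\<T> X) \<cdot> s) u" "vlift X (\<pi> (\<T> X) \<cdot> s) u = s"
proof -
  let ?a = "\<pi> (\<T> X) \<cdot> s"
  note n = vneg(1-4)[OF X]
  have "Dom C s = Dom C (\<D> (\<pi> X) \<cdot> s)" using X s by simp
  then have dom: "Dom C s = Dom C y" unfolding y(3) using X y by simp
  have "\<pi> X \<cdot> ?a = \<pi> X \<cdot> \<D> (\<pi> X) \<cdot> s" using X s by (simp add: proj_nat')
  then have pa: "\<pi> X \<cdot> ?a = y" using X y by simp
  have "\<pi> X \<cdot> vneg X \<cdot> ?a = \<pi> X \<cdot> ?a" by (rule comp_reassoc) (use n X s in auto)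
  with pa have pn: "\<pi> X \<cdot> vneg X \<cdot> ?a = y" by simp
  let ?z = "\<D> (\<zeta> X) \<cdot> vneg X \<cdot> ?a"
  have an: "cofib X ?a (vneg X \<cdot> ?a)" using pa pn X s n by (simp add: cofib_def)
  have c: "cofib (\<T> X) (\<tau> X \<cdot> s) ?z"
    using X s n y pn by (simp add: cofib_def proj_nat')
  \<comment> \<open>The flipped square minus the square \<open>T \<zeta> \<cdot> ?a\<close>. Both
    edges of the difference are zero vectors at \<open>y\<close>, so it is a cone over the pullback
    square of \<open>\<l>\<close>.\<close>
  let ?d = "(\<tau> X \<cdot> s) \<oplus>\<^bsub>\<T> X\<^esub> ?z"
  have d: "?d \<in> Ar C" "Dom C ?d = Dom C y" "Cod C ?d = \<T> (\<T> X)" "\<pi> (\<T> X) \<cdot> ?d = \<zeta> X \<cdot> y"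
    using vadd_arrow[OF c] X s n dom pn by (simp_all add: proj_nat')
  have "\<D> (\<pi> X) \<cdot> ?d = ?a \<oplus>\<^bsub>X\<^esub> (vneg X \<cdot> ?a)"
    using vadd_nat[OF c, of "\<pi> X"] X s n by simp
  also have "\<dots> = \<zeta> X \<cdot> y" using vadd_neg[OF X, of ?a] X s pa by simp
  finally have dd: "\<D> (\<pi> X) \<cdot> ?d = \<zeta> X \<cdot> y" .
  have pp: "cofib X (\<pi> (\<T> X)) (\<D> (\<pi> X))" "cofib X (\<zeta> X) (\<zeta> X)"
    using X by (auto simp: cofib_def proj_nat)
  have cone: "tpair X (\<pi> (\<T> X)) (\<D> (\<pi> X)) \<cdot> ?d = tpair X (\<zeta> X) (\<zeta> X) \<cdot> y"
    using tpair_comp[OF pp(1), of ?d] tpair_comp[OF pp(2), of y] d dd X y by simp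
  have t: "tpair X (\<pi> (\<T> X)) (\<D> (\<pi> X)) \<in> Ar C" "Dom C (tpair X (\<pi> (\<T> X)) (\<D> (\<pi> X))) = \<T> (\<T> X)"
     "tpair X (\<zeta> X) (\<zeta> X) \<in> Ar C" "Dom C (tpair X (\<zeta> X) (\<zeta> X)) = X"
    using tpair[OF pp(1)] tpair[OF pp(2)] X by simp_all
  let ?u = "tuple C (\<T> X) [\<l> X, \<pi> X] [?d, y]"
  have u: "?u \<in> Hom C (Dom C y) (\<T> X)" "\<l> X \<cdot> ?u = ?d" "\<pi> X \<cdot> ?u = y"
    using fiber_tuple[OF lift_pullback[OF X] d(1) y(1) d(2) _ _ cone] d y t by simp_all
  then have au: "cofib X ?a ?u" using X s pa dom by (simp add: cofib_def Hom_def)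
  have cz: "cofib (\<T> X) (\<D> (\<zeta> X) \<cdot> ?a) (\<tau> X \<cdot> s)"
    using X s y pa by (simp add: cofib_def proj_nat')
  \<comment> \<open>Adding \<open>T \<zeta> \<cdot> ?a\<close> cancels \<open>?z\<close>, because
    \<open>T \<zeta>\<close> is additive.\<close>
  have "(\<D> (\<zeta> X) \<cdot> ?a) \<oplus>\<^bsub>\<T> X\<^esub> ?d = ((\<D> (\<zeta> X) \<cdot> ?a) \<oplus>\<^bsub>\<T> X\<^esub> ?z) \<oplus>\<^bsub>\<T> X\<^esub> (\<tau> X \<cdot> s)"
    unfolding vadd_commute[OF c]
    by (rule vadd_assoc[symmetric]) (use cofib_trans[OF cz c] cofib_sym[OF c] in auto)
  also have "(\<D> (\<zeta> X) \<cdot> ?a) \<oplus>\<^bsub>\<T> X\<^esub> ?z = \<zeta> (\<T> X) \<cdot> \<zeta> X \<cdot> y"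
    using vadd_nat[OF an, of "\<zeta> X"] vadd_neg[OF X, of ?a] X s pa y by (simp add: zero_nat')
  also have "(\<zeta> (\<T> X) \<cdot> \<zeta> X \<cdot> y) \<oplus>\<^bsub>\<T> X\<^esub> (\<tau> X \<cdot> s) = \<tau> X \<cdot> s"
    by (rule vadd_zero_left) (use X s y in simp_all)
  finally have "vlift X ?a ?u = s" using u(2) X s by (simp add: vlift_def)
  with au that show thesis by blast
qed

section \<open>The torsor action of tangent vectors on infinitesimal squares\<close>

lemma vadd_shuffle:
  assumes ab: "cofib X a b" and bc: "cofib X b c" and cd: "cofib X c d"
  shows "(a \<oplus>\<^bsub>X\<^esub> b) \<oplus>\<^bsub>X\<^esub> (c \<oplus>\<^bsub>X\<^esub> d) = (a \<oplus>\<^bsub>X\<^esub> c) \<oplus>\<^bsub>X\<^esub> (b \<oplus>\<^bsub>X\<^esub> d)"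
proof -
  have bd: "cofib X b d" using cofib_trans[OF bc cd] .
  have ac: "cofib X a c" using cofib_trans[OF ab bc] .
  have "(a \<oplus>\<^bsub>X\<^esub> b) \<oplus>\<^bsub>X\<^esub> (c \<oplus>\<^bsub>X\<^esub> d) = a \<oplus>\<^bsub>X\<^esub> ((b \<oplus>\<^bsub>X\<^esub> c) \<oplus>\<^bsub>X\<^esub> d)"
    by (simp only: vadd_assoc[OF ab cofib_vadd(2)[OF bc cd]] vadd_assoc[OF bc cd])
  also have "\<dots> = a \<oplus>\<^bsub>X\<^esub> (c \<oplus>\<^bsub>X\<^esub> (b \<oplus>\<^bsub>X\<^esub> d))"
    by (simp only: vadd_commute[OF bc] vadd_assoc[OF cofib_sym[OF bc] bd])
  also have "\<dots> = (a \<oplus>\<^bsub>X\<^esub> c) \<oplus>\<^bsub>X\<^esub> (b \<oplus>\<^bsub>X\<^esub> d)"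
    by (rule vadd_assoc[symmetric, OF ac cofib_vadd(2)[OF cofib_sym[OF bc] bd]])
  finally show ?thesis .
qed

text \<open>\<open>A \<lhd> k\<close> is the infinitesimal square \<open>(s, t) \<mapsto> A(s, t) + s t k\<close>: the squares with given edges form
  a torsor under the tangent vectors at their corner (the strong difference of Kock and Lavendhomme).\<close>

definition actable :: "'o \<Rightarrow> 'm \<Rightarrow> 'm \<Rightarrow> bool" where
  "actable X A k \<longleftrightarrow> A \<in> Ar C \<and> Cod C A = \<T> (\<T> X) \<and> cofib X (\<pi> (\<T> X) \<cdot> A) k"

definition act :: "'m \<Rightarrow> 'o \<Rightarrow> 'm \<Rightarrow> 'm" ("(_ \<lhd>\<^bsub>_\<^esub> _)" [66, 0, 67] 66) where
  "A \<lhd>\<^bsub>X\<^esub> k = A \<oplus>\<^bsub>\<T> X\<^esub> vlift X (\<pi> (\<T> X) \<cdot> A) k"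

lemma actableD:
  assumes "actable X A k"
  shows "A \<in> Ar C" "Cod C A = \<T> (\<T> X)" "cofib X (\<pi> (\<T> X) \<cdot> A) k" "Dom C A = Dom C k"
    "X \<in> Ob C" "k \<in> Ar C" "Cod C k = \<T> X" "\<pi> X \<cdot> \<pi> (\<T> X) \<cdot> A = \<pi> X \<cdot> k"
  using assms by (auto simp: actable_def cofib_def)

lemma cofib_act:
  assumes "actable X A k"
  shows "cofib (\<T> X) A (vlift X (\<pi> (\<T> X) \<cdot> A) k)"
  using actableD[OF assms] by (simp add: cofib_def)

lemma act_arrow [simp]:
  assumes "actable X A k"
  shows "A \<lhd>\<^bsub>X\<^esub> k \<in> Ar C" "Dom C (A \<lhd>\<^bsub>X\<^esub> k) = Dom C k" "Cod C (A \<lhd>\<^bsub>X\<^esub> k) = \<T> (\<T> X)"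
    "\<pi> (\<T> X) \<cdot> (A \<lhd>\<^bsub>X\<^esub> k) = \<pi> (\<T> X) \<cdot> A" "\<D> (\<pi> X) \<cdot> (A \<lhd>\<^bsub>X\<^esub> k) = \<D> (\<pi> X) \<cdot> A"
proof -
  note a = actableD[OF assms] and c = cofib_act[OF assms]
  show "A \<lhd>\<^bsub>X\<^esub> k \<in> Ar C" "Dom C (A \<lhd>\<^bsub>X\<^esub> k) = Dom C k" "Cod C (A \<lhd>\<^bsub>X\<^esub> k) = \<T> (\<T> X)"
    "\<pi> (\<T> X) \<cdot> (A \<lhd>\<^bsub>X\<^esub> k) = \<pi> (\<T> X) \<cdot> A"
    using a vadd_arrow[OF c] by (simp_all add: act_def)
  show "\<D> (\<pi> X) \<cdot> (A \<lhd>\<^bsub>X\<^esub> k) = \<D> (\<pi> X) \<cdot> A"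
    using a vadd_nat[OF c, of "\<pi> X"] by (simp add: act_def proj_nat')
qed

lemma act_comp:
  assumes "actable X A k" "h \<in> Ar C" "Cod C h = Dom C k"
  shows "(A \<lhd>\<^bsub>X\<^esub> k) \<cdot> h = (A \<cdot> h) \<lhd>\<^bsub>X\<^esub> (k \<cdot> h)"
  using actableD[OF assms(1)] vadd_comp[OF cofib_act[OF assms(1)] assms(2)] assms by (simp add: act_def)

lemma actable_comp:
  assumes "actable X A k" "h \<in> Ar C" "Cod C h = Dom C k"
  shows "actable X (A \<cdot> h) (k \<cdot> h)"
  using actableD[OF assms(1)] assms(2,3) cofib_comp[OF actableD(3)[OF assms(1)] assms(2)]
  by (simp add: actable_def)

lemma actable_tan:
  assumes "actable X A k" "f \<in> Ar C" "Dom C f = X"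
  shows "actable (Cod C f) (\<D> (\<D> f) \<cdot> A) (\<D> f \<cdot> k)"
  using actableD[OF assms(1)] assms(2,3) cofib_tan[OF actableD(3)[OF assms(1)] assms(2)]
  by (simp add: actable_def proj_nat')

lemma act_nat:
  assumes "actable X A k" "f \<in> Ar C" "Dom C f = X"
  shows "\<D> (\<D> f) \<cdot> (A \<lhd>\<^bsub>X\<^esub> k) = (\<D> (\<D> f) \<cdot> A) \<lhd>\<^bsub>Cod C f\<^esub> (\<D> f \<cdot> k)"
  using actableD[OF assms(1)] vadd_nat[OF cofib_act[OF assms(1)], of "\<D> f"] assms(2,3)
  by (simp add: act_def vlift_nat proj_nat')

lemma actable_flip:
  assumes "actable X A k"
  shows "actable X (\<tau> X \<cdot> A) k"
  using actableD[OF assms] by (simp add: actable_def cofib_def proj_nat')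

text \<open>An Eckmann-Hilton argument: apply \<open>interchange\<close> to the two-by-two array
  with \<open>A\<close> and \<open>\<l> \<cdot> k\<close> on the diagonal and zero squares off it.
  One order of addition gives \<open>A \<lhd> k\<close>, the other adds to \<open>A\<close> along
  \<open>T \<pi>\<close> the flip of the lift of \<open>k\<close> over the other edge. This is the
  symmetry of s t k in s and t.\<close>

lemma act_flip:
  assumes "actable X A k"
  shows "\<tau> X \<cdot> (A \<lhd>\<^bsub>X\<^esub> k) = (\<tau> X \<cdot> A) \<lhd>\<^bsub>X\<^esub> k"
proof -
  note a = actableD[OF assms] and fl = actable_flip[OF assms]
  let ?w = "\<pi> (\<T> X) \<cdot> A" and ?v = "\<D> (\<pi> X) \<cdot> A"
  have vk: "cofib X ?v k" using actableD(3)[OF fl] a by simp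
  have z: "A \<boxplus>\<^bsub>X\<^esub> (\<D> (\<zeta> X) \<cdot> ?v) = A" using a by (simp add: hadd_def)
  have "(A \<oplus>\<^bsub>\<T> X\<^esub> (\<zeta> (\<T> X) \<cdot> ?w)) \<boxplus>\<^bsub>X\<^esub> ((\<D> (\<zeta> X) \<cdot> ?v) \<oplus>\<^bsub>\<T> X\<^esub> (\<l> X \<cdot> k))
     = (A \<boxplus>\<^bsub>X\<^esub> (\<D> (\<zeta> X) \<cdot> ?v)) \<oplus>\<^bsub>\<T> X\<^esub> ((\<zeta> (\<T> X) \<cdot> ?w) \<boxplus>\<^bsub>X\<^esub> (\<l> X \<cdot> k))"
    by (rule interchange[OF _ cofib_vlift[OF vk]]) (use a in \<open>simp_all add: cofib_def zero_nat'\<close>)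
  then have "A \<boxplus>\<^bsub>X\<^esub> (\<tau> X \<cdot> vlift X ?v k) = A \<lhd>\<^bsub>X\<^esub> k"
    using a z by (simp add: act_def vlift_hadd[of X ?w] flip_vlift[OF vk])
  from arg_cong[OF this, of "\<lambda>u. \<tau> X \<cdot> u"]
  show ?thesis using a vk vadd_arrow[OF cofib_act[OF fl]] by (simp add: hadd_def act_def)
qed

lemma act_act:
  assumes A: "actable X A k" and k: "cofib X k l"
  shows "(A \<lhd>\<^bsub>X\<^esub> k) \<lhd>\<^bsub>X\<^esub> l = A \<lhd>\<^bsub>X\<^esub> (k \<oplus>\<^bsub>X\<^esub> l)"
proof -
  note a = actableD[OF A] and c = cofibD[OF k]
  have "cofib X (\<pi> (\<T> X) \<cdot> A) l" using cofib_trans[OF a(3) k] .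
  then have "cofib (\<T> X) (vlift X (\<pi> (\<T> X) \<cdot> A) k) (vlift X (\<pi> (\<T> X) \<cdot> A) l)"
    using a c by (simp add: cofib_def)
  from vadd_assoc[OF cofib_act[OF A] this] show ?thesis
    unfolding act_def[of "A \<lhd>\<^bsub>X\<^esub> k"] act_arrow(4)[OF A] by (simp add: act_def vlift_vadd[OF a(3) k])
qed

lemma act_vadd:
  assumes A: "actable X A k" and B: "actable X B l" and AB: "cofib (\<T> X) A B"
  shows "(A \<lhd>\<^bsub>X\<^esub> k) \<oplus>\<^bsub>\<T> X\<^esub> (B \<lhd>\<^bsub>X\<^esub> l) = (A \<oplus>\<^bsub>\<T> X\<^esub> B) \<lhd>\<^bsub>X\<^esub> (k \<oplus>\<^bsub>X\<^esub> l)"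
    and actable_vadd: "actable X (A \<oplus>\<^bsub>\<T> X\<^esub> B) (k \<oplus>\<^bsub>X\<^esub> l)"
proof -
  note a = actableD[OF A] and b = actableD[OF B] and c = cofibD[OF AB]
  let ?w = "\<pi> (\<T> X) \<cdot> A"
  have w: "\<pi> (\<T> X) \<cdot> B = ?w" using c(7) by simp
  have kl: "cofib X k l" using cofib_trans[OF cofib_sym[OF a(3)] b(3)[unfolded w]] .
  have "(A \<oplus>\<^bsub>\<T> X\<^esub> vlift X ?w k) \<oplus>\<^bsub>\<T> X\<^esub> (B \<oplus>\<^bsub>\<T> X\<^esub> vlift X ?w l)
    = (A \<oplus>\<^bsub>\<T> X\<^esub> B) \<oplus>\<^bsub>\<T> X\<^esub> (vlift X ?w k \<oplus>\<^bsub>\<T> X\<^esub> vlift X ?w l)"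
    by (rule vadd_shuffle[OF cofib_act[OF A] cofib_trans[OF cofib_sym[OF cofib_act[OF A]] AB]
        cofib_act[OF B, unfolded w]])
  then show "(A \<lhd>\<^bsub>X\<^esub> k) \<oplus>\<^bsub>\<T> X\<^esub> (B \<lhd>\<^bsub>X\<^esub> l) = (A \<oplus>\<^bsub>\<T> X\<^esub> B) \<lhd>\<^bsub>X\<^esub> (k \<oplus>\<^bsub>X\<^esub> l)"
    unfolding act_def vlift_vadd[OF a(3) kl] vadd_arrow(4)[OF AB] w .
  show "actable X (A \<oplus>\<^bsub>\<T> X\<^esub> B) (k \<oplus>\<^bsub>X\<^esub> l)"
    unfolding actable_def vadd_arrow(4)[OF AB] w
    using vadd_arrow[OF AB] cofib_vadd(2)[OF a(3) kl] by simp
qed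

lemma act_zero:
  assumes "X \<in> Ob C" "A \<in> Ar C" "Cod C A = \<T> (\<T> X)" "\<pi> X \<cdot> \<pi> (\<T> X) \<cdot> A = x"
  shows "A \<lhd>\<^bsub>X\<^esub> (\<zeta> X \<cdot> x) = A"
  using assms vlift_zero[of X "\<pi> (\<T> X) \<cdot> A" x] by (simp add: act_def)

text \<open>The action is free, since a lift over a fixed base determines its vector
  (\<open>vlift_eqD\<close>). Uniqueness of brackets comes from here.\<close>

lemma act_cancel:
  assumes A: "actable X A k" and B: "actable X A l" and e: "A \<lhd>\<^bsub>X\<^esub> k = A \<lhd>\<^bsub>X\<^esub> l"
  shows "k = l"
  by (rule vlift_eqD[OF actableD(3)[OF A] actableD(3)[OF B]],
      rule vadd_cancel[OF cofib_act[OF A] cofib_act[OF B] e[unfolded act_def]])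

lemma sub_eq_iff:
  assumes ab: "cofib X a b" and bc: "cofib X b c"
  shows "a \<oplus>\<^bsub>X\<^esub> (vneg X \<cdot> b) = c \<longleftrightarrow> a = b \<oplus>\<^bsub>X\<^esub> c"
proof -
  note c = cofibD[OF ab] and d = cofibD[OF bc]
  have ac: "cofib X a c" using cofib_trans[OF ab bc] .
  have bn: "cofib X b (vneg X \<cdot> b)" using cofib_neg[of X b b] bc by (simp add: cofib_def)
  have nb: "(vneg X \<cdot> b) \<oplus>\<^bsub>X\<^esub> b = \<zeta> X \<cdot> \<pi> X \<cdot> b"
    using vadd_commute[OF bn] vadd_neg[of X b] c by metis
  have "(a \<oplus>\<^bsub>X\<^esub> (vneg X \<cdot> b)) \<oplus>\<^bsub>X\<^esub> b = a"
    using c by (simp add: vadd_assoc[OF cofib_trans[OF ab bn] cofib_sym[OF bn]] nb)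
  moreover have "(b \<oplus>\<^bsub>X\<^esub> c) \<oplus>\<^bsub>X\<^esub> (vneg X \<cdot> b) = c"
  proof -
    have "(c \<oplus>\<^bsub>X\<^esub> b) \<oplus>\<^bsub>X\<^esub> (vneg X \<cdot> b) = c"
      using vadd_assoc[OF cofib_sym[OF bc] bn] vadd_neg[of X b] d by simp
    then show ?thesis using vadd_commute[OF bc] by simp
  qed
  ultimately show ?thesis using vadd_commute[OF bc] by metis
qed

lemma Tminus_tpair:
  assumes "cofib X a b"
  shows "Tminus X \<cdot> tpair X a b = a \<oplus>\<^bsub>X\<^esub> (vneg X \<cdot> b)"
proof -
  note c = cofibD[OF assms] and t = tpair[OF assms]
  have p: "cofib X (p\<^sub>1 X) (vneg X \<cdot> p\<^sub>2 X)"
    by (rule cofib_neg) (use c(1) in \<open>auto simp: cofib_def\<close>)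
  have "Tminus X = p\<^sub>1 X \<oplus>\<^bsub>X\<^esub> (vneg X \<cdot> p\<^sub>2 X)"
    by (simp add: Tminus_def vadd_def vneg_def)
  then show ?thesis using vadd_comp[OF p, of "tpair X a b"] c(1) t vneg(1-4)[OF c(1)] by simp
qed

text \<open>Transitivity of the action. As the two squares share their edges, their fiberwise
  difference has a zero \<open>T \<pi>\<close>-edge, and \<open>vlift_ex\<close> presents such a
  square as a lift.\<close>

lemma act_ex1:
  assumes X: "X \<in> Ob C" and A: "A \<in> Ar C" "Cod C A = \<T> (\<T> X)" and B: "B \<in> Ar C" "Cod C B = \<T> (\<T> X)"
    and p: "\<pi> (\<T> X) \<cdot> A = \<pi> (\<T> X) \<cdot> B" "\<D> (\<pi> X) \<cdot> A = \<D> (\<pi> X) \<cdot> B" and dom: "Dom C A = Dom C B"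
  obtains k where "actable X B k" "A = B \<lhd>\<^bsub>X\<^esub> k"
proof -
  have AB: "cofib (\<T> X) A B" using assms by (simp add: cofib_def)
  have AnB: "cofib (\<T> X) A (vneg (\<T> X) \<cdot> B)" by (rule cofib_neg[OF AB])
  let ?s = "A \<oplus>\<^bsub>\<T> X\<^esub> (vneg (\<T> X) \<cdot> B)"
  note n = vneg(1-4)[of "\<T> X"]
  have "\<D> (\<pi> X) \<cdot> ?s = (\<D> (\<pi> X) \<cdot> B) \<oplus>\<^bsub>X\<^esub> (vneg X \<cdot> \<D> (\<pi> X) \<cdot> B)"
    using vadd_nat[OF AnB, of "\<pi> X"] vneg_nat[of "\<pi> X" "\<T> X" B] X B p by simp
  then have s: "\<D> (\<pi> X) \<cdot> ?s = \<zeta> X \<cdot> \<pi> X \<cdot> \<D> (\<pi> X) \<cdot> B"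
    using vadd_neg[OF X, of "\<D> (\<pi> X) \<cdot> B"] X B by simp
  have "\<pi> (\<T> X) \<cdot> vneg (\<T> X) \<cdot> B = \<pi> (\<T> X) \<cdot> B"
    by (rule comp_reassoc) (use n X B in auto)
  then have ps: "\<pi> (\<T> X) \<cdot> ?s = \<pi> (\<T> X) \<cdot> B" using vadd_arrow(4)[OF AnB] p by simp
  obtain k where k: "cofib X (\<pi> (\<T> X) \<cdot> B) k" "vlift X (\<pi> (\<T> X) \<cdot> B) k = ?s"
    using vlift_ex[OF X vadd_arrow(1,3)[OF AnB] _ _ s] X B unfolding ps by auto
  then have "actable X B k" using B by (simp add: actable_def)
  moreover have "A = B \<lhd>\<^bsub>X\<^esub> k"
    using sub_eq_iff[OF AB cofib_act[OF \<open>actable X B k\<close>]] k unfolding act_def by simp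
  ultimately show thesis using that by blast
qed

subsection \<open>The bracket of vector fields\<close>

lemma vector_fieldD:
  assumes "v \<in> vector_fields X" "X \<in> Ob C"
  shows "v \<in> Ar C" "Dom C v = X" "Cod C v = \<T> X" "\<pi> X \<cdot> v = Ident C X"
    "h \<in> Ar C \<Longrightarrow> Cod C h = X \<Longrightarrow> \<pi> X \<cdot> v \<cdot> h = h"
    "h \<in> Ar C \<Longrightarrow> Cod C h = \<T> X \<Longrightarrow> \<D> (\<pi> X) \<cdot> \<D> v \<cdot> h = h"
proof -
  show v: "v \<in> Ar C" "Dom C v = X" "Cod C v = \<T> X" "\<pi> X \<cdot> v = Ident C X"
    using assms by (auto simp: vector_fields_def Hom_def)
  have Dv: "\<D> (\<pi> X) \<cdot> \<D> v = Ident C (\<T> X)"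
    using arg_cong[OF v(4), of \<D>] v(1-3) assms(2) by simp
  show "h \<in> Ar C \<Longrightarrow> Cod C h = X \<Longrightarrow> \<pi> X \<cdot> v \<cdot> h = h"
    using comp_reassoc[OF v(4), of h] v assms(2) by simp
  show "h \<in> Ar C \<Longrightarrow> Cod C h = \<T> X \<Longrightarrow> \<D> (\<pi> X) \<cdot> \<D> v \<cdot> h = h"
    using comp_reassoc[OF Dv, of h] v assms(2) by simp
qed

lemma vector_fieldI:
  "v \<in> Ar C \<Longrightarrow> Dom C v = X \<Longrightarrow> Cod C v = \<T> X \<Longrightarrow> \<pi> X \<cdot> v = Ident C X \<Longrightarrow> v \<in> vector_fields X"
  by (auto simp: vector_fields_def Hom_def)

lemma vector_field_cofib: "v \<in> vector_fields X \<Longrightarrow> w \<in> vector_fields X \<Longrightarrow> X \<in> Ob C \<Longrightarrow> cofib X v w"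
  by (simp add: vector_fields_def Hom_def cofib_def)

lemma vector_field_vadd:
  assumes "v \<in> vector_fields X" "w \<in> vector_fields X" "X \<in> Ob C"
  shows "v \<oplus>\<^bsub>X\<^esub> w \<in> vector_fields X"
  using vadd_arrow[OF vector_field_cofib[OF assms]] assms(2) by (auto simp: vector_fields_def Hom_def)

lemma vector_field_neg:
  assumes "v \<in> vector_fields X" "X \<in> Ob C"
  shows "vneg X \<cdot> v \<in> vector_fields X"
  using cofib_neg[OF vector_field_cofib[OF assms(1,1,2)]] assms
  by (auto simp: cofib_def vector_fields_def Hom_def)

lemma actable_flow:
  assumes X: "X \<in> Ob C" and v: "v \<in> vector_fields X" and w: "w \<in> vector_fields X" and u: "u \<in> vector_fields X"
  shows "actable X (\<tau> X \<cdot> \<D> v \<cdot> w) u" "actable X (\<D> v \<cdot> w) u"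
  using vector_fieldD[OF v X] vector_fieldD[OF w X] vector_fieldD[OF u X] X
  by (simp_all add: actable_def cofib_def proj_nat')

text \<open>The passage from subtraction to the action. Both squares have \<open>w\<close> as
  \<open>\<pi>\<close>-edge and \<open>v\<close> as \<open>T \<pi>\<close>-edge, which is why one of
  them is flipped. Later arguments about brackets start from the right-hand side.\<close>

lemma bracket_iff:
  assumes X: "X \<in> Ob C" and v: "v \<in> vector_fields X" and w: "w \<in> vector_fields X" and u: "u \<in> vector_fields X"
  shows "vf_delta X v w = ext_lift X \<cdot> tpair X w u \<longleftrightarrow> \<D> w \<cdot> v = (\<tau> X \<cdot> \<D> v \<cdot> w) \<lhd>\<^bsub>X\<^esub> u"
proof -
  note v' = vector_fieldD[OF v X] and w' = vector_fieldD[OF w X] and u' = vector_fieldD[OF u X]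
  have c: "cofib (\<T> X) (\<D> w \<cdot> v) (\<tau> X \<cdot> \<D> v \<cdot> w)"
    using v' w' X by (simp add: cofib_def proj_nat')
  have "\<pi> (\<T> X) \<cdot> \<tau> X \<cdot> \<D> v \<cdot> w = w" using v' w' X by simp
  with sub_eq_iff[OF c cofib_act[OF actable_flow(1)[OF X v w u]]] show ?thesis
    by (simp add: act_def vf_delta_def Tminus_tpair[OF c] ext_lift_vlift[OF vector_field_cofib[OF w u X]])
qed

lemma bracket:
  assumes X: "X \<in> Ob C" and v: "v \<in> vector_fields X" and w: "w \<in> vector_fields X"
  shows bracket_vector_field: "vf_bracket X v w \<in> vector_fields X"
    and bracket_eqn: "\<D> w \<cdot> v = (\<tau> X \<cdot> \<D> v \<cdot> w) \<lhd>\<^bsub>X\<^esub> vf_bracket X v w"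
    and bracket_eqI: "u \<in> vector_fields X \<Longrightarrow> \<D> w \<cdot> v = (\<tau> X \<cdot> \<D> v \<cdot> w) \<lhd>\<^bsub>X\<^esub> u \<Longrightarrow> vf_bracket X v w = u"
proof -
  note v' = vector_fieldD[OF v X] and w' = vector_fieldD[OF w X]
  have ex: "\<exists>k \<in> vector_fields X. \<D> w \<cdot> v = (\<tau> X \<cdot> \<D> v \<cdot> w) \<lhd>\<^bsub>X\<^esub> k"
  proof (rule act_ex1[of X "\<D> w \<cdot> v" "\<tau> X \<cdot> \<D> v \<cdot> w"])
    fix k assume k: "actable X (\<tau> X \<cdot> \<D> v \<cdot> w) k" "\<D> w \<cdot> v = (\<tau> X \<cdot> \<D> v \<cdot> w) \<lhd>\<^bsub>X\<^esub> k"
    \<comment> \<open>The vector \<open>k\<close> sits over the corner of the acted square, which is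
      the identity of \<open>X\<close>; hence it is a section.\<close>
    have "k \<in> vector_fields X"
      using actableD[OF k(1)] v' w' X by (intro vector_fieldI) simp_all
    with k show ?thesis by blast
  qed (use v' w' X in \<open>simp_all add: proj_nat'\<close>)
  let ?P = "\<lambda>u. u \<in> vector_fields X \<and> vf_delta X v w = ext_lift X \<cdot> tpair X w u"
  have uniq: "k = l" if "?P k" "?P l" for k l
    using act_cancel[OF actable_flow(1)[OF X v w] actable_flow(1)[OF X v w], of k l]
      that bracket_iff[OF X v w, of k] bracket_iff[OF X v w, of l] by metis
  have "\<exists>!u. ?P u" using ex uniq bracket_iff[OF X v w] by metis
  from theI'[OF this] have P: "?P (vf_bracket X v w)" unfolding vf_bracket_def .
  then show "vf_bracket X v w \<in> vector_fields X" "\<D> w \<cdot> v = (\<tau> X \<cdot> \<D> v \<cdot> w) \<lhd>\<^bsub>X\<^esub> vf_bracket X v w"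
    using bracket_iff[OF X v w] by blast+
  show "u \<in> vector_fields X \<Longrightarrow> \<D> w \<cdot> v = (\<tau> X \<cdot> \<D> v \<cdot> w) \<lhd>\<^bsub>X\<^esub> u \<Longrightarrow> vf_bracket X v w = u"
    using uniq[OF P] bracket_iff[OF X v w] by blast
qed

lemma bracket_eqn_flip:
  assumes X: "X \<in> Ob C" and v: "v \<in> vector_fields X" and w: "w \<in> vector_fields X"
  shows "\<tau> X \<cdot> \<D> w \<cdot> v = (\<D> v \<cdot> w) \<lhd>\<^bsub>X\<^esub> vf_bracket X v w"
  using arg_cong[OF bracket_eqn[OF X v w], of "\<lambda>u. \<tau> X \<cdot> u"]
    act_flip[OF actable_flow(1)[OF X v w bracket_vector_field[OF X v w]]]
    vector_fieldD[OF v X] vector_fieldD[OF w X] X by simp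

text \<open>Flipping the defining equation exchanges the roles of the two fields and puts the action
  on the other side without changing the acting vector (\<open>act_flip\<close>). Acting by the
  negative then undoes it.\<close>

lemma bracket_antisym:
  assumes X: "X \<in> Ob C" and v: "v \<in> vector_fields X" and w: "w \<in> vector_fields X"
  shows "vf_bracket X w v = vneg X \<cdot> vf_bracket X v w"
proof (rule bracket_eqI[OF X w v])
  let ?k = "vf_bracket X v w"
  note k = bracket_vector_field[OF X v w]
  note v' = vector_fieldD[OF v X] and w' = vector_fieldD[OF w X] and k' = vector_fieldD[OF k X]
  show "vneg X \<cdot> ?k \<in> vector_fields X" by (rule vector_field_neg[OF k X])
  then have c: "cofib X ?k (vneg X \<cdot> ?k)" by (rule vector_field_cofib[OF k _ X])
  have "(\<tau> X \<cdot> \<D> w \<cdot> v) \<lhd>\<^bsub>X\<^esub> (vneg X \<cdot> ?k) = (\<D> v \<cdot> w) \<lhd>\<^bsub>X\<^esub> (\<zeta> X \<cdot> \<pi> X \<cdot> ?k)"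
    using vadd_neg[OF X, of ?k] k'
    by (simp only: bracket_eqn_flip[OF X v w] act_act[OF actable_flow(2)[OF X v w k] c])
  also have "\<dots> = \<D> v \<cdot> w" using v' w' k' X by (intro act_zero) (simp_all add: proj_nat')
  finally show "\<D> v \<cdot> w = (\<tau> X \<cdot> \<D> w \<cdot> v) \<lhd>\<^bsub>X\<^esub> (vneg X \<cdot> ?k)" ..
qed

text \<open>The flipped equation is used because \<open>T v\<close> is additive as it stands,
  whereas \<open>T\<close> of a sum of fields becomes a sum for \<open>\<oplus>\<close> only after
  the flip.\<close>

lemma bracket_vadd_right:
  assumes X: "X \<in> Ob C" and v: "v \<in> vector_fields X" and w: "w \<in> vector_fields X" and u: "u \<in> vector_fields X"
  shows "vf_bracket X v (w \<oplus>\<^bsub>X\<^esub> u) = vf_bracket X v w \<oplus>\<^bsub>X\<^esub> vf_bracket X v u"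
proof (rule bracket_eqI[OF X v vector_field_vadd[OF w u X]])
  let ?k = "vf_bracket X v w" and ?l = "vf_bracket X v u"
  note k = bracket_vector_field[OF X v w] and l = bracket_vector_field[OF X v u]
  note v' = vector_fieldD[OF v X] and w' = vector_fieldD[OF w X] and u' = vector_fieldD[OF u X]
  show "?k \<oplus>\<^bsub>X\<^esub> ?l \<in> vector_fields X" by (rule vector_field_vadd[OF k l X])
  have wu: "cofib X w u" by (rule vector_field_cofib[OF w u X])
  have sum: "\<D> v \<cdot> (w \<oplus>\<^bsub>X\<^esub> u) = (\<D> v \<cdot> w) \<oplus>\<^bsub>\<T> X\<^esub> (\<D> v \<cdot> u)"
    using vadd_nat[OF wu, of v] v' by simp
  have Dv: "cofib (\<T> X) (\<D> v \<cdot> w) (\<D> v \<cdot> u)"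
    using cofib_tan[OF wu, of v] v' by simp
  note A = actable_flow(2)[OF X v w k] and B = actable_flow(2)[OF X v u l]
  have "\<tau> X \<cdot> \<D> (w \<oplus>\<^bsub>X\<^esub> u) \<cdot> v = ((\<tau> X \<cdot> \<D> w) \<oplus>\<^bsub>\<T> X\<^esub> (\<tau> X \<cdot> \<D> u)) \<cdot> v"
    by (rule comp_reassoc[OF flip_tan_vadd[OF wu]]) (use vadd_arrow[OF wu] v' w' u' X in simp_all)
  also have "\<dots> = (\<tau> X \<cdot> \<D> w \<cdot> v) \<oplus>\<^bsub>\<T> X\<^esub> (\<tau> X \<cdot> \<D> u \<cdot> v)"
    using vadd_comp[OF cofib_flip_tan[OF wu], of v] v' w' u' X by simp
  also have "\<dots> = (\<D> v \<cdot> (w \<oplus>\<^bsub>X\<^esub> u)) \<lhd>\<^bsub>X\<^esub> (?k \<oplus>\<^bsub>X\<^esub> ?l)"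
    unfolding bracket_eqn_flip[OF X v w] bracket_eqn_flip[OF X v u] sum by (rule act_vadd(1)[OF A B Dv])
  finally have "\<tau> X \<cdot> \<tau> X \<cdot> \<D> (w \<oplus>\<^bsub>X\<^esub> u) \<cdot> v = (\<tau> X \<cdot> \<D> v \<cdot> (w \<oplus>\<^bsub>X\<^esub> u)) \<lhd>\<^bsub>X\<^esub> (?k \<oplus>\<^bsub>X\<^esub> ?l)"
    using act_flip[OF actable_vadd[OF A B Dv]] sum by simp
  then show "\<D> (w \<oplus>\<^bsub>X\<^esub> u) \<cdot> v = (\<tau> X \<cdot> \<D> v \<cdot> (w \<oplus>\<^bsub>X\<^esub> u)) \<lhd>\<^bsub>X\<^esub> (?k \<oplus>\<^bsub>X\<^esub> ?l)"
    using vadd_arrow[OF wu] v' w' u' X by simp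
qed

text \<open>Both vectors move the same square to the same square: one by applying
  \<open>T (T f)\<close> to the bracket equation on \<open>X\<close>, the other by composing the
  equation on \<open>Y\<close> with \<open>f\<close>. Freeness of the action identifies
  them.\<close>

lemma bracket_related:
  assumes X: "X \<in> Ob C" and Y: "Y \<in> Ob C" and f: "f \<in> Ar C" "Dom C f = X" "Cod C f = Y"
    and v: "v \<in> vector_fields X" and w: "w \<in> vector_fields X"
    and v2: "v2 \<in> vector_fields Y" and w2: "w2 \<in> vector_fields Y"
    and fv: "\<D> f \<cdot> v = v2 \<cdot> f" and fw: "\<D> f \<cdot> w = w2 \<cdot> f"
  shows "\<D> f \<cdot> vf_bracket X v w = vf_bracket Y v2 w2 \<cdot> f"
proof -
  note k = bracket_vector_field[OF X v w] and l = bracket_vector_field[OF Y v2 w2]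
  note v' = vector_fieldD[OF v X] and w' = vector_fieldD[OF w X] and k' = vector_fieldD[OF k X]
  note v2' = vector_fieldD[OF v2 Y] and w2' = vector_fieldD[OF w2 Y] and l' = vector_fieldD[OF l Y]
  have flow: "\<D> (\<D> f) \<cdot> \<D> b \<cdot> a = \<D> b2 \<cdot> a2 \<cdot> f"
    if "\<D> f \<cdot> a = a2 \<cdot> f" "\<D> f \<cdot> b = b2 \<cdot> f" "a \<in> Ar C" "b \<in> Ar C" "a2 \<in> Ar C" "b2 \<in> Ar C"
      "Dom C a = X" "Dom C b = X" "Cod C a = \<T> X" "Cod C b = \<T> X"
      "Dom C a2 = Y" "Dom C b2 = Y" "Cod C a2 = \<T> Y" "Cod C b2 = \<T> Y" for a b a2 b2
  proof -
    have "\<D> (\<D> f) \<cdot> \<D> b \<cdot> a = (\<D> b2 \<cdot> \<D> f) \<cdot> a"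
      by (rule comp_reassoc) (use arg_cong[OF that(2), of \<D>] that(3-) f in simp_all)
    then show ?thesis using that f by simp
  qed
  have a: "actable Y (\<D> (\<D> f) \<cdot> \<tau> X \<cdot> \<D> v \<cdot> w) (\<D> f \<cdot> vf_bracket X v w)"
    using actable_tan[OF actable_flow(1)[OF X v w k] f(1,2)] f by simp
  have e: "\<D> (\<D> f) \<cdot> \<tau> X \<cdot> \<D> v \<cdot> w = (\<tau> Y \<cdot> \<D> v2 \<cdot> w2) \<cdot> f"
    using flow[OF fw fv] v' w' v2' w2' f X Y by (simp add: flip_nat')
  have b: "actable Y (\<D> (\<D> f) \<cdot> \<tau> X \<cdot> \<D> v \<cdot> w) (vf_bracket Y v2 w2 \<cdot> f)"
    unfolding e using actable_comp[OF actable_flow(1)[OF Y v2 w2 l] f(1)] f l' by simp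
  have e1: "(\<D> w2 \<cdot> v2) \<cdot> f = (\<D> (\<D> f) \<cdot> \<tau> X \<cdot> \<D> v \<cdot> w) \<lhd>\<^bsub>Y\<^esub> (vf_bracket Y v2 w2 \<cdot> f)"
    unfolding e bracket_eqn[OF Y v2 w2]
    by (rule act_comp[OF actable_flow(1)[OF Y v2 w2 l] f(1)]) (use f l' in simp)
  have e2: "\<D> (\<D> f) \<cdot> (\<D> w \<cdot> v) = (\<D> (\<D> f) \<cdot> \<tau> X \<cdot> \<D> v \<cdot> w) \<lhd>\<^bsub>Y\<^esub> (\<D> f \<cdot> vf_bracket X v w)"
    unfolding bracket_eqn[OF X v w] using act_nat[OF actable_flow(1)[OF X v w k] f(1,2)] f by simp
  have e3: "\<D> (\<D> f) \<cdot> (\<D> w \<cdot> v) = (\<D> w2 \<cdot> v2) \<cdot> f"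
    using flow[OF fv fw] v' w' v2' w2' f by simp
  show ?thesis by (rule act_cancel[OF a b trans[OF e2[symmetric] trans[OF e3 e1]]])
qed

section \<open>The abelian group of vector fields\<close>

abbreviation vf_group :: "'o \<Rightarrow> 'm monoid" where
  "vf_group X \<equiv> section_group C X (tangent_bundle X)"

lemma vf_group_simps [simp]:
  "carrier (vf_group X) = vector_fields X" "a \<otimes>\<^bsub>vf_group X\<^esub> b = a \<oplus>\<^bsub>X\<^esub> b" "\<one>\<^bsub>vf_group X\<^esub> = \<zeta> X"
  by (simp_all add: section_group_def sections_def vector_fields_def tangent_bundle_def vadd_def
      tpair_def bpair_def)

lemma zero_vector_field: "X \<in> Ob C \<Longrightarrow> \<zeta> X \<in> vector_fields X"
  by (rule vector_fieldI) simp_all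

lemma vadd_zero_field:
  assumes "X \<in> Ob C" "a \<in> vector_fields X"
  shows "a \<oplus>\<^bsub>X\<^esub> \<zeta> X = a" "\<zeta> X \<oplus>\<^bsub>X\<^esub> a = a"
  using vadd_zero_right[of X a "Ident C X"] vadd_zero_left[of X a "Ident C X"]
    vector_fieldD[OF assms(2,1)] assms(1) by simp_all

lemma vf_group_comm_group:
  assumes X: "X \<in> Ob C"
  shows "comm_group (vf_group X)"
proof (rule comm_groupI; simp)
  show "\<And>a b. a \<in> vector_fields X \<Longrightarrow> b \<in> vector_fields X \<Longrightarrow> a \<oplus>\<^bsub>X\<^esub> b \<in> vector_fields X"
    using vector_field_vadd X by blast
  show "\<zeta> X \<in> vector_fields X" by (rule zero_vector_field[OF X])
  show "\<And>a b c. a \<in> vector_fields X \<Longrightarrow> b \<in> vector_fields X \<Longrightarrow> c \<in> vector_fields X \<Longrightarrow>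
      (a \<oplus>\<^bsub>X\<^esub> b) \<oplus>\<^bsub>X\<^esub> c = a \<oplus>\<^bsub>X\<^esub> (b \<oplus>\<^bsub>X\<^esub> c)"
    using vadd_assoc vector_field_cofib X by blast
  show "\<And>a b. a \<in> vector_fields X \<Longrightarrow> b \<in> vector_fields X \<Longrightarrow> a \<oplus>\<^bsub>X\<^esub> b = b \<oplus>\<^bsub>X\<^esub> a"
    using vadd_commute vector_field_cofib X by blast
  fix a assume a: "a \<in> vector_fields X"
  then show "\<zeta> X \<oplus>\<^bsub>X\<^esub> a = a" by (rule vadd_zero_field(2)[OF X])
  note n = vector_field_neg[OF a X]
  have "(vneg X \<cdot> a) \<oplus>\<^bsub>X\<^esub> a = \<zeta> X"
    using vadd_neg[OF X, of a] vadd_commute[OF vector_field_cofib[OF a n X]] vector_fieldD[OF a X] X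
    by simp
  with n show "\<exists>b \<in> vector_fields X. b \<oplus>\<^bsub>X\<^esub> a = \<zeta> X" by blast
qed

lemma vf_group_inv:
  assumes X: "X \<in> Ob C" and a: "a \<in> vector_fields X"
  shows "inv\<^bsub>vf_group X\<^esub> a = vneg X \<cdot> a"
proof -
  interpret G: comm_group "vf_group X" by (rule vf_group_comm_group[OF X])
  show ?thesis
    using vadd_neg[OF X, of a] vector_fieldD[OF a X] X vector_field_neg[OF a X] a
      vadd_commute[OF vector_field_cofib[OF a vector_field_neg[OF a X] X]]
    by (intro G.inv_equality) simp_all
qed

lemma bracket_vadd_left:
  assumes X: "X \<in> Ob C" and v: "v \<in> vector_fields X" and w: "w \<in> vector_fields X" and u: "u \<in> vector_fields X"
  shows "vf_bracket X (v \<oplus>\<^bsub>X\<^esub> w) u = vf_bracket X v u \<oplus>\<^bsub>X\<^esub> vf_bracket X w u"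
proof -
  interpret G: comm_group "vf_group X" by (rule vf_group_comm_group[OF X])
  note b = bracket_vector_field[OF X u v] bracket_vector_field[OF X u w]
  show ?thesis
    using G.inv_mult[of "vf_bracket X u v" "vf_bracket X u w"] b
      bracket_antisym[OF X u v] bracket_antisym[OF X u w] bracket_antisym[OF X u vector_field_vadd[OF v w X]]
      bracket_vadd_right[OF X u v w]
    by (simp add: vf_group_inv[OF X] vector_field_vadd[OF _ _ X])
qed

subsection \<open>Brackets of lifted vector fields and the Jacobi identity\<close>

text \<open>The simplifier splits \<open>T (g \<cdot> f)\<close> into a composite, so an equation
  under \<open>T\<close> has to be available in split form.\<close>

lemma tan_reassoc:
  assumes e: "g \<cdot> f = k" and t: "f \<in> Ar C" "g \<in> Ar C" "Dom C g = Cod C f" "h \<in> Ar C" "\<T> (Dom C f) = Cod C h"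
  shows "\<D> g \<cdot> \<D> f \<cdot> h = \<D> k \<cdot> h"
proof (rule comp_reassoc)
  show "\<D> g \<cdot> \<D> f = \<D> k" using t unfolding e[symmetric] by simp
qed (use t in simp_all)

lemma tan_flip_flip [simp]:
  "X \<in> Ob C \<Longrightarrow> h \<in> Ar C \<Longrightarrow> Cod C h = \<T> (\<T> (\<T> X)) \<Longrightarrow> \<D> (\<tau> X) \<cdot> \<D> (\<tau> X) \<cdot> h = h"
  using tan_reassoc[OF flip_flip[of X], of h] by simp

lemma tan_flip_tan_zero [simp]:
  "X \<in> Ob C \<Longrightarrow> h \<in> Ar C \<Longrightarrow> Cod C h = \<T> (\<T> X) \<Longrightarrow> \<D> (\<tau> X) \<cdot> \<D> (\<D> (\<zeta> X)) \<cdot> h = \<D> (\<zeta> (\<T> X)) \<cdot> h"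
  using tan_reassoc[OF flip_tan_zero[of X], of h] by simp

lemma tan_flip_zero [simp]:
  "X \<in> Ob C \<Longrightarrow> h \<in> Ar C \<Longrightarrow> Cod C h = \<T> (\<T> X) \<Longrightarrow> \<D> (\<tau> X) \<cdot> \<D> (\<zeta> (\<T> X)) \<cdot> h = \<D> (\<D> (\<zeta> X)) \<cdot> h"
  using tan_reassoc[OF flip_zero[of X], of h] by simp

lemma flip_braid':
  assumes "X \<in> Ob C" "h \<in> Ar C" "Cod C h = \<T> (\<T> (\<T> X))"
  shows "\<tau> (\<T> X) \<cdot> \<D> (\<tau> X) \<cdot> \<tau> (\<T> X) \<cdot> h = \<D> (\<tau> X) \<cdot> \<tau> (\<T> X) \<cdot> \<D> (\<tau> X) \<cdot> h"
proof -
  have "(\<tau> (\<T> X) \<cdot> \<D> (\<tau> X) \<cdot> \<tau> (\<T> X)) \<cdot> h = (\<D> (\<tau> X) \<cdot> \<tau> (\<T> X) \<cdot> \<D> (\<tau> X)) \<cdot> h"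
    using flip_braid[OF assms(1)] by simp
  then show ?thesis using assms by simp
qed

lemma flip_flip_lift':
  assumes "X \<in> Ob C" "h \<in> Ar C" "Cod C h = \<T> (\<T> X)"
  shows "\<D> (\<tau> X) \<cdot> \<tau> (\<T> X) \<cdot> \<D> (\<l> X) \<cdot> h = \<l> (\<T> X) \<cdot> \<tau> X \<cdot> h"
proof -
  have "(\<D> (\<tau> X) \<cdot> \<tau> (\<T> X) \<cdot> \<D> (\<l> X)) \<cdot> h = (\<l> (\<T> X) \<cdot> \<tau> X) \<cdot> h"
    using flip_flip_lift[OF assms(1)] by simp
  then show ?thesis using assms by simp
qed

text \<open>\<open>T \<tau> \<cdot> \<tau>\<close> moves the outermost direction of \<open>T (T (T X))\<close> to the innermost place.\<close>

lemma rot_tan_vlift: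
  assumes au: "cofib X a u"
  shows "\<D> (\<tau> X) \<cdot> \<tau> (\<T> X) \<cdot> \<D> (vlift X a u) = vlift (\<T> X) (\<tau> X \<cdot> \<D> a) (\<tau> X \<cdot> \<D> u)"
proof -
  note c = cofibD[OF au] and d = cofib_vlift[OF au]
  note e = cofib_flip_tan[OF d] and va = vadd_arrow[OF d]
  have zz: "\<D> (\<tau> X) \<cdot> \<tau> (\<T> X) \<cdot> \<D> (\<D> (\<zeta> X)) \<cdot> \<D> a = \<D> (\<zeta> (\<T> X)) \<cdot> \<tau> X \<cdot> \<D> a"
    using flip_nat'[of "\<zeta> X" X "\<D> a", symmetric] c by simp
  have "\<D> (\<tau> X) \<cdot> \<tau> (\<T> X) \<cdot> \<D> (vlift X a u)
      = \<tau> (\<T> X) \<cdot> \<D> (\<tau> X) \<cdot> \<tau> (\<T> X) \<cdot> \<D> ((\<D> (\<zeta> X) \<cdot> a) \<oplus>\<^bsub>\<T> X\<^esub> (\<l> X \<cdot> u))"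
    using c va by (simp add: vlift_def flip_braid')
  also have "\<dots> = vlift (\<T> X) (\<tau> X \<cdot> \<D> a) (\<tau> X \<cdot> \<D> u)"
    using c vadd_nat[OF e, of "\<D> (\<tau> X)"] vadd_nat[OF e, of "\<tau> X"] zz flip_flip_lift'[of X "\<D> u"]
    by (simp add: vlift_def flip_tan_vadd[OF d])
  finally show ?thesis .
qed

text \<open>Differentiating a family of squares \<open>A(s, t) + s t k\<close> adds an outermost
  direction. Rotated to the innermost place, it turns the family into one square over
  \<open>T X\<close>, on which the derivative of \<open>k\<close>, flipped, acts.\<close>

lemma rot_tan_act:
  assumes A: "actable X A k"
  shows "\<D> (\<tau> X) \<cdot> \<tau> (\<T> X) \<cdot> \<D> (A \<lhd>\<^bsub>X\<^esub> k) = (\<D> (\<tau> X) \<cdot> \<tau> (\<T> X) \<cdot> \<D> A) \<lhd>\<^bsub>\<T> X\<^esub> (\<tau> X \<cdot> \<D> k)"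
proof -
  note a = actableD[OF A] and c = cofib_act[OF A]
  note e = cofib_flip_tan[OF c]
  have p: "\<pi> (\<T> (\<T> X)) \<cdot> \<D> (\<tau> X) \<cdot> \<tau> (\<T> X) \<cdot> \<D> A = \<tau> X \<cdot> \<D> (\<pi> (\<T> X)) \<cdot> \<D> A"
    using a by (simp add: proj_nat')
  show ?thesis
    using a vadd_nat[OF e, of "\<tau> X"] rot_tan_vlift[OF a(3)] flip_tan_vadd[OF c]
    unfolding act_def p by simp
qed

text \<open>With the outermost parameter first, both sides are the cube
  \<open>(r, s, t) \<mapsto> a(s) + r s t k\<close>. The proof expands the left side by
  \<open>flip_flip_lift\<close> and reduces its vertical part by \<open>lift_lift\<close>.\<close>

lemma tan_flip_lift_vlift:
  assumes ak: "cofib X a k"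
  shows "\<D> (\<tau> X) \<cdot> \<l> (\<T> X) \<cdot> vlift X a k = vlift (\<T> X) (\<D> (\<zeta> X) \<cdot> a) (\<l> X \<cdot> k)"
proof -
  note c = cofibD[OF ak] and d = cofib_vlift[OF ak]
  have lz: "\<D> (\<l> X) \<cdot> \<D> (\<zeta> X) \<cdot> a = \<D> (\<zeta> (\<T> X)) \<cdot> \<D> (\<zeta> X) \<cdot> a"
    using tan_reassoc[of "\<l> X" "\<zeta> X" "\<zeta> (\<T> X) \<cdot> \<zeta> X" a] lift_zero'[of X "Ident C X"] c by simp
  have ll: "\<D> (\<l> X) \<cdot> \<l> X \<cdot> k = \<l> (\<T> X) \<cdot> \<l> X \<cdot> k"
    using comp_reassoc[OF lift_lift[of X, symmetric], of k] c by simp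
  show ?thesis
    unfolding vlift_def flip_flip_lift'[OF c(1) vadd_arrow(1,3)[OF d], symmetric]
    using c vadd_arrow[OF d] vadd_arrow[OF cofib_vlift[OF d]] vadd_nat[OF d, of "\<l> X"] lz ll by simp
qed

text \<open>Both sides are the cube \<open>(r, s, t) \<mapsto> q(r, s) + r s t k\<close>: before the
  rotation the direction absent from \<open>q\<close> is the outermost one, afterwards the innermost
  one.\<close>

lemma rot_vlift_vlift:
  assumes q: "actable X q k"
  shows "\<D> (\<tau> X) \<cdot> \<tau> (\<T> X) \<cdot> vlift (\<T> X) q (vlift X (\<pi> (\<T> X) \<cdot> q) k)
    = (\<D> (\<D> (\<zeta> X)) \<cdot> q) \<lhd>\<^bsub>\<T> X\<^esub> (\<l> X \<cdot> k)"
proof -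
  note a = actableD[OF q] and c = cofib_act[OF q]
  note d = cofib_vlift[OF c]
  have p: "\<pi> (\<T> (\<T> X)) \<cdot> \<D> (\<D> (\<zeta> X)) \<cdot> q = \<D> (\<zeta> X) \<cdot> \<pi> (\<T> X) \<cdot> q"
    using a by (simp add: proj_nat')
  show ?thesis
    unfolding flip_vlift[OF c] act_def p
    using a vadd_nat[OF d, of "\<tau> X"] tan_flip_lift_vlift[OF a(3)] by simp
qed

text \<open>By the braid relation, \<open>T \<tau>\<close> is the conjugate of \<open>\<tau>\<close> under the rotation \<open>T \<tau> \<cdot> \<tau>\<close>.\<close>

lemma tan_flip_vlift_vlift:
  assumes q: "actable X q k"
  shows "\<D> (\<tau> X) \<cdot> vlift (\<T> X) q (vlift X (\<pi> (\<T> X) \<cdot> q) k) = vlift (\<T> X) (\<tau> X \<cdot> q) (vlift X (\<D> (\<pi> X) \<cdot> q) k)"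
    (is "\<D> (\<tau> X) \<cdot> ?U = ?U'")
proof -
  note a = actableD[OF q] and fq = actable_flip[OF q]
  note c = cofib_act[OF q] and fc = cofib_act[OF fq]
  have U: "?U \<in> Ar C" "Cod C ?U = \<T> (\<T> (\<T> X))" using vlift_arrow[OF c] by simp_all
  have p: "\<pi> (\<T> X) \<cdot> \<tau> X \<cdot> q = \<D> (\<pi> X) \<cdot> q" using a by simp
  have U': "?U' \<in> Ar C" "Cod C ?U' = \<T> (\<T> (\<T> X))" using vlift_arrow[OF fc] p by simp_all
  have act: "actable (\<T> X) (\<D> (\<D> (\<zeta> X)) \<cdot> q) (\<l> X \<cdot> k)"
    using a by (simp add: actable_def cofib_def proj_nat')
  have "\<D> (\<tau> X) \<cdot> \<tau> (\<T> X) \<cdot> \<D> (\<tau> X) \<cdot> ?U = \<tau> (\<T> X) \<cdot> \<D> (\<tau> X) \<cdot> \<tau> (\<T> X) \<cdot> ?U"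
    by (rule flip_braid'[OF a(5) U, symmetric])
  also have "\<dots> = (\<tau> (\<T> X) \<cdot> \<D> (\<D> (\<zeta> X)) \<cdot> q) \<lhd>\<^bsub>\<T> X\<^esub> (\<l> X \<cdot> k)"
    unfolding rot_vlift_vlift[OF q] by (rule act_flip[OF act])
  also have "\<tau> (\<T> X) \<cdot> \<D> (\<D> (\<zeta> X)) \<cdot> q = \<D> (\<D> (\<zeta> X)) \<cdot> \<tau> X \<cdot> q"
    using a flip_nat'[of "\<zeta> X" X q] by simp
  also have "(\<D> (\<D> (\<zeta> X)) \<cdot> \<tau> X \<cdot> q) \<lhd>\<^bsub>\<T> X\<^esub> (\<l> X \<cdot> k) = \<D> (\<tau> X) \<cdot> \<tau> (\<T> X) \<cdot> ?U'"
    using rot_vlift_vlift[OF fq] p by simp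
  finally have e: "\<D> (\<tau> X) \<cdot> \<tau> (\<T> X) \<cdot> \<D> (\<tau> X) \<cdot> ?U = \<D> (\<tau> X) \<cdot> \<tau> (\<T> X) \<cdot> ?U'" .
  have "\<D> (\<tau> X) \<cdot> ?U = \<tau> (\<T> X) \<cdot> \<D> (\<tau> X) \<cdot> (\<D> (\<tau> X) \<cdot> \<tau> (\<T> X) \<cdot> \<D> (\<tau> X) \<cdot> ?U)"
    using U a by simp
  also have "\<dots> = ?U'" unfolding e using U' a by simp
  finally show ?thesis .
qed

text \<open>The doubly lifted vector contributes r s t k, which is symmetric in all three
  directions. Flipping the inner two therefore changes only the cube \<open>A\<close> and the edge
  over which \<open>k\<close> is lifted.\<close>

lemma tan_flip_act:
  assumes A: "A \<in> Ar C" "Cod C A = \<T> (\<T> (\<T> X))" and q: "actable X (\<pi> (\<T> (\<T> X)) \<cdot> A) k"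
  shows "\<D> (\<tau> X) \<cdot> (A \<lhd>\<^bsub>\<T> X\<^esub> vlift X (\<pi> (\<T> X) \<cdot> \<pi> (\<T> (\<T> X)) \<cdot> A) k)
    = (\<D> (\<tau> X) \<cdot> A) \<lhd>\<^bsub>\<T> X\<^esub> vlift X (\<D> (\<pi> X) \<cdot> \<pi> (\<T> (\<T> X)) \<cdot> A) k"
proof -
  note a = actableD[OF q]
  note c = cofib_act[OF q]
  have d: "cofib (\<T> (\<T> X)) A (vlift (\<T> X) (\<pi> (\<T> (\<T> X)) \<cdot> A) (vlift X (\<pi> (\<T> X) \<cdot> \<pi> (\<T> (\<T> X)) \<cdot> A) k))"
    using vlift_arrow[OF c] vlift_arrow[OF a(3)] a A by (simp add: cofib_def)
  have p: "\<pi> (\<T> (\<T> X)) \<cdot> \<D> (\<tau> X) \<cdot> A = \<tau> X \<cdot> \<pi> (\<T> (\<T> X)) \<cdot> A" using a A by (simp add: proj_nat')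
  show ?thesis
    unfolding act_def p using vadd_nat[OF d, of "\<tau> X"] tan_flip_vlift_vlift[OF q] a by simp
qed

text \<open>The complete lift of a vector field \<open>v\<close> is \<open>\<tau> \<cdot> T v\<close>, the vertical lift of \<open>s\<close> is \<open>vert X s\<close>.\<close>

definition vert :: "'o \<Rightarrow> 'm \<Rightarrow> 'm" where
  "vert X s = vlift X (Ident C (\<T> X)) (s \<cdot> \<pi> X)"

lemma complete_vector_field:
  assumes X: "X \<in> Ob C" and v: "v \<in> vector_fields X"
  shows "\<tau> X \<cdot> \<D> v \<in> vector_fields (\<T> X)"
  using vector_fieldD[OF v X] vector_fieldD(6)[OF v X, of "Ident C (\<T> X)"] X by (intro vector_fieldI) simp_all

lemma cofib_vert:
  assumes X: "X \<in> Ob C" and s: "s \<in> vector_fields X"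
  shows "cofib X (Ident C (\<T> X)) (s \<cdot> \<pi> X)"
  using vector_fieldD[OF s X] X by (simp add: cofib_def)

lemma vert_vector_field:
  assumes X: "X \<in> Ob C" and s: "s \<in> vector_fields X"
  shows "vert X s \<in> vector_fields (\<T> X)"
  unfolding vert_def using vlift_arrow[OF cofib_vert[OF X s]] vector_fieldD(1-3)[OF s X] X
  by (intro vector_fieldI) simp_all

text \<open>Applying \<open>T\<close> to the bracket equation on \<open>X\<close> and rotating the
  result gives the bracket equation of the complete lifts.\<close>

lemma bracket_complete_complete:
  assumes X: "X \<in> Ob C" and v: "v \<in> vector_fields X" and u: "u \<in> vector_fields X"
  shows "vf_bracket (\<T> X) (\<tau> X \<cdot> \<D> v) (\<tau> X \<cdot> \<D> u) = \<tau> X \<cdot> \<D> (vf_bracket X v u)"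
proof (rule bracket_eqI)
  let ?k = "vf_bracket X v u"
  note k = bracket_vector_field[OF X v u]
  note v' = vector_fieldD(1-4)[OF v X] and u' = vector_fieldD(1-4)[OF u X]
  have "\<D> (\<tau> X \<cdot> \<D> u) \<cdot> \<tau> X \<cdot> \<D> v = \<D> (\<tau> X) \<cdot> \<tau> (\<T> X) \<cdot> \<D> (\<D> u \<cdot> v)"
    using v' u' X by (simp add: flip_nat')
  also have "\<dots> = (\<D> (\<tau> X) \<cdot> \<tau> (\<T> X) \<cdot> \<D> (\<tau> X \<cdot> \<D> v \<cdot> u)) \<lhd>\<^bsub>\<T> X\<^esub> (\<tau> X \<cdot> \<D> ?k)"
    unfolding bracket_eqn[OF X v u] by (rule rot_tan_act[OF actable_flow(1)[OF X v u k]])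
  \<comment> \<open>The braid relation together with naturality of \<open>\<tau>\<close> identifies
    the rotated square with the flow square of the two complete lifts.\<close>
  also have "\<D> (\<tau> X) \<cdot> \<tau> (\<T> X) \<cdot> \<D> (\<tau> X \<cdot> \<D> v \<cdot> u) = \<tau> (\<T> X) \<cdot> \<D> (\<tau> X \<cdot> \<D> v) \<cdot> \<tau> X \<cdot> \<D> u"
    using v' u' X flip_braid'[of X "\<D> (\<D> v) \<cdot> \<D> u"] by (simp add: flip_nat')
  finally show "\<D> (\<tau> X \<cdot> \<D> u) \<cdot> \<tau> X \<cdot> \<D> v
      = (\<tau> (\<T> X) \<cdot> \<D> (\<tau> X \<cdot> \<D> v) \<cdot> \<tau> X \<cdot> \<D> u) \<lhd>\<^bsub>\<T> X\<^esub> (\<tau> X \<cdot> \<D> ?k)" .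
  show "\<tau> X \<cdot> \<D> ?k \<in> vector_fields (\<T> X)" by (rule complete_vector_field[OF X k])
qed (use X complete_vector_field[OF X v] complete_vector_field[OF X u] in simp_all)

lemma rot_tan_vert:
  assumes X: "X \<in> Ob C" and s: "s \<in> vector_fields X" and h: "h \<in> Ar C" "Cod C h = \<T> (\<T> X)"
  shows "\<D> (\<tau> X) \<cdot> \<tau> (\<T> X) \<cdot> \<D> (vert X s) \<cdot> h
    = vlift (\<T> X) (\<tau> X \<cdot> h) (\<tau> X \<cdot> \<D> s \<cdot> \<D> (\<pi> X) \<cdot> h)"
proof -
  note c = cofib_vert[OF X s] and s' = vector_fieldD[OF s X]
  note va = vlift_arrow[OF c]
  have "\<D> (\<tau> X) \<cdot> \<tau> (\<T> X) \<cdot> \<D> (vert X s) \<cdot> h = (\<D> (\<tau> X) \<cdot> \<tau> (\<T> X) \<cdot> \<D> (vert X s)) \<cdot> h"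
    using va X h s' by (simp add: vert_def)
  also have "\<dots> = vlift (\<T> X) (\<tau> X) (\<tau> X \<cdot> \<D> s \<cdot> \<D> (\<pi> X)) \<cdot> h"
    unfolding vert_def rot_tan_vlift[OF c] using X s' by simp
  also have "\<dots> = vlift (\<T> X) (\<tau> X \<cdot> h) (\<tau> X \<cdot> \<D> s \<cdot> \<D> (\<pi> X) \<cdot> h)"
    using vlift_comp[of "\<T> X" "\<tau> X" "\<tau> X \<cdot> \<D> s \<cdot> \<D> (\<pi> X)" h] X h s' vector_fieldD(6)[OF s X, of "\<D> (\<pi> X)"]
    by (simp add: cofib_def proj_flip)
  finally show ?thesis .
qed

lemma rot_cancel:
  assumes X: "X \<in> Ob C" and A: "A \<in> Ar C" "Cod C A = \<T> (\<T> (\<T> X))" and B: "B \<in> Ar C" "Cod C B = \<T> (\<T> (\<T> X))"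
    and e: "\<D> (\<tau> X) \<cdot> \<tau> (\<T> X) \<cdot> A = \<D> (\<tau> X) \<cdot> \<tau> (\<T> X) \<cdot> B"
  shows "A = B"
proof -
  have "\<tau> (\<T> X) \<cdot> \<D> (\<tau> X) \<cdot> \<D> (\<tau> X) \<cdot> \<tau> (\<T> X) \<cdot> A = \<tau> (\<T> X) \<cdot> \<D> (\<tau> X) \<cdot> \<D> (\<tau> X) \<cdot> \<tau> (\<T> X) \<cdot> B"
    by (simp only: e)
  then show ?thesis using X A B by simp
qed

text \<open>The two sides of the bracket equation are compared after rotation, where each becomes
  the lift of \<open>T v \<cdot> s\<close> acted on by the lift of \<open>[v, s]\<close>. In
  \<open>L\<close> this action comes from the bracket equation on \<open>X\<close>, in
  \<open>R\<close> from the candidate for the bracket.\<close>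

lemma bracket_complete_vert:
  assumes X: "X \<in> Ob C" and v: "v \<in> vector_fields X" and s: "s \<in> vector_fields X"
  shows "vf_bracket (\<T> X) (\<tau> X \<cdot> \<D> v) (vert X s) = vert X (vf_bracket X v s)"
proof (rule bracket_eqI)
  let ?k = "vf_bracket X v s" and ?I = "Ident C (\<T> X)"
  note k = bracket_vector_field[OF X v s]
  note v' = vector_fieldD[OF v X] and s' = vector_fieldD[OF s X] and k' = vector_fieldD[OF k X]
  note vc = complete_vector_field[OF X v]
  note sv = vert_vector_field[OF X s] and kv = vert_vector_field[OF X k]
  have TX: "\<T> X \<in> Ob C" using X by simp
  note vc' = vector_fieldD[OF vc TX] and sv' = vector_fieldD[OF sv TX] and kv' = vector_fieldD[OF kv TX]
  let ?B = "\<D> v \<cdot> s \<cdot> \<pi> X"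
  have Bk: "actable X ?B (?k \<cdot> \<pi> X)"
    using actable_comp[OF actable_flow(2)[OF X v s k], of "\<pi> X"] v' s' k' X by simp
  have pB: "\<pi> (\<T> X) \<cdot> ?B = v \<cdot> \<pi> X" using v' s' X by (simp add: proj_nat')
  have VB: "cofib (\<T> X) (\<D> v) ?B" using v' s' X by (simp add: cofib_def proj_nat proj_nat')
  have "\<D> (\<tau> X) \<cdot> \<tau> (\<T> X) \<cdot> \<D> (vert X s) \<cdot> \<tau> X \<cdot> \<D> v = vlift (\<T> X) (\<D> v) ((\<tau> X \<cdot> \<D> s \<cdot> v) \<cdot> \<pi> X)"
    using rot_tan_vert[OF X s, of "\<tau> X \<cdot> \<D> v"] v' s' X by (simp add: proj_nat)
  \<comment> \<open>Here the bracket of \<open>v\<close> and \<open>s\<close> enters: it measures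
    the failure of \<open>\<tau> \<cdot> T s \<cdot> v\<close> to equal
    \<open>T v \<cdot> s\<close>.\<close>
  also have "(\<tau> X \<cdot> \<D> s \<cdot> v) \<cdot> \<pi> X = ?B \<lhd>\<^bsub>X\<^esub> (?k \<cdot> \<pi> X)"
    unfolding bracket_eqn_flip[OF X v s]
    using act_comp[OF actable_flow(2)[OF X v s k], of "\<pi> X"] v' s' k' X by simp
  also have "vlift (\<T> X) (\<D> v) (?B \<lhd>\<^bsub>X\<^esub> (?k \<cdot> \<pi> X))
      = vlift (\<T> X) (\<D> v) ?B \<lhd>\<^bsub>\<T> X\<^esub> vlift X (v \<cdot> \<pi> X) (?k \<cdot> \<pi> X)"
    using vlift_vadd[OF VB cofib_act[OF Bk]] vlift_arrow(4)[OF VB] pB by (simp add: act_def)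
  finally have L: "\<D> (\<tau> X) \<cdot> \<tau> (\<T> X) \<cdot> \<D> (vert X s) \<cdot> \<tau> X \<cdot> \<D> v
      = vlift (\<T> X) (\<D> v) ?B \<lhd>\<^bsub>\<T> X\<^esub> vlift X (v \<cdot> \<pi> X) (?k \<cdot> \<pi> X)" .
  let ?N = "\<D> (\<tau> X \<cdot> \<D> v) \<cdot> vert X s"
  have N: "?N \<in> Ar C" "Cod C ?N = \<T> (\<T> (\<T> X))" "Dom C ?N = \<T> X" using vc' sv' X by simp_all
  have pN: "\<pi> (\<T> (\<T> X)) \<cdot> ?N = \<tau> X \<cdot> \<D> v" using vc' sv' X by (simp add: proj_nat' del: tan_ar_comp)
  have ppN: "\<pi> (\<T> X) \<cdot> \<pi> (\<T> (\<T> X)) \<cdot> ?N = ?I" unfolding pN using vc' by simp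
  have dpN: "\<D> (\<pi> X) \<cdot> \<pi> (\<T> (\<T> X)) \<cdot> ?N = v \<cdot> \<pi> X" unfolding pN using v' X by (simp add: proj_nat)
  have DN: "\<D> (\<tau> X) \<cdot> ?N = vlift (\<T> X) (\<D> v) ?B"
    using vlift_nat[OF cofib_vert[OF X s], of v] vlift_arrow[OF VB] sv' v' X by (simp add: vert_def)
  have act: "actable X (\<pi> (\<T> (\<T> X)) \<cdot> ?N) (?k \<cdot> \<pi> X)"
    using cofib_vert[OF X k] ppN N X by (simp add: actable_def)
  have M: "actable (\<T> X) (\<tau> (\<T> X) \<cdot> ?N) (vert X ?k)"
    by (rule actable_flow(1)[OF TX vc sv kv])
  \<comment> \<open>The outer flip of the rotation cancels the flip of the flow square, so only
    \<open>T \<tau>\<close> remains and \<open>tan_flip_act\<close> applies.\<close>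
  have "\<D> (\<tau> X) \<cdot> \<tau> (\<T> X) \<cdot> ((\<tau> (\<T> X) \<cdot> ?N) \<lhd>\<^bsub>\<T> X\<^esub> vert X ?k) = \<D> (\<tau> X) \<cdot> (?N \<lhd>\<^bsub>\<T> X\<^esub> vert X ?k)"
    unfolding act_flip[OF M] using N X by simp
  also have "\<dots> = vlift (\<T> X) (\<D> v) ?B \<lhd>\<^bsub>\<T> X\<^esub> vlift X (v \<cdot> \<pi> X) (?k \<cdot> \<pi> X)"
    using tan_flip_act[OF N(1,2) act, unfolded ppN dpN DN] unfolding vert_def[of X ?k] .
  finally have R: "\<D> (\<tau> X) \<cdot> \<tau> (\<T> X) \<cdot> ((\<tau> (\<T> X) \<cdot> ?N) \<lhd>\<^bsub>\<T> X\<^esub> vert X ?k)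
      = vlift (\<T> X) (\<D> v) ?B \<lhd>\<^bsub>\<T> X\<^esub> vlift X (v \<cdot> \<pi> X) (?k \<cdot> \<pi> X)" .
  show "\<D> (vert X s) \<cdot> \<tau> X \<cdot> \<D> v = (\<tau> (\<T> X) \<cdot> \<D> (\<tau> X \<cdot> \<D> v) \<cdot> vert X s) \<lhd>\<^bsub>\<T> X\<^esub> vert X ?k"
    by (rule rot_cancel[OF X _ _ act_arrow(1)[OF M] act_arrow(3)[OF M] trans[OF L R[symmetric]]])
      (use sv' v' X in simp_all)
  show "vert X ?k \<in> vector_fields (\<T> X)" "\<T> X \<in> Ob C" "\<tau> X \<cdot> \<D> v \<in> vector_fields (\<T> X)"
    "vert X s \<in> vector_fields (\<T> X)" by (fact kv TX vc sv)+
qed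

text \<open>The flow cubes of two vertical lifts agree up to the flip. After rotation each is a
  flipped sum of a zero part, an s-part and a t-part, and exchanging the fields amounts to applying
  \<open>T \<tau>\<close> to that sum.\<close>

lemma bracket_vert_vert:
  assumes X: "X \<in> Ob C" and s: "s \<in> vector_fields X" and t: "t \<in> vector_fields X"
  shows "vf_bracket (\<T> X) (vert X s) (vert X t) = \<zeta> (\<T> X)"
proof -
  have TX: "\<T> X \<in> Ob C" using X by simp
  \<comment> \<open>At a vector y this is the cube
    \<open>(r, p, q) \<mapsto> y(r) + r q s + r p t\<close>, so exchanging the inner directions
    exchanges \<open>s\<close> and \<open>t\<close>.\<close>
  define E where "E s t = (\<D> (\<zeta> (\<T> X)) \<cdot> \<D> (\<zeta> X) \<oplus>\<^bsub>\<T> (\<T> X)\<^esub> \<D> (\<zeta> (\<T> X)) \<cdot> \<l> X \<cdot> s \<cdot> \<pi> X)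
      \<oplus>\<^bsub>\<T> (\<T> X)\<^esub> \<D> (\<D> (\<zeta> X)) \<cdot> \<l> X \<cdot> t \<cdot> \<pi> X" for s t
  have E: "\<D> (\<tau> X) \<cdot> \<tau> (\<T> X) \<cdot> \<D> (vert X t) \<cdot> vert X s = \<tau> (\<T> X) \<cdot> E s t"
    and DE: "\<D> (\<tau> X) \<cdot> E s t = E t s" and E_arrow: "E s t \<in> Ar C" "Cod C (E s t) = \<T> (\<T> (\<T> X))"
    if s: "s \<in> vector_fields X" and t: "t \<in> vector_fields X" for s t
  proof -
    note s' = vector_fieldD[OF s X] and t' = vector_fieldD[OF t X]
    note sv = vector_fieldD[OF vert_vector_field[OF X s] TX]
    note c = cofib_vert[OF X s]
    note d = cofib_vlift[OF c]
    have dp: "\<D> (\<pi> X) \<cdot> vert X s = \<zeta> X \<cdot> \<pi> X"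
      using vlift_arrow(5)[OF c] s' X by (simp add: vert_def)
    have fl: "\<tau> X \<cdot> vert X s = \<D> (\<zeta> X) \<oplus>\<^bsub>\<T> X\<^esub> \<l> X \<cdot> s \<cdot> \<pi> X"
      using flip_vlift[OF c] X by (simp add: vert_def)
    show "\<D> (\<tau> X) \<cdot> \<tau> (\<T> X) \<cdot> \<D> (vert X t) \<cdot> vert X s = \<tau> (\<T> X) \<cdot> E s t"
      unfolding rot_tan_vert[OF X t sv(1,3)] dp fl vlift_def
      using s' t' X vadd_nat[OF d, of "\<zeta> (\<T> X)"] lift_nat'[of "\<zeta> X" X "t \<cdot> \<pi> X"]
      by (simp add: E_def zero_nat')
    have e1: "cofib (\<T> (\<T> X)) (\<D> (\<zeta> (\<T> X)) \<cdot> \<D> (\<zeta> X)) (\<D> (\<zeta> (\<T> X)) \<cdot> \<l> X \<cdot> s \<cdot> \<pi> X)"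
      using cofib_tan[OF d, of "\<zeta> (\<T> X)"] X by simp
    have e2: "cofib (\<T> (\<T> X)) (\<D> (\<zeta> (\<T> X)) \<cdot> \<l> X \<cdot> s \<cdot> \<pi> X) (\<D> (\<D> (\<zeta> X)) \<cdot> \<l> X \<cdot> t \<cdot> \<pi> X)"
      using s' t' X by (simp add: cofib_def proj_nat' zero_nat')
    note e = cofib_vadd(1)[OF e1 e2]
    show "E s t \<in> Ar C" "Cod C (E s t) = \<T> (\<T> (\<T> X))"
      unfolding E_def using vadd_arrow[OF e] X by simp_all
    have zz: "\<D> (\<D> (\<zeta> X)) \<cdot> \<D> (\<zeta> X) = \<D> (\<zeta> (\<T> X)) \<cdot> \<D> (\<zeta> X)"
      using arg_cong[OF zero_nat[of "\<zeta> X" X], of \<D>] X by simp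
    have "\<D> (\<tau> X) \<cdot> E s t = (\<D> (\<zeta> (\<T> X)) \<cdot> \<D> (\<zeta> X) \<oplus>\<^bsub>\<T> (\<T> X)\<^esub> \<D> (\<D> (\<zeta> X)) \<cdot> \<l> X \<cdot> s \<cdot> \<pi> X)
      \<oplus>\<^bsub>\<T> (\<T> X)\<^esub> \<D> (\<zeta> (\<T> X)) \<cdot> \<l> X \<cdot> t \<cdot> \<pi> X"
      unfolding E_def using vadd_nat[OF e, of "\<tau> X"] vadd_nat[OF e1, of "\<tau> X"] s' t' X zz by simp
    also have "\<dots> = \<D> (\<zeta> (\<T> X)) \<cdot> \<D> (\<zeta> X) \<oplus>\<^bsub>\<T> (\<T> X)\<^esub>
       (\<D> (\<D> (\<zeta> X)) \<cdot> \<l> X \<cdot> s \<cdot> \<pi> X \<oplus>\<^bsub>\<T> (\<T> X)\<^esub> \<D> (\<zeta> (\<T> X)) \<cdot> \<l> X \<cdot> t \<cdot> \<pi> X)"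
      by (rule vadd_assoc) (use s' t' X in \<open>simp_all add: cofib_def proj_nat' proj_nat zero_nat'\<close>)
    also have "\<D> (\<D> (\<zeta> X)) \<cdot> \<l> X \<cdot> s \<cdot> \<pi> X \<oplus>\<^bsub>\<T> (\<T> X)\<^esub> \<D> (\<zeta> (\<T> X)) \<cdot> \<l> X \<cdot> t \<cdot> \<pi> X
       = \<D> (\<zeta> (\<T> X)) \<cdot> \<l> X \<cdot> t \<cdot> \<pi> X \<oplus>\<^bsub>\<T> (\<T> X)\<^esub> \<D> (\<D> (\<zeta> X)) \<cdot> \<l> X \<cdot> s \<cdot> \<pi> X"
      by (rule vadd_commute) (use s' t' X in \<open>simp_all add: cofib_def proj_nat' zero_nat'\<close>)
    also have "\<D> (\<zeta> (\<T> X)) \<cdot> \<D> (\<zeta> X) \<oplus>\<^bsub>\<T> (\<T> X)\<^esub>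
       (\<D> (\<zeta> (\<T> X)) \<cdot> \<l> X \<cdot> t \<cdot> \<pi> X \<oplus>\<^bsub>\<T> (\<T> X)\<^esub> \<D> (\<D> (\<zeta> X)) \<cdot> \<l> X \<cdot> s \<cdot> \<pi> X) = E t s"
      unfolding E_def
      by (rule vadd_assoc[symmetric]) (use s' t' X in \<open>simp_all add: cofib_def proj_nat' proj_nat zero_nat'\<close>)
    finally show "\<D> (\<tau> X) \<cdot> E s t = E t s" .
  qed
  note sv = vert_vector_field[OF X s] and tv = vert_vector_field[OF X t]
  note sv' = vector_fieldD[OF sv TX] and tv' = vector_fieldD[OF tv TX]
  let ?Y = "\<D> (vert X s) \<cdot> vert X t"
  have Y: "?Y \<in> Ar C" "Cod C ?Y = \<T> (\<T> (\<T> X))" "Dom C ?Y = \<T> X" using sv' tv' X by simp_all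
  \<comment> \<open>Cancelling flips are inserted to create the rotation of \<open>?Y\<close>, which
    is \<open>\<tau> \<cdot> E t s\<close>; the braid relation then leaves
    \<open>\<tau> \<cdot> T \<tau>\<close> applied to \<open>E t s\<close>.\<close>
  have "\<D> (\<tau> X) \<cdot> ?Y = \<D> (\<tau> X) \<cdot> \<tau> (\<T> X) \<cdot> \<D> (\<tau> X) \<cdot> (\<D> (\<tau> X) \<cdot> \<tau> (\<T> X) \<cdot> ?Y)"
    using Y X by simp
  also have "\<dots> = \<D> (\<tau> X) \<cdot> \<tau> (\<T> X) \<cdot> \<D> (\<tau> X) \<cdot> \<tau> (\<T> X) \<cdot> E t s"
    by (simp only: E[OF t s])
  also have "\<dots> = \<tau> (\<T> X) \<cdot> E s t"
    using flip_braid'[of X "\<tau> (\<T> X) \<cdot> E t s", symmetric] E_arrow[OF t s] DE[OF t s] X by simp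
  also have "\<dots> = \<D> (\<tau> X) \<cdot> \<tau> (\<T> X) \<cdot> \<D> (vert X t) \<cdot> vert X s" by (rule E[OF s t, symmetric])
  finally have "\<D> (\<tau> X) \<cdot> \<tau> (\<T> X) \<cdot> \<D> (vert X t) \<cdot> vert X s = \<D> (\<tau> X) \<cdot> \<tau> (\<T> X) \<cdot> \<tau> (\<T> X) \<cdot> ?Y"
    using Y X by simp
  from rot_cancel[OF X _ _ _ _ this]
  have eq: "\<D> (vert X t) \<cdot> vert X s = \<tau> (\<T> X) \<cdot> ?Y" using Y X sv' tv' by simp
  have "(\<tau> (\<T> X) \<cdot> ?Y) \<lhd>\<^bsub>\<T> X\<^esub> (\<zeta> (\<T> X) \<cdot> Ident C (\<T> X)) = \<tau> (\<T> X) \<cdot> ?Y"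
    by (rule act_zero) (use sv' tv' X in simp_all)
  with eq show ?thesis
    using X by (intro bracket_eqI[OF TX sv tv]) (simp_all add: zero_vector_field)
qed

lemma vert_vadd:
  assumes X: "X \<in> Ob C" and s: "s \<in> vector_fields X" and t: "t \<in> vector_fields X"
  shows "vert X s \<oplus>\<^bsub>\<T> X\<^esub> vert X t = vert X (s \<oplus>\<^bsub>X\<^esub> t)"
proof -
  note s' = vector_fieldD[OF s X] and t' = vector_fieldD[OF t X]
  have "cofib X (s \<cdot> \<pi> X) (t \<cdot> \<pi> X)" using s' t' X by (simp add: cofib_def)
  from vlift_vadd[OF cofib_vert[OF X s] this] show ?thesis
    using vadd_comp[OF vector_field_cofib[OF s t X], of "\<pi> X"] t' X by (simp add: vert_def)
qed

lemma vert_neg: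
  assumes X: "X \<in> Ob C" and s: "s \<in> vector_fields X"
  shows "vneg (\<T> X) \<cdot> vert X s = vert X (vneg X \<cdot> s)"
proof -
  have TX: "\<T> X \<in> Ob C" using X by simp
  note n = vector_field_neg[OF s X]
  note sv = vert_vector_field[OF X s] and nv = vert_vector_field[OF X n]
  have z: "vert X (\<zeta> X) = \<zeta> (\<T> X)"
    using vlift_zero[of X "Ident C (\<T> X)" "\<pi> X"] X by (simp add: vert_def)
  have "vert X s \<oplus>\<^bsub>\<T> X\<^esub> (vneg (\<T> X) \<cdot> vert X s) = vert X s \<oplus>\<^bsub>\<T> X\<^esub> vert X (vneg X \<cdot> s)"
    using vert_vadd[OF X s n] vadd_neg[OF X, of s] vadd_neg[OF TX, of "vert X s"] z
      vector_fieldD[OF s X] vector_fieldD[OF sv TX] X by simp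
  then show ?thesis
    by (rule vadd_cancel[OF vector_field_cofib[OF sv vector_field_neg[OF sv TX] TX]
          vector_field_cofib[OF sv nv TX]])
qed

text \<open>For \<open>s = [v, w]\<close> the right-hand side is \<open>T w \<cdot> v\<close>.\<close>

lemma bracket_related_lift:
  assumes X: "X \<in> Ob C" and v: "v \<in> vector_fields X" and w: "w \<in> vector_fields X" and s: "s \<in> vector_fields X"
  shows "(\<tau> X \<cdot> \<D> v \<oplus>\<^bsub>\<T> X\<^esub> vert X s) \<cdot> w = (\<tau> X \<cdot> \<D> v \<cdot> w) \<lhd>\<^bsub>X\<^esub> s"
proof -
  have TX: "\<T> X \<in> Ob C" using X by simp
  note v' = vector_fieldD[OF v X] and w' = vector_fieldD[OF w X] and s' = vector_fieldD[OF s X]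
  note vc = complete_vector_field[OF X v] and sv = vert_vector_field[OF X s]
  have p: "\<pi> (\<T> X) \<cdot> \<tau> X \<cdot> \<D> v \<cdot> w = w" using v' w' X by simp
  show ?thesis
    using vadd_comp[OF vector_field_cofib[OF vc sv TX], of w] vlift_comp[OF cofib_vert[OF X s], of w]
      vector_fieldD[OF sv TX] v' w' s' X
    unfolding act_def p by (simp add: vert_def)
qed

section \<open>The Jacobi identity and the Lie algebra of vector fields\<close>

text \<open>By \<open>bracket_related_lift\<close>, composing the complete lift of
  \<open>[v, u]\<close> plus the vertical lift of a field with \<open>w\<close> produces the right
  side of the equation that defines \<open>[[v, u], w]\<close>, with that field as candidate. So the
  double bracket is the vertical part of the bracket of \<open>?L\<close> and
  \<open>?M\<close>.\<close>

lemma jacobi: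
  assumes X: "X \<in> Ob C" and v: "v \<in> vector_fields X" and u: "u \<in> vector_fields X" and w: "w \<in> vector_fields X"
  shows "vf_bracket X (vf_bracket X v u) w
    = vf_bracket X v (vf_bracket X u w) \<oplus>\<^bsub>X\<^esub> (vneg X \<cdot> vf_bracket X u (vf_bracket X v w))"
proof -
  let ?p = "vf_bracket X v w" and ?q = "vf_bracket X u w" and ?k = "vf_bracket X v u"
  have TX: "\<T> X \<in> Ob C" using X by simp
  note w' = vector_fieldD[OF w X]
  note p = bracket_vector_field[OF X v w] and q = bracket_vector_field[OF X u w]
    and k = bracket_vector_field[OF X v u]
  let ?r = "vf_bracket X v ?q" and ?s = "vneg X \<cdot> vf_bracket X u ?p"
  note r = bracket_vector_field[OF X v q] and s0 = bracket_vector_field[OF X u p]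
  note s = vector_field_neg[OF s0 X]
  note rs = vector_field_vadd[OF r s X]
  note vc = complete_vector_field[OF X v] and uc = complete_vector_field[OF X u]
    and pv = vert_vector_field[OF X p] and qv = vert_vector_field[OF X q]
  let ?L = "\<tau> X \<cdot> \<D> v \<oplus>\<^bsub>\<T> X\<^esub> vert X ?p" and ?M = "\<tau> X \<cdot> \<D> u \<oplus>\<^bsub>\<T> X\<^esub> vert X ?q"
  note L = vector_field_vadd[OF vc pv TX] and M = vector_field_vadd[OF uc qv TX]
  note kc = complete_vector_field[OF X k] and rv = vert_vector_field[OF X r]
    and sv = vert_vector_field[OF X s]
  interpret G: comm_group "vf_group (\<T> X)" by (rule vf_group_comm_group[OF TX])
  \<comment> \<open>Antisymmetry brings this mixed bracket into the computed order; this is the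
    origin of the sign in \<open>?s\<close>.\<close>
  have "vf_bracket (\<T> X) (vert X ?p) (\<tau> X \<cdot> \<D> u) = vert X ?s"
    by (simp only: bracket_antisym[OF TX uc pv] bracket_complete_vert[OF X u p] vert_neg[OF X s0])
  then have "vf_bracket (\<T> X) ?L ?M = (\<tau> X \<cdot> \<D> ?k \<oplus>\<^bsub>\<T> X\<^esub> vert X ?s) \<oplus>\<^bsub>\<T> X\<^esub> (vert X ?r \<oplus>\<^bsub>\<T> X\<^esub> \<zeta> (\<T> X))"
    by (simp only: bracket_vadd_right[OF TX L uc qv] bracket_vadd_left[OF TX vc pv uc]
        bracket_vadd_left[OF TX vc pv qv] bracket_complete_complete[OF X v u]
        bracket_complete_vert[OF X v q] bracket_vert_vert[OF X p q])
  also have "\<dots> = \<tau> X \<cdot> \<D> ?k \<oplus>\<^bsub>\<T> X\<^esub> (vert X ?r \<oplus>\<^bsub>\<T> X\<^esub> vert X ?s)"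
    using G.m_assoc[of "\<tau> X \<cdot> \<D> ?k" "vert X ?s" "vert X ?r"] G.m_comm[of "vert X ?s" "vert X ?r"] kc rv sv
    by (simp add: vadd_zero_field[OF TX])
  also have "\<dots> = \<tau> X \<cdot> \<D> ?k \<oplus>\<^bsub>\<T> X\<^esub> vert X (?r \<oplus>\<^bsub>X\<^esub> ?s)"
    by (simp only: vert_vadd[OF X r s])
  finally have LM: "vf_bracket (\<T> X) ?L ?M = \<tau> X \<cdot> \<D> ?k \<oplus>\<^bsub>\<T> X\<^esub> vert X (?r \<oplus>\<^bsub>X\<^esub> ?s)" .
  \<comment> \<open>The section \<open>w\<close> is used as a plain arrow from \<open>X\<close> to
    \<open>T X\<close>. The relatedness hypotheses are the equations defining \<open>[v, w]\<close>
    and \<open>[u, w]\<close>.\<close>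
  have "\<D> w \<cdot> ?k = vf_bracket (\<T> X) ?L ?M \<cdot> w"
    by (rule bracket_related[OF X TX w'(1-3) v u L M])
      (simp_all only: bracket_related_lift[OF X v w p] bracket_related_lift[OF X u w q]
        bracket_eqn[OF X v w] bracket_eqn[OF X u w])
  also have "\<dots> = (\<tau> X \<cdot> \<D> ?k \<cdot> w) \<lhd>\<^bsub>X\<^esub> (?r \<oplus>\<^bsub>X\<^esub> ?s)"
    unfolding LM by (rule bracket_related_lift[OF X k w rs])
  finally show ?thesis by (rule bracket_eqI[OF X k w rs])
qed

lemma bracket_lie:
  assumes X: "X \<in> Ob C"
  shows "lie_bracket (vf_group X) (vf_bracket X)"
proof -
  interpret G: comm_group "vf_group X" by (rule vf_group_comm_group[OF X])
  note br = bracket_vector_field[OF X]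
  have anti: "vf_bracket X a b = inv\<^bsub>vf_group X\<^esub> (vf_bracket X b a)"
    if "a \<in> vector_fields X" "b \<in> vector_fields X" for a b
    using bracket_antisym[OF X that(2,1)] vf_group_inv[OF X br[OF that(2,1)]] by simp
  have jac: "vf_bracket X a (vf_bracket X b c) \<otimes>\<^bsub>vf_group X\<^esub> vf_bracket X b (vf_bracket X c a) \<otimes>\<^bsub>vf_group X\<^esub>
      vf_bracket X c (vf_bracket X a b) = \<one>\<^bsub>vf_group X\<^esub>"
    if a: "a \<in> vector_fields X" and b: "b \<in> vector_fields X" and c: "c \<in> vector_fields X" for a b c
  proof -
    let ?x = "vf_bracket X a (vf_bracket X b c)" and ?y = "vf_bracket X b (vf_bracket X a c)"
    have x: "?x \<in> carrier (vf_group X)" and y: "?y \<in> carrier (vf_group X)" using a b c br by simp_all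
    \<comment> \<open>Additivity in the second argument makes the bracket with zero idempotent,
      hence zero; inverses are then preserved.\<close>
    have neg: "vf_bracket X b (inv\<^bsub>vf_group X\<^esub> d) = inv\<^bsub>vf_group X\<^esub> (vf_bracket X b d)"
      if d: "d \<in> vector_fields X" for d
    proof -
      have d': "inv\<^bsub>vf_group X\<^esub> d \<in> vector_fields X" using d G.inv_closed[of d] by simp
      have i: "inv\<^bsub>vf_group X\<^esub> d \<oplus>\<^bsub>X\<^esub> d = \<zeta> X" using G.l_inv[of d] d by simp
      have z: "\<zeta> X \<oplus>\<^bsub>X\<^esub> \<zeta> X = \<zeta> X" using vadd_zero_field[OF X zero_vector_field[OF X]] by simp
      have "vf_bracket X b (\<zeta> X) \<otimes>\<^bsub>vf_group X\<^esub> vf_bracket X b (\<zeta> X) = vf_bracket X b (\<zeta> X)"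
        using bracket_vadd_right[OF X b zero_vector_field[OF X] zero_vector_field[OF X]] z by simp
      then have "vf_bracket X b (\<zeta> X) = \<zeta> X"
        using G.l_cancel_one[of "vf_bracket X b (\<zeta> X)" "vf_bracket X b (\<zeta> X)"] br[OF b zero_vector_field[OF X]]
        by simp
      then have "vf_bracket X b (inv\<^bsub>vf_group X\<^esub> d) \<otimes>\<^bsub>vf_group X\<^esub> vf_bracket X b d = \<one>\<^bsub>vf_group X\<^esub>"
        using bracket_vadd_right[OF X b d' d] i by simp
      then show ?thesis using br[OF b d] br[OF b d'] by (intro G.inv_equality[symmetric]) simp_all
    qed
    \<comment> \<open>In additive notation the cyclic sum becomes x - y - (x - y), the last bracket
      being minus the derivation form supplied by \<open>jacobi\<close>.\<close>
    have "vf_bracket X b (vf_bracket X c a) = inv\<^bsub>vf_group X\<^esub> ?y"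
      using neg[OF br[OF a c]] anti[OF c a] by simp
    moreover have "vf_bracket X c (vf_bracket X a b) = inv\<^bsub>vf_group X\<^esub> (?x \<otimes>\<^bsub>vf_group X\<^esub> inv\<^bsub>vf_group X\<^esub> ?y)"
      using anti[OF c br[OF a b]] jacobi[OF X a b c] vf_group_inv[OF X br[OF b br[OF a c]]] by simp
    ultimately show ?thesis
      using G.r_inv[OF G.m_closed[OF x G.inv_closed[OF y]]] by simp
  qed
  show ?thesis
    unfolding lie_bracket_def
  proof (intro conjI ballI)
    show "vf_bracket X \<in> carrier (vf_group X) \<rightarrow> carrier (vf_group X) \<rightarrow> carrier (vf_group X)"
      using br by auto
    fix a b
    assume a: "a \<in> carrier (vf_group X)" and b: "b \<in> carrier (vf_group X)"
    then show "vf_bracket X a b = inv\<^bsub>vf_group X\<^esub> vf_bracket X b a"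
      unfolding vf_group_simps by (rule anti)
    fix c
    assume c: "c \<in> carrier (vf_group X)"
    show "vf_bracket X (a \<otimes>\<^bsub>vf_group X\<^esub> b) c = vf_bracket X a c \<otimes>\<^bsub>vf_group X\<^esub> vf_bracket X b c"
      using a b c unfolding vf_group_simps by (rule bracket_vadd_left[OF X])
    show "vf_bracket X a (b \<otimes>\<^bsub>vf_group X\<^esub> c) = vf_bracket X a b \<otimes>\<^bsub>vf_group X\<^esub> vf_bracket X a c"
      using a b c unfolding vf_group_simps by (rule bracket_vadd_right[OF X])
    show "vf_bracket X a (vf_bracket X b c) \<otimes>\<^bsub>vf_group X\<^esub> vf_bracket X b (vf_bracket X c a) \<otimes>\<^bsub>vf_group X\<^esub>
        vf_bracket X c (vf_bracket X a b) = \<one>\<^bsub>vf_group X\<^esub>"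
      using a b c by (intro jac) simp_all
  qed (rule G.comm_group_axioms)
qed

end

subsection \<open>The Leibniz rule\<close>

context cartesian_tangent_category
begin

lemma product: "A \<in> Ob C \<Longrightarrow> B \<in> Ob C \<Longrightarrow> is_product C [A, B] (Prod F A B) [Pr1 F A B, Pr2 F A B]"
  and one_product: "is_product C [] (One F) []"
  using has_finite_products by (auto simp: finite_products_def)

lemma product_arrow [simp]:
  assumes "A \<in> Ob C" "B \<in> Ob C"
  shows "Prod F A B \<in> Ob C" "Pr1 F A B \<in> Ar C" "Dom C (Pr1 F A B) = Prod F A B" "Cod C (Pr1 F A B) = A"
    "Pr2 F A B \<in> Ar C" "Dom C (Pr2 F A B) = Prod F A B" "Cod C (Pr2 F A B) = B"
  using product_pair[OF product[OF assms]] by (auto simp: Hom_def)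

lemma pair_arrow [simp]:
  assumes "f \<in> Ar C" "g \<in> Ar C" "Dom C f = Dom C g"
  shows "pair f g \<in> Ar C" "Dom C (pair f g) = Dom C g" "Cod C (pair f g) = Prod F (Cod C f) (Cod C g)"
    "Cod C f = A \<Longrightarrow> Cod C g = B \<Longrightarrow> Pr1 F A B \<cdot> pair f g = f"
    "Cod C f = A \<Longrightarrow> Cod C g = B \<Longrightarrow> Pr2 F A B \<cdot> pair f g = g"
  using product_tuple[OF product[of "Cod C f" "Cod C g"] assms refl refl] assms
  by (auto simp: pair_def Let_def Hom_def)

lemma pair_proj' [simp]:
  assumes "f \<in> Ar C" "g \<in> Ar C" "Dom C f = Dom C g" "Cod C f = A" "Cod C g = B" "h \<in> Ar C" "Cod C h = Dom C g"
  shows "Pr1 F A B \<cdot> pair f g \<cdot> h = f \<cdot> h" "Pr2 F A B \<cdot> pair f g \<cdot> h = g \<cdot> h"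
  using comp_reassoc[OF pair_arrow(4)[OF assms(1-5)], of h] comp_reassoc[OF pair_arrow(5)[OF assms(1-5)], of h]
    assms by auto

lemma pair_comp [simp]:
  assumes "f \<in> Ar C" "g \<in> Ar C" "Dom C f = Dom C g" "h \<in> Ar C" "Cod C h = Dom C g"
  shows "pair f g \<cdot> h = pair (f \<cdot> h) (g \<cdot> h)"
  by (rule product_eqI[OF product[of "Cod C f" "Cod C g"]]) (use assms in simp_all)

lemma par_arrow [simp]:
  assumes "f \<in> Ar C" "g \<in> Ar C"
  shows "par f g \<in> Ar C" "Dom C (par f g) = Prod F (Dom C f) (Dom C g)"
    "Cod C (par f g) = Prod F (Cod C f) (Cod C g)"
  using assms by (simp_all add: par_def Let_def)

lemma par_pair [simp]:
  assumes "f \<in> Ar C" "g \<in> Ar C" "a \<in> Ar C" "b \<in> Ar C" "Dom C a = Dom C b" "Cod C a = Dom C f" "Cod C b = Dom C g"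
  shows "par f g \<cdot> pair a b = pair (f \<cdot> a) (g \<cdot> b)"
  using assms by (simp add: par_def Let_def)

definition tan_pair :: "'o \<Rightarrow> 'o \<Rightarrow> 'm \<Rightarrow> 'm \<Rightarrow> 'm" where
  "tan_pair X Y a b = inverse_of C (chi X Y) \<cdot> pair a b"

lemma chi_inverse:
  assumes "X \<in> Ob C" "Y \<in> Ob C"
  shows "chi X Y \<in> Ar C" "Dom C (chi X Y) = \<T> (Prod F X Y)" "Cod C (chi X Y) = Prod F (\<T> X) (\<T> Y)"
    "inverse_of C (chi X Y) \<in> Ar C" "Dom C (inverse_of C (chi X Y)) = Prod F (\<T> X) (\<T> Y)"
    "Cod C (inverse_of C (chi X Y)) = \<T> (Prod F X Y)"
    "chi X Y \<cdot> inverse_of C (chi X Y) = Ident C (Prod F (\<T> X) (\<T> Y))"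
    "inverse_of C (chi X Y) \<cdot> chi X Y = Ident C (\<T> (Prod F X Y))"
  using inverse_of_inverse[OF chi_iso[OF assms]] assms by (auto simp: inverse_arrows_def Hom_def chi_def)

lemma tan_pair:
  assumes X: "X \<in> Ob C" and Y: "Y \<in> Ob C" and ab: "a \<in> Ar C" "b \<in> Ar C" "Dom C a = Dom C b" "Cod C a = \<T> X" "Cod C b = \<T> Y"
  shows "tan_pair X Y a b \<in> Ar C" "Dom C (tan_pair X Y a b) = Dom C b"
    "Cod C (tan_pair X Y a b) = \<T> (Prod F X Y)"
    "\<D> (Pr1 F X Y) \<cdot> tan_pair X Y a b = a" "\<D> (Pr2 F X Y) \<cdot> tan_pair X Y a b = b"
proof -
  note c = chi_inverse[OF X Y]
  show t: "tan_pair X Y a b \<in> Ar C" "Dom C (tan_pair X Y a b) = Dom C b"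
    "Cod C (tan_pair X Y a b) = \<T> (Prod F X Y)"
    using c ab by (simp_all add: tan_pair_def)
  have "chi X Y \<cdot> tan_pair X Y a b = Ident C (Prod F (\<T> X) (\<T> Y)) \<cdot> pair a b"
    unfolding tan_pair_def by (rule comp_reassoc[OF c(7)]) (use c ab in simp_all)
  then have e: "chi X Y \<cdot> tan_pair X Y a b = pair a b" using ab X Y by simp
  have d: "chi X Y \<cdot> tan_pair X Y a b
      = pair (\<D> (Pr1 F X Y) \<cdot> tan_pair X Y a b) (\<D> (Pr2 F X Y) \<cdot> tan_pair X Y a b)"
    using t X Y by (simp add: chi_def)
  show "\<D> (Pr1 F X Y) \<cdot> tan_pair X Y a b = a"
    using arg_cong[OF d[unfolded e], of "\<lambda>u. Pr1 F (\<T> X) (\<T> Y) \<cdot> u"] ab t X Y by simp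
  show "\<D> (Pr2 F X Y) \<cdot> tan_pair X Y a b = b"
    using arg_cong[OF d[unfolded e], of "\<lambda>u. Pr2 F (\<T> X) (\<T> Y) \<cdot> u"] ab t X Y by simp
qed

lemma tan_pair_eq:
  assumes X: "X \<in> Ob C" and Y: "Y \<in> Ob C" and K: "K \<in> Ar C" "Cod C K = \<T> (Prod F X Y)"
  shows "K = tan_pair X Y (\<D> (Pr1 F X Y) \<cdot> K) (\<D> (Pr2 F X Y) \<cdot> K)"
proof -
  note c = chi_inverse[OF X Y]
  have "inverse_of C (chi X Y) \<cdot> chi X Y \<cdot> K = Ident C (\<T> (Prod F X Y)) \<cdot> K"
    by (rule comp_reassoc[OF c(8)]) (use c K in simp_all)
  then show ?thesis using c K X Y by (simp add: tan_pair_def chi_def)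
qed

lemma tan_ar_pair:
  assumes "f \<in> Ar C" "g \<in> Ar C" "Dom C f = Dom C g" "h \<in> Ar C" "Cod C h = \<T> (Dom C g)"
  shows "\<D> (pair f g) \<cdot> h = tan_pair (Cod C f) (Cod C g) (\<D> f \<cdot> h) (\<D> g \<cdot> h)"
proof -
  note p = pair_arrow[OF assms(1-3)]
  have "\<D> (Pr1 F (Cod C f) (Cod C g)) \<cdot> \<D> (pair f g) \<cdot> h = \<D> f \<cdot> h"
    "\<D> (Pr2 F (Cod C f) (Cod C g)) \<cdot> \<D> (pair f g) \<cdot> h = \<D> g \<cdot> h"
    by (rule tan_reassoc; use p assms in simp)+
  then show ?thesis using tan_pair_eq[of "Cod C f" "Cod C g" "\<D> (pair f g) \<cdot> h"] p assms by simp
qed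

lemma proj_tan_pair:
  assumes X: "X \<in> Ob C" and Y: "Y \<in> Ob C" and ab: "a \<in> Ar C" "b \<in> Ar C" "Dom C a = Dom C b" "Cod C a = \<T> X" "Cod C b = \<T> Y"
  shows "\<pi> (Prod F X Y) \<cdot> tan_pair X Y a b = pair (\<pi> X \<cdot> a) (\<pi> Y \<cdot> b)"
proof (rule product_eqI[OF product[OF X Y]])
  note t = tan_pair[OF X Y ab]
  show "Pr1 F X Y \<cdot> \<pi> (Prod F X Y) \<cdot> tan_pair X Y a b = Pr1 F X Y \<cdot> pair (\<pi> X \<cdot> a) (\<pi> Y \<cdot> b)"
    using proj_nat'[of "Pr1 F X Y" X "tan_pair X Y a b"] t ab X Y by simp
  show "Pr2 F X Y \<cdot> \<pi> (Prod F X Y) \<cdot> tan_pair X Y a b = Pr2 F X Y \<cdot> pair (\<pi> X \<cdot> a) (\<pi> Y \<cdot> b)"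
    using proj_nat'[of "Pr2 F X Y" Y "tan_pair X Y a b"] t ab X Y by simp
qed (use tan_pair[OF X Y ab] X Y ab in simp_all)

text \<open>The tangent maps of the projections are additive and jointly determine a tangent vector
  of the product.\<close>

lemma tan_pair_vadd:
  assumes a: "cofib X a a'" and b: "cofib Y b b'" and dom: "Dom C a = Dom C b"
  shows "tan_pair X Y a b \<oplus>\<^bsub>Prod F X Y\<^esub> tan_pair X Y a' b' = tan_pair X Y (a \<oplus>\<^bsub>X\<^esub> a') (b \<oplus>\<^bsub>Y\<^esub> b')"
    and cofib_tan_pair: "cofib (Prod F X Y) (tan_pair X Y a b) (tan_pair X Y a' b')"
proof -
  note ca = cofibD[OF a] and cb = cofibD[OF b]
  have dom': "Dom C a' = Dom C b'" using ca cb dom by simp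
  note t = tan_pair[OF ca(1) cb(1) ca(2) cb(2) dom ca(5) cb(5)]
  note t' = tan_pair[OF ca(1) cb(1) ca(3) cb(3) dom' ca(6) cb(6)]
  show c: "cofib (Prod F X Y) (tan_pair X Y a b) (tan_pair X Y a' b')"
    using t t' ca cb dom dom' by (simp add: cofib_def proj_tan_pair)
  show "tan_pair X Y a b \<oplus>\<^bsub>Prod F X Y\<^esub> tan_pair X Y a' b' = tan_pair X Y (a \<oplus>\<^bsub>X\<^esub> a') (b \<oplus>\<^bsub>Y\<^esub> b')"
    using tan_pair_eq[OF ca(1) cb(1) vadd_arrow(1,3)[OF c]] vadd_nat[OF c, of "Pr1 F X Y"]
      vadd_nat[OF c, of "Pr2 F X Y"] t t' ca(1) cb(1) by simp
qed

lemma partial1_pair: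
  assumes X: "X \<in> Ob C" and Y: "Y \<in> Ob C" and f: "f \<in> Ar C" "Dom C f = Prod F X Y"
    and ab: "a \<in> Ar C" "y \<in> Ar C" "Dom C a = Dom C y" "Cod C a = \<T> X" "Cod C y = Y"
  shows "partial1 X Y f \<cdot> pair a y = \<D> f \<cdot> tan_pair X Y a (\<zeta> Y \<cdot> y)"
  using chi_inverse[OF X Y] assms by (simp add: partial1_def tan_pair_def)

lemma partial2_pair:
  assumes X: "X \<in> Ob C" and Y: "Y \<in> Ob C" and f: "f \<in> Ar C" "Dom C f = Prod F X Y"
    and ab: "x \<in> Ar C" "b \<in> Ar C" "Dom C x = Dom C b" "Cod C x = X" "Cod C b = \<T> Y"
  shows "partial2 X Y f \<cdot> pair x b = \<D> f \<cdot> tan_pair X Y (\<zeta> X \<cdot> x) b"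
  using chi_inverse[OF X Y] assms by (simp add: partial2_def tan_pair_def)

text \<open>The total derivative is the sum of the partial ones: over the common base point the pair
  (a, b) is the sum of (a, 0) and (0, b), and \<open>T f\<close> is additive.\<close>

lemma tan_ar_tan_pair:
  assumes X: "X \<in> Ob C" and Y: "Y \<in> Ob C" and f: "f \<in> Ar C" "Dom C f = Prod F X Y"
    and ab: "a \<in> Ar C" "b \<in> Ar C" "Dom C a = Dom C b" "Cod C a = \<T> X" "Cod C b = \<T> Y"
  shows "\<D> f \<cdot> tan_pair X Y a b
    = (partial1 X Y f \<cdot> pair a (\<pi> Y \<cdot> b)) \<oplus>\<^bsub>Cod C f\<^esub> (partial2 X Y f \<cdot> pair (\<pi> X \<cdot> a) b)"
proof -
  have a: "cofib X a (\<zeta> X \<cdot> \<pi> X \<cdot> a)" and b: "cofib Y (\<zeta> Y \<cdot> \<pi> Y \<cdot> b) b" using X Y ab by (simp_all add: cofib_def)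
  have "tan_pair X Y a b = tan_pair X Y a (\<zeta> Y \<cdot> \<pi> Y \<cdot> b) \<oplus>\<^bsub>Prod F X Y\<^esub> tan_pair X Y (\<zeta> X \<cdot> \<pi> X \<cdot> a) b"
    using tan_pair_vadd[OF a b] ab X Y by simp
  moreover have "cofib (Prod F X Y) (tan_pair X Y a (\<zeta> Y \<cdot> \<pi> Y \<cdot> b)) (tan_pair X Y (\<zeta> X \<cdot> \<pi> X \<cdot> a) b)"
    using cofib_tan_pair[OF a b] ab X Y by simp
  from vadd_nat[OF this f]
  have "\<D> f \<cdot> (tan_pair X Y a (\<zeta> Y \<cdot> \<pi> Y \<cdot> b) \<oplus>\<^bsub>Prod F X Y\<^esub> tan_pair X Y (\<zeta> X \<cdot> \<pi> X \<cdot> a) b)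
    = (partial1 X Y f \<cdot> pair a (\<pi> Y \<cdot> b)) \<oplus>\<^bsub>Cod C f\<^esub> (partial2 X Y f \<cdot> pair (\<pi> X \<cdot> a) b)"
    using partial1_pair[OF X Y f, of a "\<pi> Y \<cdot> b"] partial2_pair[OF X Y f, of "\<pi> X \<cdot> a" b] ab X Y by simp
  ultimately show ?thesis by simp
qed

end

section \<open>Scalar multiplication of generalized tangent vectors and the Leibniz rule\<close>

context scalar_tangent_category
begin

lemma ring_group: "abelian_group_obj C ring_additive_group"
  using ring_object category_axioms
  by (simp add: abelian_group_obj_def abelian_group_obj_axioms_def commutative_ring_object_def Let_def)

lemma ring_group_simps [simp]:
  "gob ring_additive_group = R'" "gone ring_additive_group = One F" "gadd ring_additive_group = Radd R"
  "gzero ring_additive_group = Rzero R" "gsq ring_additive_group = Prod F R' R'"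
  "gprs ring_additive_group = [Pr1 F R' R', Pr2 F R' R']"
  by (simp_all add: ring_additive_group_def)

lemma ring_arrow [simp]: "R' \<in> Ob C" "Radd R \<in> Ar C" "Dom C (Radd R) = Prod F R' R'" "Cod C (Radd R) = R'"
    "Rzero R \<in> Ar C" "Dom C (Rzero R) = One F" "Cod C (Rzero R) = R'"
    "ring_neg \<in> Ar C" "Dom C ring_neg = R'" "Cod C ring_neg = R'"
proof -
  interpret G: abelian_group_obj C ring_additive_group by (rule ring_group)
  show "R' \<in> Ob C" "Radd R \<in> Ar C" "Dom C (Radd R) = Prod F R' R'" "Cod C (Radd R) = R'"
    "Rzero R \<in> Ar C" "Dom C (Rzero R) = One F" "Cod C (Rzero R) = R'"
    "ring_neg \<in> Ar C" "Dom C ring_neg = R'" "Cod C ring_neg = R'"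
    using G.gob_Ob G.gadd_hom G.gzero_hom G.neg_is_neg[unfolded G.is_neg_iff]
    by (simp_all add: Hom_def ring_neg_def)
qed

lemma ring_neg_add:
  assumes "a \<in> Ar C" "Cod C a = R'"
  shows "Radd R \<cdot> pair (ring_neg \<cdot> a) a = Rzero R \<cdot> bang (Dom C a)"
proof -
  interpret G: abelian_group_obj C ring_additive_group by (rule ring_group)
  have a: "a \<in> Hom C (Dom C a) (gob ring_additive_group)"
    and n: "ring_neg \<cdot> a \<in> Hom C (Dom C a) (gob ring_additive_group)" using assms by (simp_all add: Hom_def)
  have "Radd R \<cdot> pair (ring_neg \<cdot> a) a = G.gsum (ring_neg \<cdot> a) a"
    using assms by (simp add: G.gsum_def gpair_def pair_def Let_def)
  also have "\<dots> = G.gnull (Dom C a)"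
    by (rule trans[OF G.gsum_commute[OF n a] G.gsum_neg[OF a, folded ring_neg_def]])
  finally show ?thesis by (simp add: G.gnull_def bang_def)
qed

text \<open>Since \<open>into_fiber\<close> is given by a description, even the typing of
  \<open>eta\<close> requires the translated vector to lie over zero. Its base point is the sum of
  \<open>- \<pi>\<close> and \<open>\<pi>\<close>.\<close>

lemma eta_arrow [simp]: "eta \<in> Ar C" "Dom C eta = \<T> R'" "Cod C eta = R'"
proof -
  have S: "is_fiber_product C [Rzero R, \<pi> R'] (fob S) [bang (fob S), fincl S]" "fiso S \<in> Hom C (fob S) R'"
    using scalar_mult by (simp_all add: scalar_multiplication_def tangent_stable_def)
  let ?h = "partial2 R' R' (Radd R) \<cdot> pair (ring_neg \<cdot> \<pi> R') (Ident C (\<T> R'))"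
  have h: "?h = \<D> (Radd R) \<cdot> tan_pair R' R' (\<zeta> R' \<cdot> ring_neg \<cdot> \<pi> R') (Ident C (\<T> R'))"
    by (rule partial2_pair) simp_all
  note t = tan_pair[of R' R' "\<zeta> R' \<cdot> ring_neg \<cdot> \<pi> R'" "Ident C (\<T> R')", simplified]
  have h': "?h \<in> Ar C" "Dom C ?h = \<T> R'" "Cod C ?h = \<T> R'" unfolding h using t by simp_all
  have b: "bang (\<T> R') \<in> Hom C (\<T> R') (One F)"
    unfolding bang_def by (rule terminal_arrow[OF one_product]) simp
  have "\<pi> R' \<cdot> ?h = Radd R \<cdot> \<pi> (Prod F R' R') \<cdot> tan_pair R' R' (\<zeta> R' \<cdot> ring_neg \<cdot> \<pi> R') (Ident C (\<T> R'))"
    unfolding h using t by (simp add: proj_nat')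
  also have "\<dots> = Rzero R \<cdot> bang (\<T> R')"
    using ring_neg_add[of "\<pi> R'"] by (simp add: proj_tan_pair)
  finally have "Rzero R \<cdot> bang (\<T> R') = \<pi> R' \<cdot> ?h" ..
  from fiber_tuple(1)[OF S(1) _ h'(1) _ _ _ this] b h'
  have "into_fiber ?h \<in> Hom C (\<T> R') (fob S)"
    unfolding into_fiber_def h'(2) by (simp add: Hom_def)
  with S(2) show "eta \<in> Ar C" "Dom C eta = \<T> R'" "Cod C eta = R'"
    by (simp_all add: eta_def Hom_def)
qed

lemma kappa_arrow [simp]:
  assumes "X \<in> Ob C"
  shows "\<kappa> X \<in> Ar C" "Dom C (\<kappa> X) = Prod F R' (\<T> X)" "Cod C (\<kappa> X) = \<T> X"
  using scalar_mult assms by (auto simp: scalar_multiplication_def tangent_module_structure_def nat_trans_def Hom_def)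

lemma module: "X \<in> Ob C \<Longrightarrow> module_bundle X (tangent_bundle X) (\<kappa> X)"
  using scalar_mult by (simp add: scalar_multiplication_def tangent_module_structure_def)

definition smul :: "'o \<Rightarrow> 'm \<Rightarrow> 'm \<Rightarrow> 'm" where
  "smul X r a = \<kappa> X \<cdot> pair r a"

lemma smul_arrow [simp]:
  assumes X: "X \<in> Ob C" and ra: "r \<in> Ar C" "a \<in> Ar C" "Dom C r = Dom C a" "Cod C r = R'" "Cod C a = \<T> X"
  shows "smul X r a \<in> Ar C" "Dom C (smul X r a) = Dom C a" "Cod C (smul X r a) = \<T> X"
    "\<pi> X \<cdot> smul X r a = \<pi> X \<cdot> a"
proof -
  show "smul X r a \<in> Ar C" "Dom C (smul X r a) = Dom C a" "Cod C (smul X r a) = \<T> X"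
    using assms by (simp_all add: smul_def)
  have "\<pi> X \<cdot> \<kappa> X = \<pi> X \<cdot> Pr2 F R' (\<T> X)"
    using module[OF X] by (simp add: module_bundle_def tangent_bundle_def Let_def)
  then have "\<pi> X \<cdot> \<kappa> X \<cdot> pair r a = (\<pi> X \<cdot> Pr2 F R' (\<T> X)) \<cdot> pair r a"
    by (rule comp_reassoc) (use assms in simp_all)
  then show "\<pi> X \<cdot> smul X r a = \<pi> X \<cdot> a" using assms by (simp add: smul_def)
qed

lemma smul_comp [simp]:
  assumes X: "X \<in> Ob C" and ra: "r \<in> Ar C" "a \<in> Ar C" "Dom C r = Dom C a" "Cod C r = R'" "Cod C a = \<T> X"
    and h: "h \<in> Ar C" "Cod C h = Dom C a"
  shows "smul X r a \<cdot> h = smul X (r \<cdot> h) (a \<cdot> h)"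
  using assms by (simp add: smul_def)

lemma smul_nat:
  assumes f: "f \<in> Ar C" "Dom C f = X" and ra: "r \<in> Ar C" "a \<in> Ar C" "Dom C r = Dom C a" "Cod C r = R'" "Cod C a = \<T> X"
  shows "\<D> f \<cdot> smul X r a = smul (Cod C f) r (\<D> f \<cdot> a)"
proof -
  have "\<D> f \<cdot> \<kappa> X = \<kappa> (Cod C f) \<cdot> par idR (\<D> f)"
    using scalar_mult f by (auto simp: scalar_multiplication_def tangent_module_structure_def nat_trans_def)
  then have "\<D> f \<cdot> \<kappa> X \<cdot> pair r a = (\<kappa> (Cod C f) \<cdot> par idR (\<D> f)) \<cdot> pair r a"
    by (rule comp_reassoc) (use assms in auto)
  then show ?thesis using assms by (auto simp: smul_def)
qed

lemma smul_vadd: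
  assumes ab: "cofib X a b" and r: "r \<in> Ar C" "Dom C r = Dom C b" "Cod C r = R'"
  shows "smul X r (a \<oplus>\<^bsub>X\<^esub> b) = smul X r a \<oplus>\<^bsub>X\<^esub> smul X r b"
proof -
  note c = cofibD[OF ab] and t = tpair[OF ab]
  let ?p = "Pr1 F R' (Tpow T 2 X)" and ?q = "Pr2 F R' (Tpow T 2 X)"
  have "\<kappa> X \<cdot> par idR (\<sigma> X) = smul X ?p (p\<^sub>1 X \<cdot> ?q) \<oplus>\<^bsub>X\<^esub> smul X ?p (p\<^sub>2 X \<cdot> ?q)"
    using module[OF c(1)]
    by (simp add: module_bundle_def tangent_bundle_def bpair_def tpair_def vadd_def smul_def Let_def)
  then have "\<kappa> X \<cdot> par idR (\<sigma> X) \<cdot> pair r (tpair X a b)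
     = (smul X ?p (p\<^sub>1 X \<cdot> ?q) \<oplus>\<^bsub>X\<^esub> smul X ?p (p\<^sub>2 X \<cdot> ?q)) \<cdot> pair r (tpair X a b)"
    by (rule comp_reassoc) (use c t r in simp_all)
  moreover have "cofib X (smul X ?p (p\<^sub>1 X \<cdot> ?q)) (smul X ?p (p\<^sub>2 X \<cdot> ?q))"
    using c(1) comp_reassoc[OF square_arrow(8)[OF c(1)], of ?q] by (simp add: cofib_def)
  ultimately show ?thesis
    using vadd_comp[of X "smul X ?p (p\<^sub>1 X \<cdot> ?q)" "smul X ?p (p\<^sub>2 X \<cdot> ?q)" "pair r (tpair X a b)"] c t r
    by (simp add: smul_def vadd_def)
qed

lemma smul_zero:
  assumes X: "X \<in> Ob C" and r: "r \<in> Ar C" "x \<in> Ar C" "Dom C r = Dom C x" "Cod C r = R'" "Cod C x = X"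
  shows "smul X r (\<zeta> X \<cdot> x) = \<zeta> X \<cdot> x"
proof -
  have c: "cofib X (\<zeta> X \<cdot> x) (\<zeta> X \<cdot> x)" using assms by (simp add: cofib_def)
  have "smul X r (\<zeta> X \<cdot> x) = \<zeta> X \<cdot> \<pi> X \<cdot> smul X r (\<zeta> X \<cdot> x)"
    by (rule vadd_idem[OF X]) (use assms smul_vadd[OF c, of r] in simp_all)
  then show ?thesis using assms by simp
qed

lemma lift_smul:
  assumes X: "X \<in> Ob C" and ra: "r \<in> Ar C" "a \<in> Ar C" "Dom C r = Dom C a" "Cod C r = R'" "Cod C a = \<T> X"
  shows "\<l> X \<cdot> smul X r a = smul (\<T> X) r (\<l> X \<cdot> a)"
proof -
  have "\<l> X \<cdot> \<kappa> X = \<kappa> (\<T> X) \<cdot> par idR (\<l> X)"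
    using scalar_mult X by (simp add: scalar_multiplication_def)
  then have "\<l> X \<cdot> \<kappa> X \<cdot> pair r a = (\<kappa> (\<T> X) \<cdot> par idR (\<l> X)) \<cdot> pair r a"
    by (rule comp_reassoc) (use assms in simp_all)
  then show ?thesis using assms by (simp add: smul_def)
qed

text \<open>Differentiating \<open>\<kappa>\<close> in its vector argument leaves the scalar acting
  on the inner direction of a square, whereas \<open>\<kappa> (T X)\<close> scales the outer one;
  hence the two flips.\<close>

lemma partial2_kappa:
  assumes X: "X \<in> Ob C" and ra: "r \<in> Ar C" "B \<in> Ar C" "Dom C r = Dom C B" "Cod C r = R'" "Cod C B = \<T> (\<T> X)"
  shows "partial2 R' (\<T> X) (\<kappa> X) \<cdot> pair r B = \<tau> X \<cdot> smul (\<T> X) r (\<tau> X \<cdot> B)"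
proof -
  have "partial2 R' (\<T> X) (\<kappa> X) = \<tau> X \<cdot> \<kappa> (\<T> X) \<cdot> par idR (\<tau> X)"
    using scalar_mult X by (simp add: scalar_multiplication_def)
  then show ?thesis using assms by (simp add: smul_def)
qed

text \<open>Differentiating in the scalar argument adds a vertical vector scaled by the fiber part
  \<open>eta\<close> of the tangent scalar. For a tangent scalar \<open>T f \<cdot> v\<close> this
  factor is the derivative of \<open>f\<close> along \<open>v\<close>.\<close>

lemma partial1_kappa:
  assumes X: "X \<in> Ob C" and ab: "a \<in> Ar C" "b \<in> Ar C" "Dom C a = Dom C b" "Cod C a = \<T> R'" "Cod C b = \<T> X"
  shows "partial1 R' (\<T> X) (\<kappa> X) \<cdot> pair a b = vlift X (smul X (\<pi> R' \<cdot> a) b) (smul X (eta \<cdot> a) b)"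
proof -
  let ?P = "Prod F (Prod F R' R') (\<T> X)"
  let ?r = "smul X (pr31 R' R' (\<T> X)) (pr33 R' R' (\<T> X))" and ?s = "smul X (pr32 R' R' (\<T> X)) (pr33 R' R' (\<T> X))"
  have pr: "pr31 R' R' (\<T> X) \<in> Ar C" "Dom C (pr31 R' R' (\<T> X)) = ?P" "Cod C (pr31 R' R' (\<T> X)) = R'"
    "pr32 R' R' (\<T> X) \<in> Ar C" "Dom C (pr32 R' R' (\<T> X)) = ?P" "Cod C (pr32 R' R' (\<T> X)) = R'"
    "pr33 R' R' (\<T> X) \<in> Ar C" "Dom C (pr33 R' R' (\<T> X)) = ?P" "Cod C (pr33 R' R' (\<T> X)) = \<T> X"
    using X by (simp_all add: pr31_def pr32_def pr33_def)
  have c: "cofib X ?r ?s" using X pr by (simp add: cofib_def)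
  note t = tpair[OF c]
  let ?h = "pair (pair (\<pi> R' \<cdot> a) (eta \<cdot> a)) b"
  have c': "cofib X (smul X (\<pi> R' \<cdot> a) b) (smul X (eta \<cdot> a) b)" using X ab by (simp add: cofib_def)
  have th: "tpair X ?r ?s \<cdot> ?h = tpair X (smul X (\<pi> R' \<cdot> a) b) (smul X (eta \<cdot> a) b)"
    using tpair_comp[OF c, of ?h] pr X ab by (simp add: pr31_def pr32_def pr33_def)
  have el: "ext_lift X \<in> Ar C" "Dom C (ext_lift X) = Tpow T 2 X"
  proof -
    have "cofib (\<T> X) (\<D> (\<zeta> X) \<cdot> p\<^sub>1 X) (\<l> X \<cdot> p\<^sub>2 X)"
      by (rule cofib_vlift) (use X in \<open>auto simp: cofib_def\<close>)
    from tpair[OF this] X show "ext_lift X \<in> Ar C" "Dom C (ext_lift X) = Tpow T 2 X"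
      by (simp_all add: ext_lift_def)
  qed
  have "partial1 R' (\<T> X) (\<kappa> X) = ext_lift X \<cdot> tpair X ?r ?s \<cdot> par (pair (\<pi> R') eta) (Ident C (\<T> X))"
    using scalar_mult X by (simp add: scalar_multiplication_def smul_def)
  then have "partial1 R' (\<T> X) (\<kappa> X) \<cdot> pair a b = ext_lift X \<cdot> tpair X ?r ?s \<cdot> ?h"
    using X ab pr t el by simp
  then show ?thesis unfolding th ext_lift_vlift[OF c'] .
qed

text \<open>After a flip, multiplication by \<open>r\<close> is \<open>T \<kappa>\<close> at the
  zero vector over \<open>r\<close>, hence additive by naturality of \<open>\<sigma>\<close>. The
  summand \<open>T \<zeta> \<cdot> a\<close> is the flip of a zero vector and stays fixed, while
  \<open>\<l> \<cdot> k\<close> is scaled through \<open>\<l>\<close> by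
  \<open>lift_smul\<close>.\<close>

lemma smul_vlift:
  assumes ak: "cofib X a k" and r: "r \<in> Ar C" "Dom C r = Dom C k" "Cod C r = R'"
  shows "smul (\<T> X) r (vlift X a k) = vlift X a (smul X r k)"
proof -
  note c = cofibD[OF ak] and d = cofib_vlift[OF ak]
  note va = vadd_arrow[OF d]
  let ?x = "(\<D> (\<zeta> X) \<cdot> a) \<oplus>\<^bsub>\<T> X\<^esub> (\<l> X \<cdot> k)"
  have rr: "cofib R' (\<zeta> R' \<cdot> r) (\<zeta> R' \<cdot> r)" using r by (simp add: cofib_def)
  note tt = tan_pair_vadd[OF rr d]
  have S: "\<D> (\<kappa> X) \<cdot> tan_pair R' (\<T> X) (\<zeta> R' \<cdot> r) B = \<tau> X \<cdot> smul (\<T> X) r (\<tau> X \<cdot> B)"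
    if "B \<in> Ar C" "Dom C B = Dom C k" "Cod C B = \<T> (\<T> X)" for B
    using partial2_pair[of R' "\<T> X" "\<kappa> X" r B] partial2_kappa[of X r B] that c r by simp
  have "\<tau> X \<cdot> smul (\<T> X) r (vlift X a k) = \<D> (\<kappa> X) \<cdot> tan_pair R' (\<T> X) (\<zeta> R' \<cdot> r) ?x"
    using S[of ?x] va c by (simp add: vlift_def)
  also have "\<dots> = (\<D> (\<kappa> X) \<cdot> tan_pair R' (\<T> X) (\<zeta> R' \<cdot> r) (\<D> (\<zeta> X) \<cdot> a))
      \<oplus>\<^bsub>\<T> X\<^esub> (\<D> (\<kappa> X) \<cdot> tan_pair R' (\<T> X) (\<zeta> R' \<cdot> r) (\<l> X \<cdot> k))"
    using tt vadd_nat[OF tt(2), of "\<kappa> X"] c r by simp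
  also have "\<dots> = (\<D> (\<zeta> X) \<cdot> a) \<oplus>\<^bsub>\<T> X\<^esub> (\<l> X \<cdot> smul X r k)"
    using c r S[of "\<D> (\<zeta> X) \<cdot> a"] S[of "\<l> X \<cdot> k"] smul_zero[of "\<T> X" r a] lift_smul[of X r k, symmetric]
    by simp
  also have "\<dots> = \<tau> X \<cdot> vlift X a (smul X r k)"
    by (rule flip_vlift[symmetric]) (use c r in \<open>simp add: cofib_def\<close>)
  finally have "\<tau> X \<cdot> \<tau> X \<cdot> smul (\<T> X) r (vlift X a k) = \<tau> X \<cdot> \<tau> X \<cdot> vlift X a (smul X r k)"
    by (simp only:)
  moreover have "cofib X a (smul X r k)" using c r by (simp add: cofib_def)
  ultimately show ?thesis using c r vlift_arrow[OF ak] by simp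
qed

lemma smul_act:
  assumes A: "actable X A k" and r: "r \<in> Ar C" "Dom C r = Dom C k" "Cod C r = R'"
  shows "smul (\<T> X) r (A \<lhd>\<^bsub>X\<^esub> k) = smul (\<T> X) r A \<lhd>\<^bsub>X\<^esub> smul X r k"
proof -
  note a = actableD[OF A]
  have p: "\<pi> (\<T> X) \<cdot> smul (\<T> X) r A = \<pi> (\<T> X) \<cdot> A" using a r by simp
  show "smul (\<T> X) r (A \<lhd>\<^bsub>X\<^esub> k) = smul (\<T> X) r A \<lhd>\<^bsub>X\<^esub> smul X r k"
    unfolding act_def p using smul_vadd[OF cofib_act[OF A], of r] smul_vlift[OF a(3) r] a r by simp
qed

lemma smul_vector_field:
  assumes X: "X \<in> Ob C" and f: "f \<in> Hom C X R'" and w: "w \<in> vector_fields X"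
  shows "smul X f w \<in> vector_fields X"
  using f vector_fieldD[OF w X] X by (intro vector_fieldI) (simp_all add: Hom_def)

lemma derivation_hom:
  assumes X: "X \<in> Ob C" and f: "f \<in> Hom C X R'" and v: "v \<in> vector_fields X"
  shows "derivation v f \<in> Hom C X R'"
  using f vector_fieldD[OF v X] X by (simp add: derivation_def Hom_def)

lemma leibniz:
  assumes X: "X \<in> Ob C" and v: "v \<in> vector_fields X" and w: "w \<in> vector_fields X" and f: "f \<in> Hom C X R'"
  shows "vf_bracket X v (smul X f w) = smul X f (vf_bracket X v w) \<oplus>\<^bsub>X\<^esub> smul X (derivation v f) w"
proof (rule bracket_eqI[OF X v smul_vector_field[OF X f w]])
  let ?k = "vf_bracket X v w" and ?fw = "smul X f w"
  note k = bracket_vector_field[OF X v w]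
  note v' = vector_fieldD[OF v X] and w' = vector_fieldD[OF w X] and k' = vector_fieldD[OF k X]
  have f': "f \<in> Ar C" "Dom C f = X" "Cod C f = R'" using f by (auto simp: Hom_def)
  note g = derivation_hom[OF X f v]
  note fk = smul_vector_field[OF X f k] and gw = smul_vector_field[OF X g w] and fw = smul_vector_field[OF X f w]
  note fw' = vector_fieldD[OF fw X]
  show "smul X f ?k \<oplus>\<^bsub>X\<^esub> smul X (derivation v f) w \<in> vector_fields X"
    by (rule vector_field_vadd[OF fk gw X])
  have p: "\<pi> R' \<cdot> \<D> f \<cdot> v = f" "\<pi> (\<T> X) \<cdot> \<D> w \<cdot> v = w" using f' v' w' X by (simp_all add: proj_nat')
  have "\<D> ?fw \<cdot> v = \<D> (\<kappa> X) \<cdot> \<D> (pair f w) \<cdot> v" using f' v' w' X by (simp add: smul_def)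
  also have "\<D> (pair f w) \<cdot> v = tan_pair R' (\<T> X) (\<D> f \<cdot> v) (\<D> w \<cdot> v)"
    using tan_ar_pair[of f w v] f' v' w' by simp
  also have "\<D> (\<kappa> X) \<cdot> tan_pair R' (\<T> X) (\<D> f \<cdot> v) (\<D> w \<cdot> v)
     = (partial1 R' (\<T> X) (\<kappa> X) \<cdot> pair (\<D> f \<cdot> v) w) \<oplus>\<^bsub>\<T> X\<^esub> (partial2 R' (\<T> X) (\<kappa> X) \<cdot> pair f (\<D> w \<cdot> v))"
    using tan_ar_tan_pair[of R' "\<T> X" "\<kappa> X" "\<D> f \<cdot> v" "\<D> w \<cdot> v"] f' v' w' X p by simp
  also have "partial1 R' (\<T> X) (\<kappa> X) \<cdot> pair (\<D> f \<cdot> v) w = vlift X ?fw (smul X (derivation v f) w)"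
    using partial1_kappa[of X "\<D> f \<cdot> v" w] f' v' w' X p by (simp add: derivation_def)
  \<comment> \<open>The inner flip of (S3) turns \<open>T w \<cdot> v\<close> into the left side of
    the flipped bracket equation.\<close>
  also have "partial2 R' (\<T> X) (\<kappa> X) \<cdot> pair f (\<D> w \<cdot> v) = \<tau> X \<cdot> smul (\<T> X) f ((\<D> v \<cdot> w) \<lhd>\<^bsub>X\<^esub> ?k)"
    using partial2_kappa[of X f "\<D> w \<cdot> v"] bracket_eqn_flip[OF X v w] f' v' w' X by simp
  \<comment> \<open>Naturality of \<open>\<kappa>\<close> at the arrow \<open>v\<close> moves
    \<open>f\<close> inside: scaling \<open>T v \<cdot> w\<close> by \<open>f\<close> gives
    \<open>T v\<close> of the scaled field.\<close>
  also have "\<dots> = (\<tau> X \<cdot> \<D> v \<cdot> ?fw) \<lhd>\<^bsub>X\<^esub> smul X f ?k"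
    using smul_act[OF actable_flow(2)[OF X v w k], of f] smul_nat[of v X f w]
      act_flip[OF actable_flow(2)[OF X v fw fk]] f' v' w' k' by simp
  \<comment> \<open>The second summand has \<open>?fw\<close> as \<open>\<pi>\<close>-edge, which is
    the base of the lift, so adding the lift is an action by its vector.\<close>
  also have "vlift X ?fw (smul X (derivation v f) w) \<oplus>\<^bsub>\<T> X\<^esub> ((\<tau> X \<cdot> \<D> v \<cdot> ?fw) \<lhd>\<^bsub>X\<^esub> smul X f ?k)
     = ((\<tau> X \<cdot> \<D> v \<cdot> ?fw) \<lhd>\<^bsub>X\<^esub> smul X f ?k) \<lhd>\<^bsub>X\<^esub> smul X (derivation v f) w"
  proof -
    note A = actable_flow(1)[OF X v fw fk]
    have q: "\<pi> (\<T> X) \<cdot> ((\<tau> X \<cdot> \<D> v \<cdot> ?fw) \<lhd>\<^bsub>X\<^esub> smul X f ?k) = ?fw"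
      unfolding act_arrow(4)[OF A] using v' fw' X by simp
    have c: "cofib X ?fw (smul X (derivation v f) w)" by (rule vector_field_cofib[OF fw gw X])
    have "cofib (\<T> X) (vlift X ?fw (smul X (derivation v f) w)) ((\<tau> X \<cdot> \<D> v \<cdot> ?fw) \<lhd>\<^bsub>X\<^esub> smul X f ?k)"
      using act_arrow[OF A] q vlift_arrow[OF c] vector_fieldD[OF gw X] vector_fieldD[OF fk X] X
      by (simp add: cofib_def)
    from vadd_commute[OF this] show ?thesis unfolding act_def[of "_ \<lhd>\<^bsub>_\<^esub> _"] q .
  qed
  also have "\<dots> = (\<tau> X \<cdot> \<D> v \<cdot> ?fw) \<lhd>\<^bsub>X\<^esub> (smul X f ?k \<oplus>\<^bsub>X\<^esub> smul X (derivation v f) w)"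
    by (rule act_act[OF actable_flow(1)[OF X v fw fk] vector_field_cofib[OF fk gw X]])
  finally show "\<D> ?fw \<cdot> v = (\<tau> X \<cdot> \<D> v \<cdot> ?fw) \<lhd>\<^bsub>X\<^esub> (smul X f ?k \<oplus>\<^bsub>X\<^esub> smul X (derivation v f) w)" .
qed

lemma tangent_lie_algebroid:
  assumes X: "X \<in> Ob C"
  shows "abstract_lie_algebroid X (tangent_bundle X) (\<kappa> X) (Ident C (\<T> X)) (vf_bracket X)"
  unfolding abstract_lie_algebroid_def
proof (intro conjI ballI)
  have sec: "sections C X (tangent_bundle X) = vector_fields X"
    by (simp add: sections_def vector_fields_def tangent_bundle_def)
  have pp: "cofib X (p\<^sub>1 X) (p\<^sub>2 X)" using X by (auto simp: cofib_def)
  \<comment> \<open>For the identity anchor, linearity comes down to two universal properties: the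
    tuple of the projections and the product of identities are identities.\<close>
  have "tpair X (p\<^sub>1 X) (p\<^sub>2 X) = Ident C (Tpow T 2 X)"
    by (rule tpair_eqI[OF pp, symmetric]) (use X in simp_all)
  moreover have "par idR (Ident C (\<T> X)) = Ident C (Prod F R' (\<T> X))"
    by (rule product_eqI[OF product[of R' "\<T> X"]]) (use X in \<open>simp_all add: par_def Let_def\<close>)
  ultimately show "module_bundle_morphism (tangent_bundle X) (\<kappa> X) (tangent_bundle X) (\<kappa> X) (Ident C (\<T> X))"
    using X by (simp add: module_bundle_morphism_def tangent_bundle_def bpair_def tpair_def Hom_def)
  show "module_bundle X (tangent_bundle X) (\<kappa> X)" by (rule module[OF X])
  show "lie_bracket (vf_group X) (vf_bracket X)" by (rule bracket_lie[OF X])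
  fix a b
  assume ab: "a \<in> sections C X (tangent_bundle X)" "b \<in> sections C X (tangent_bundle X)"
  then have a: "a \<in> vector_fields X" and b: "b \<in> vector_fields X" by (simp_all add: sec)
  have I: "Ident C (\<T> X) \<cdot> c = c" if "c \<in> vector_fields X" for c
    using vector_fieldD[OF that X] X by simp
  show "Ident C (\<T> X) \<cdot> vf_bracket X a b = vf_bracket X (Ident C (\<T> X) \<cdot> a) (Ident C (\<T> X) \<cdot> b)"
    using I a b bracket_vector_field[OF X a b] by simp
  fix f assume "f \<in> Hom C X R'"
  from leibniz[OF X a b this]
  show "vf_bracket X a (\<kappa> X \<cdot> pair f b) = badd (tangent_bundle X) \<cdot>
      bpair C (tangent_bundle X) (\<kappa> X \<cdot> pair f (vf_bracket X a b))
        (\<kappa> X \<cdot> pair (derivation (Ident C (\<T> X) \<cdot> a) f) b)"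
    unfolding I[OF a] by (simp add: smul_def vadd_def tpair_def bpair_def tangent_bundle_def)
qed

end

theorem theorem6p12:
  fixes C :: "('o, 'm) cat" and F :: "('o, 'm) products" and T :: "('o, 'm) tangent"
    and R :: "('o, 'm) ring_data" and \<kappa> :: "'o \<Rightarrow> 'm" and S :: "('o, 'm) tangent_fiber" and X :: 'o
  assumes "scalar_tangent_category C F T R \<kappa> S"
    and "X \<in> Ob C"
  shows "scalar_data.abstract_lie_algebroid C F T R \<kappa> S X
           (tangent_data.tangent_bundle T X) (\<kappa> X) (Ident C (Tob T X))
           (tangent_data.vf_bracket C T X)"
  using assms by (rule scalar_tangent_category.tangent_lie_algebroid)

end
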